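(* Let $n$ be an odd number, $h_n:=(n-1)/2$, and let $\alpha\in\mathbb N$ be such that $1\le\alpha\le h_n-1$. Let $T\in\mathcal{BC}^1(V_n)$ be such that its components $T_i$, $i=1,\dots,n$, have real spectra. Then for every left (resp. right) slice hyperholomorphic function $f$ and every bounded slice Cauchy domain $U$ with $\sigma_S(T)\subset U$ and $\overline U\subset\mathrm{dom}(f)$, the integral $$\frac1{2\pi}\int_{\partial(U\cap\mathbb C_I)}\mathcal K_\alpha^L(s,T)\,ds_I\,f(s)\qquad\Big(\text{resp. }\ \frac1{2\pi}\int_{\partial(U\cap\mathbb C_I)}f(s)\,ds_I\,\mathcal K_\alpha^R(s,T)\Big)$$ is independent of the choice of such a slice Cauchy domain $U$ and of the imaginary unit $I\in\mathbb S$.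
   Context: $\mathbb R_n$ is the real Clifford algebra generated by $e_1,\dots,e_n$ with $e_ie_j+e_je_i=-2\delta_{ij}$. A point $(x_0,\dots,x_n)\in\mathbb R^{n+1}$ is identified with the paravector $x=x_0+\underline x$, $\underline x=\sum_{j=1}^n x_je_j$ (with $e_0=1$). $\mathbb S$ is the set of $\underline x$ with $|\underline x|=1$; for $I\in\mathbb S$, $\mathbb C_I=\mathbb R+I\mathbb R$. $[x]=\{x_0+I|\underline x|: I\in\mathbb S\}$. An open $U\subset\mathbb R^{n+1}$ is axially symmetric if $[x]\subset U$ for all $x\in U$; it is a slice Cauchy domain if it is axially symmetric and, for every $I\in\mathbb S$, $\partial(U\cap\mathbb C_I)$ is a finite union of non-intersecting piecewise continuously differentiable Jordan curves in $\mathbb C_I$ (positively oriented). $ds_I=ds(-I)$. For $U$ axially symmetric open let $\mathcal U=\{(u,v)\in\mathbb R^2: u+\mathbb S v\subset U\}$. $f:U\to\mathbb R_n$ is left (resp. right) slice hyperholomorphic if $f(u+Iv)=a(u,v)+I\,b(u,v)$ (resp. $a(u,v)+b(u,v)I$) for all $I\in\mathbb S$, $(u,v)\in\mathcal U$, with differentiable $a,b:\mathcal U\to\mathbb R_n$ satisfying $a(u,-v)=a(u,v)$, $b(u,-v)=-b(u,v)$ and $\partial_ua=\partial_vb$, $\partial_va=-\partial_ub$. The domain $\mathrm{dom}(f)$ is an axially symmetric open set. $V$ is a real Banach space, $\mathcal B(V)$ its bounded linear operators, $V_n=V\otimes\mathbb R_n$ the two-sided Banach $\mathbb R_n$-module,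 $\mathcal B(V_n)$ the set of $\sum_A T_Ae_A$, $T_A\in\mathcal B(V)$, with $(\sum_AT_Ae_A)(\sum_Bv_Be_B)=\sum_{A,B}T_A(v_B)e_Ae_B$ and norm $\sum_A\|T_A\|$; $\mathbb R_n$ is embedded via $a\mapsto\mathcal I a$. $\mathcal{BC}^{0,1}(V_n)$ is the set of $T=\sum_{\mu=0}^ne_\mu T_\mu$ with pairwise commuting $T_\mu\in\mathcal B(V)$; $\mathcal{BC}^1(V_n)$ is the subset with $T_0=0$. $\overline T=T_0-\sum_{\mu\ge1}e_\mu T_\mu$. $\sigma_S(T)$ is the set of $s\in\mathbb R^{n+1}$ such that $T^2-2s_0T+|s|^2\mathcal I$ is not invertible in $\mathcal B(V_n)$ (equivalently, for commuting components, $\mathcal Q_{c,s}(T):=s^2\mathcal I-s(T+\overline T)+T\overline T$ is not invertible in $\mathcal B(V_n)$); $\rho_S(T)=\mathbb R^{n+1}\setminus\sigma_S(T)$. The spectrum of $T_i$ is the usual one (in the complexification of $V$). For $s\in\rho_S(T)$: $\mathcal K_\alpha^L(s,T)=k_\alpha(s\mathcal I-\overline T)\mathcal Q_{c,s}(T)^{-\alpha-1}$, $\mathcal K_\alpha^R(s,T)=k_\alpha\mathcal Q_{c,s}(T)^{-\alpha-1}(s\mathcal I-\overline T)$, $k_\alpha=4^\alpha\alpha!\,(-h_n)_\alpha$, $(-h_n)_\alpha=(-1)^\alpha\frac{h_n!}{(h_n-\alpha)!}$. (These integrals define the holomorphic Cliffordian functional calculus.) *)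

theory Defs
  imports "HOL-Complex_Analysis.Winding_Numbers"
begin

section \<open>The algebra of bounded operators\<close>

text \<open>
  \<open>'v endo\<close> is \<open>B(V)\<close>: a copy of \<open>'v \<Rightarrow>\<^sub>L 'v\<close> carrying composition as multiplication. It is not
  an instance of \<^class>\<open>ring_1\<close> because \<open>V = {0}\<close> is allowed.
\<close>

typedef (overloaded) ('v::real_normed_vector) endo = "UNIV :: ('v \<Rightarrow>\<^sub>L 'v) set"
  morphisms blinfun_of_endo Endo ..

setup_lifting type_definition_endo

instantiation endo :: (real_normed_vector) "{real_normed_algebra, monoid_mult}"
begin

lift_definition zero_endo :: "'a endo" is 0 .
lift_definition one_endo :: "'a endo" is id_blinfun .
lift_definition plus_endo :: "'a endo \<Rightarrow> 'a endo \<Rightarrow> 'a endo" is "(+)" .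
lift_definition minus_endo :: "'a endo \<Rightarrow> 'a endo \<Rightarrow> 'a endo" is "(-)" .
lift_definition uminus_endo :: "'a endo \<Rightarrow> 'a endo" is "uminus" .
lift_definition times_endo :: "'a endo \<Rightarrow> 'a endo \<Rightarrow> 'a endo" is "(o\<^sub>L)" .
lift_definition scaleR_endo :: "real \<Rightarrow> 'a endo \<Rightarrow> 'a endo" is "(*\<^sub>R)" .
lift_definition norm_endo :: "'a endo \<Rightarrow> real" is norm .
lift_definition sgn_endo :: "'a endo \<Rightarrow> 'a endo" is sgn .
lift_definition dist_endo :: "'a endo \<Rightarrow> 'a endo \<Rightarrow> real" is dist .
definition uniformity_endo :: "('a endo \<times> 'a endo) filter"
  where "uniformity_endo = (INF e\<in>{0<..}. principal {(x, y). dist x y < e})"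
definition open_endo :: "'a endo set \<Rightarrow> bool"
  where "open_endo S = (\<forall>x\<in>S. \<forall>\<^sub>F (x', y) in uniformity. x' = x \<longrightarrow> y \<in> S)"

instance
proof
  fix a b c :: "'a endo" and r s :: real
  show "a + b + c = a + (b + c)" "a + b = b + a" "0 + a = a" "- a + a = 0" "a - b = a + - b"
    by (transfer; simp)+
  show "r *\<^sub>R (a + b) = r *\<^sub>R a + r *\<^sub>R b" "(r + s) *\<^sub>R a = r *\<^sub>R a + s *\<^sub>R a"
    "r *\<^sub>R s *\<^sub>R a = (r * s) *\<^sub>R a" "1 *\<^sub>R a = a"
    by (transfer; simp add: scaleR_add_left scaleR_add_right)+
  show "a * b * c = a * (b * c)" by (transfer; auto intro!: blinfun_eqI)
  show "(a + b) * c = a * c + b * c" "a * (b + c) = a * b + a * c"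
    by (transfer; auto intro!: blinfun_eqI simp: blinfun.add_left blinfun.add_right)+
  show "r *\<^sub>R a * b = r *\<^sub>R (a * b)" "a * r *\<^sub>R b = r *\<^sub>R (a * b)"
    by (transfer; auto intro!: blinfun_eqI simp: blinfun.scaleR_left blinfun.scaleR_right)+
  show "1 * a = a" "a * 1 = a"
    by (transfer; auto intro!: blinfun_eqI)+
  show "dist a b = norm (a - b)" by (transfer; simp add: dist_norm)
  show "sgn a = inverse (norm a) *\<^sub>R a" by (transfer; simp add: sgn_div_norm)
  show "(uniformity :: ('a endo \<times> 'a endo) filter) = (INF e\<in>{0<..}. principal {(x, y). dist x y < e})"
    by (rule uniformity_endo_def)
  show "open S = (\<forall>x\<in>S. \<forall>\<^sub>F (x', y) in uniformity. x' = x \<longrightarrow> y \<in> S)" for S :: "'a endo set"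
    by (rule open_endo_def)
  show "(norm a = 0) = (a = 0)" by (transfer; simp)
  show "norm (a + b) \<le> norm a + norm b" by (transfer; rule norm_triangle_ineq)
  show "norm (r *\<^sub>R a) = \<bar>r\<bar> * norm a" by (transfer; simp)
  show "norm (a * b) \<le> norm a * norm b" by (transfer; rule norm_blinfun_compose)
qed

end

lemma blinfun_of_endo_mult_apply:
  "blinfun_apply (blinfun_of_endo (S * T)) v
     = blinfun_apply (blinfun_of_endo S) (blinfun_apply (blinfun_of_endo T) v)"
  by transfer simp

instance endo :: (banach) banach
proof
  fix X :: "nat \<Rightarrow> 'a endo"
  assume "Cauchy X"
  then have "Cauchy (\<lambda>n. blinfun_of_endo (X n))"
    unfolding Cauchy_def by (simp add: dist_endo.rep_eq)
  then obtain L where L: "(\<lambda>n. blinfun_of_endo (X n)) \<longlonglongrightarrow> L"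
    using Cauchy_convergent convergent_def by blast
  then have "X \<longlonglongrightarrow> Endo L"
    unfolding tendsto_iff by (simp add: dist_endo.rep_eq Endo_inverse)
  then show "convergent X" by (rule convergentI)
qed

section \<open>Clifford algebras\<close>

text \<open>
  \<open>('a, 'n) cliff\<close> consists of the formal sums \<open>\<Sum>\<^sub>A x\<^sub>A e\<^sub>A\<close> with \<open>x\<^sub>A :: 'a\<close> and \<open>A\<close> ranging over the
  subsets of \<open>'n\<close>, where \<open>n = CARD('n)\<close> and \<open>e\<^sub>A = e\<^bsub>i1\<^esub> \<cdots> e\<^bsub>ik\<^esub>\<close> for \<open>A = {i1 < \<cdots> < ik}\<close>. Thus
  \<open>(real, 'n) cliff\<close> is the real Clifford algebra, \<open>('v, 'n) cliff\<close> the module \<open>V\<^sub>n\<close>, and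
  \<open>('v endo, 'n) cliff\<close> the algebra \<open>B(V\<^sub>n)\<close>. The norm is \<open>\<Sum>\<^sub>A \<parallel>x\<^sub>A\<parallel>\<close> in all three cases.
\<close>

typedef ('a, 'n) cliff = "UNIV :: ('n set \<Rightarrow> 'a) set"
  morphisms coef Cliff ..

setup_lifting type_definition_cliff

text \<open>
  \<open>e\<^sub>A e\<^sub>B = csign A B e\<^sub>C\<close> with \<open>C = sym_diff A B\<close>: each \<open>i \<in> A\<close> has to pass all \<open>j \<in> B\<close> with \<open>j < i\<close>,
  and \<open>j = i\<close> contributes \<open>e\<^sub>i\<^sup>2 = -1\<close>.
\<close>

definition csign :: "'n::{finite,linorder} set \<Rightarrow> 'n set \<Rightarrow> real"
  where "csign A B = (- 1) ^ card {(i, j). i \<in> A \<and> j \<in> B \<and> j \<le> i}"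

lemma csign_prod:
  "csign A B = (\<Prod>(i, j)\<in>UNIV. (if i \<in> A then if j \<in> B then if j \<le> i then - 1 else 1 else 1 else 1))"
proof -
  have "csign A B = (\<Prod>p\<in>{p. fst p \<in> A \<and> snd p \<in> B \<and> snd p \<le> fst p}. (- 1 :: real))"
    unfolding csign_def case_prod_beta by simp
  also have "\<dots> = (\<Prod>p\<in>UNIV. if fst p \<in> A \<and> snd p \<in> B \<and> snd p \<le> fst p then - 1 else 1)"
    by (subst prod.inter_filter[symmetric]) simp_all
  also have "\<dots> = (\<Prod>(i, j)\<in>UNIV. (if i \<in> A then if j \<in> B then if j \<le> i then - 1 else 1 else 1 else 1))"
    by (rule prod.cong) auto
  finally show ?thesis .
qed

lemma csign_left: "csign (sym_diff A B) C = csign A C * csign B C"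
  unfolding csign_prod prod.distrib [symmetric] by (intro prod.cong) auto

lemma csign_right: "csign A (sym_diff B C) = csign A B * csign A C"
  unfolding csign_prod prod.distrib [symmetric] by (intro prod.cong) auto

lemma csign_empty [simp]: "csign {} A = 1" "csign A {} = 1"
  by (simp_all add: csign_def)

lemma abs_csign [simp]: "\<bar>csign A B\<bar> = 1"
  by (simp add: csign_def power_abs)

text \<open>
  The bilinear extension of \<open>(a e\<^sub>A, b e\<^sub>B) \<mapsto> f a b e\<^sub>A e\<^sub>B\<close>; the contributions to \<open>e\<^sub>C\<close> come from the pairs
  \<open>(A, B)\<close> with \<open>B = sym_diff A C\<close>.
\<close>

lift_definition cprod :: "('a \<Rightarrow> 'b \<Rightarrow> 'c::real_vector)
    \<Rightarrow> ('a, 'n::{finite,linorder}) cliff \<Rightarrow> ('b, 'n) cliff \<Rightarrow> ('c, 'n) cliff"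
  is "\<lambda>f x y C. \<Sum>A\<in>UNIV. csign A (sym_diff A C) *\<^sub>R f (x A) (y (sym_diff A C))" .

lemma sym_diff_sum_reindex:
  fixes g :: "'n::finite set \<Rightarrow> 'b::comm_monoid_add"
  shows "(\<Sum>E\<in>UNIV. g (sym_diff A E)) = (\<Sum>E\<in>UNIV. g E)"
proof (rule sum.reindex_bij_witness[where i = "sym_diff A" and j = "sym_diff A"])
qed auto

lemma cprod_assoc:
  fixes f :: "'a::real_vector \<Rightarrow> 'b::real_vector \<Rightarrow> 'd::real_vector"
    and g :: "'d \<Rightarrow> 'c::real_vector \<Rightarrow> 'e::real_vector"
    and h :: "'b \<Rightarrow> 'c \<Rightarrow> 'k::real_vector" and k :: "'a \<Rightarrow> 'k \<Rightarrow> 'e"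
    and x :: "('a, 'n::{finite,linorder}) cliff"
  assumes g: "\<And>c. linear (\<lambda>d. g d c)" and k: "\<And>a. linear (k a)"
    and gf: "\<And>a b c. g (f a b) c = k a (h b c)"
  shows "cprod g (cprod f x y) z = cprod k x (cprod h y z)"
proof (transfer fixing: f g h k, rule ext)
  fix x :: "'n set \<Rightarrow> 'a" and y :: "'n set \<Rightarrow> 'b" and z :: "'n set \<Rightarrow> 'c" and D :: "'n set"
  have sd: "sym_diff A (sym_diff A B) = B" for A B :: "'n set" by auto
  have sd2: "sym_diff (sym_diff A B) D = sym_diff B (sym_diff A D)" for A B :: "'n set" by auto
  have sd3: "csign A (sym_diff A D) = csign A B * csign A (sym_diff B (sym_diff A D))" for A B :: "'n set"
    unfolding csign_right [symmetric] by (rule arg_cong[of _ _ "csign A"]) auto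
  have "(\<Sum>E\<in>UNIV. csign E (sym_diff E D) *\<^sub>R
            g (\<Sum>A\<in>UNIV. csign A (sym_diff A E) *\<^sub>R f (x A) (y (sym_diff A E))) (z (sym_diff E D)))
      = (\<Sum>E\<in>UNIV. \<Sum>A\<in>UNIV. (csign E (sym_diff E D) * csign A (sym_diff A E)) *\<^sub>R
            g (f (x A) (y (sym_diff A E))) (z (sym_diff E D)))"
    by (simp add: linear_sum[OF g] linear_scale[OF g] scaleR_sum_right)
  also have "\<dots> = (\<Sum>A\<in>UNIV. \<Sum>E\<in>UNIV. (csign E (sym_diff E D) * csign A (sym_diff A E)) *\<^sub>R
            k (x A) (h (y (sym_diff A E)) (z (sym_diff E D))))"
    by (subst sum.swap) (simp add: gf)
  also have "\<dots> = (\<Sum>A\<in>UNIV. \<Sum>B\<in>UNIV. (csign (sym_diff A B) (sym_diff (sym_diff A B) D)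
            * csign A (sym_diff A (sym_diff A B))) *\<^sub>R
            k (x A) (h (y (sym_diff A (sym_diff A B))) (z (sym_diff (sym_diff A B) D))))"
    by (rule sum.cong[OF refl], rule sym_diff_sum_reindex[symmetric])
  also have "\<dots> = (\<Sum>A\<in>UNIV. \<Sum>B\<in>UNIV. (csign A (sym_diff A D) * csign B (sym_diff B (sym_diff A D))) *\<^sub>R
            k (x A) (h (y B) (z (sym_diff B (sym_diff A D)))))"
  proof (intro sum.cong refl)
    fix A B :: "'n set"
    let ?C = "sym_diff B (sym_diff A D)"
    have "csign (sym_diff A B) ?C * csign A B = csign A (sym_diff A D) * csign B ?C"
      unfolding csign_left sd3[of A B] by (simp add: mult_ac)
    then show "(csign (sym_diff A B) (sym_diff (sym_diff A B) D) * csign A (sym_diff A (sym_diff A B))) *\<^sub>R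
            k (x A) (h (y (sym_diff A (sym_diff A B))) (z (sym_diff (sym_diff A B) D)))
      = (csign A (sym_diff A D) * csign B ?C) *\<^sub>R k (x A) (h (y B) (z ?C))"
      unfolding sd sd2 by simp
  qed
  also have "\<dots> = (\<Sum>A\<in>UNIV. csign A (sym_diff A D) *\<^sub>R k (x A)
            (\<Sum>B\<in>UNIV. csign B (sym_diff B (sym_diff A D)) *\<^sub>R h (y B) (z (sym_diff B (sym_diff A D)))))"
    by (simp add: linear_sum[OF k] linear_scale[OF k] scaleR_sum_right)
  finally show "(\<Sum>E\<in>UNIV. csign E (sym_diff E D) *\<^sub>R
            g (\<Sum>A\<in>UNIV. csign A (sym_diff A E) *\<^sub>R f (x A) (y (sym_diff A E))) (z (sym_diff E D)))
      = (\<Sum>A\<in>UNIV. csign A (sym_diff A D) *\<^sub>R k (x A)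
            (\<Sum>B\<in>UNIV. csign B (sym_diff B (sym_diff A D)) *\<^sub>R h (y B) (z (sym_diff B (sym_diff A D)))))" .
qed

instantiation cliff :: (real_normed_vector, finite) real_normed_vector
begin

lift_definition zero_cliff :: "('a, 'b) cliff" is "\<lambda>A. 0" .
lift_definition plus_cliff :: "('a, 'b) cliff \<Rightarrow> ('a, 'b) cliff \<Rightarrow> ('a, 'b) cliff"
  is "\<lambda>x y A. x A + y A" .
lift_definition minus_cliff :: "('a, 'b) cliff \<Rightarrow> ('a, 'b) cliff \<Rightarrow> ('a, 'b) cliff"
  is "\<lambda>x y A. x A - y A" .
lift_definition uminus_cliff :: "('a, 'b) cliff \<Rightarrow> ('a, 'b) cliff" is "\<lambda>x A. - x A" .
lift_definition scaleR_cliff :: "real \<Rightarrow> ('a, 'b) cliff \<Rightarrow> ('a, 'b) cliff"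
  is "\<lambda>r x A. r *\<^sub>R x A" .
definition norm_cliff :: "('a, 'b) cliff \<Rightarrow> real"
  where "norm_cliff x = (\<Sum>A\<in>UNIV. norm (coef x A))"
definition sgn_cliff :: "('a, 'b) cliff \<Rightarrow> ('a, 'b) cliff"
  where "sgn_cliff x = inverse (norm x) *\<^sub>R x"
definition dist_cliff :: "('a, 'b) cliff \<Rightarrow> ('a, 'b) cliff \<Rightarrow> real"
  where "dist_cliff x y = norm (x - y)"
definition uniformity_cliff :: "(('a, 'b) cliff \<times> ('a, 'b) cliff) filter"
  where "uniformity_cliff = (INF e\<in>{0<..}. principal {(x, y). dist x y < e})"
definition open_cliff :: "('a, 'b) cliff set \<Rightarrow> bool"
  where "open_cliff S = (\<forall>x\<in>S. \<forall>\<^sub>F (x', y) in uniformity. x' = x \<longrightarrow> y \<in> S)"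

instance
proof
  fix a b c :: "('a, 'b) cliff" and r s :: real
  show "a + b + c = a + (b + c)" "a + b = b + a" "0 + a = a" "- a + a = 0" "a - b = a + - b"
    by (transfer; simp add: fun_eq_iff)+
  show "r *\<^sub>R (a + b) = r *\<^sub>R a + r *\<^sub>R b" "(r + s) *\<^sub>R a = r *\<^sub>R a + s *\<^sub>R a"
    "r *\<^sub>R s *\<^sub>R a = (r * s) *\<^sub>R a" "1 *\<^sub>R a = a"
    by (transfer; simp add: fun_eq_iff scaleR_add_left scaleR_add_right)+
  show "dist a b = norm (a - b)" by (rule dist_cliff_def)
  show "sgn a = inverse (norm a) *\<^sub>R a" by (rule sgn_cliff_def)
  show "(uniformity :: (('a, 'b) cliff \<times> ('a, 'b) cliff) filter)
      = (INF e\<in>{0<..}. principal {(x, y). dist x y < e})"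
    by (rule uniformity_cliff_def)
  show "open S = (\<forall>x\<in>S. \<forall>\<^sub>F (x', y) in uniformity. x' = x \<longrightarrow> y \<in> S)" for S :: "('a, 'b) cliff set"
    by (rule open_cliff_def)
  show "(norm a = 0) = (a = 0)"
    unfolding norm_cliff_def by (transfer; simp add: sum_nonneg_eq_0_iff fun_eq_iff)
  show "norm (a + b) \<le> norm a + norm b"
    unfolding norm_cliff_def sum.distrib [symmetric]
    by (intro sum_mono) (simp add: plus_cliff.rep_eq norm_triangle_ineq)
  show "norm (r *\<^sub>R a) = \<bar>r\<bar> * norm a"
    unfolding norm_cliff_def by (simp add: scaleR_cliff.rep_eq sum_distrib_left)
qed

end

lemma coef_simps [simp]:
  "coef 0 A = 0" "coef (x + y) A = coef x A + coef y A" "coef (x - y) A = coef x A - coef y A"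
  "coef (- x) A = - coef x A" "coef (r *\<^sub>R x) A = r *\<^sub>R coef x A"
  by (simp_all add: zero_cliff.rep_eq plus_cliff.rep_eq minus_cliff.rep_eq
      uminus_cliff.rep_eq scaleR_cliff.rep_eq)

lemma cliff_eqI: "(\<And>A. coef x A = coef y A) \<Longrightarrow> x = y"
  using coef_inject by blast

lemma norm_coef_le: "norm (coef x A) \<le> norm (x :: ('a::real_normed_vector, 'n::finite) cliff)"
  unfolding norm_cliff_def by (rule member_le_sum) auto

instance cliff :: (banach, finite) banach
proof
  fix X :: "nat \<Rightarrow> ('a, 'b) cliff"
  assume X: "Cauchy X"
  have "Cauchy (\<lambda>n. coef (X n) A)" for A
  proof (rule metric_CauchyI)
    fix e :: real assume "0 < e"
    then obtain M where M: "\<forall>m\<ge>M. \<forall>n\<ge>M. dist (X m) (X n) < e"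
      using X unfolding Cauchy_def by blast
    have "dist (coef (X m) A) (coef (X n) A) \<le> dist (X m) (X n)" for m n
      using norm_coef_le[of "X m - X n" A] by (simp add: dist_norm)
    then show "\<exists>M. \<forall>m\<ge>M. \<forall>n\<ge>M. dist (coef (X m) A) (coef (X n) A) < e"
      using M le_less_trans by blast
  qed
  then have "\<forall>A. \<exists>l. (\<lambda>n. coef (X n) A) \<longlonglongrightarrow> l"
    using Cauchy_convergent convergent_def by blast
  then obtain l where l: "\<And>A. (\<lambda>n. coef (X n) A) \<longlonglongrightarrow> l A" by metis
  have "(\<lambda>n. \<Sum>A\<in>UNIV. norm (coef (X n) A - l A)) \<longlonglongrightarrow> (\<Sum>A::'b set\<in>UNIV. 0)"
    by (rule tendsto_sum, rule tendsto_norm_zero, rule LIM_zero, rule l)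
  then have "(\<lambda>n. norm (X n - Cliff l)) \<longlonglongrightarrow> 0"
    by (simp add: norm_cliff_def Cliff_inverse)
  then have "X \<longlonglongrightarrow> Cliff l"
    by (rule LIM_zero_cancel[OF tendsto_norm_zero_cancel])
  then show "convergent X" by (rule convergentI)
qed

instantiation cliff :: (real_normed_algebra, "{finite,linorder}") real_normed_algebra
begin

definition times_cliff :: "('a, 'b) cliff \<Rightarrow> ('a, 'b) cliff \<Rightarrow> ('a, 'b) cliff"
  where "times_cliff = cprod (*)"

instance
proof
  fix a b c :: "('a, 'b) cliff" and r :: real
  show "a * b * c = a * (b * c)"
    unfolding times_cliff_def
    by (rule cprod_assoc)
      (auto intro!: bounded_linear.linear bounded_linear_mult_left bounded_linear_mult_right
        simp: mult.assoc)
  show "(a + b) * c = a * c + b * c" "a * (b + c) = a * b + a * c"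
    unfolding times_cliff_def
    by (rule cliff_eqI; simp add: cprod.rep_eq algebra_simps sum.distrib)+
  show "r *\<^sub>R a * b = r *\<^sub>R (a * b)" "a * r *\<^sub>R b = r *\<^sub>R (a * b)"
    unfolding times_cliff_def
    by (rule cliff_eqI; simp add: cprod.rep_eq scaleR_sum_right mult.commute)+
  have "norm (a * b)
      \<le> (\<Sum>C\<in>UNIV. \<Sum>A\<in>UNIV. norm (coef a A) * norm (coef b (sym_diff A C)))"
    unfolding norm_cliff_def times_cliff_def cprod.rep_eq
    by (intro sum_mono sum_norm_le) (simp add: norm_mult_ineq)
  also have "\<dots> = (\<Sum>A\<in>UNIV. \<Sum>C\<in>UNIV. norm (coef a A) * norm (coef b (sym_diff A C)))"
    by (rule sum.swap)
  also have "\<dots> = (\<Sum>A\<in>UNIV. \<Sum>C\<in>UNIV. norm (coef a A) * norm (coef b C))"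
    by (rule sum.cong[OF refl], rule sym_diff_sum_reindex)
  also have "\<dots> = norm a * norm b"
    by (simp add: norm_cliff_def sum_product)
  finally show "norm (a * b) \<le> norm a * norm b" .
qed

end

text \<open>\<open>cmono A a\<close> is \<open>a e\<^sub>A\<close>.\<close>

lift_definition cmono :: "'n set \<Rightarrow> 'a::zero \<Rightarrow> ('a, 'n) cliff"
  is "\<lambda>A a B. if B = A then a else 0" .

lemma coef_cmono: "coef (cmono A a) B = (if B = A then a else 0)"
  by (simp add: cmono.rep_eq)

lemma cprod_cmono_left:
  fixes f :: "'a::real_vector \<Rightarrow> 'b::real_vector \<Rightarrow> 'c::real_vector"
  assumes "\<And>b. f 0 b = 0"
  shows "coef (cprod f (cmono A a) y) C = csign A (sym_diff A C) *\<^sub>R f a (coef y (sym_diff A C))"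
proof -
  have "coef (cprod f (cmono A a) y) C
      = (\<Sum>B\<in>UNIV. if B = A then csign A (sym_diff A C) *\<^sub>R f a (coef y (sym_diff A C)) else 0)"
    unfolding cprod.rep_eq coef_cmono by (rule sum.cong) (auto simp: assms)
  then show ?thesis by simp
qed

lemma cprod_cmono:
  fixes f :: "'a::real_vector \<Rightarrow> 'b::real_vector \<Rightarrow> 'c::real_vector"
  assumes "\<And>b. f 0 b = 0" "\<And>a. f a 0 = 0"
  shows "cprod f (cmono A a) (cmono B b) = cmono (sym_diff A B) (csign A B *\<^sub>R f a b)"
proof (rule cliff_eqI)
  fix C
  have "sym_diff A C = B \<longleftrightarrow> C = sym_diff A B" by auto
  then show "coef (cprod f (cmono A a) (cmono B b)) C
      = coef (cmono (sym_diff A B) (csign A B *\<^sub>R f a b)) C"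
    by (auto simp: cprod_cmono_left assms coef_cmono)
qed

instantiation cliff :: ("{real_normed_algebra, monoid_mult}", "{finite,linorder}") monoid_mult
begin

definition one_cliff :: "('a, 'b) cliff"
  where "one_cliff = cmono {} 1"

instance
proof
  fix a :: "('a, 'b) cliff"
  show "1 * a = a"
    unfolding one_cliff_def times_cliff_def
    by (rule cliff_eqI) (simp add: cprod_cmono_left)
  show "a * 1 = a"
  proof (rule cliff_eqI)
    fix C
    have "coef (a * 1) C = (\<Sum>A\<in>UNIV. if A = C then coef a C else 0)"
      unfolding one_cliff_def times_cliff_def cprod.rep_eq coef_cmono
      by (rule sum.cong) auto
    then show "coef (a * 1) C = coef a C" by simp
  qed
qed

end

instance cliff :: (real_normed_algebra_1, "{finite,linorder}") real_normed_algebra_1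
proof
  have "norm (cmono {} 1 :: ('a, 'b) cliff) = (\<Sum>A::'b set\<in>UNIV. if A = {} then 1 else 0)"
    unfolding norm_cliff_def coef_cmono by (rule sum.cong) auto
  then show *: "norm (1 :: ('a, 'b) cliff) = 1"
    by (simp add: one_cliff_def)
  then show "(0 :: ('a, 'b) cliff) \<noteq> 1" by (metis norm_zero zero_neq_one)
qed

abbreviation gen :: "'n::{finite,linorder} \<Rightarrow> (real, 'n) cliff"
  where "gen i \<equiv> cmono {i} 1"

lemma cmono_mult_cmono:
  "cmono A a * cmono B b = cmono (sym_diff A B) (csign A B *\<^sub>R (a * b))"
  for a b :: "'a::real_normed_algebra"
  by (simp add: times_cliff_def cprod_cmono)

lemma gen_relation:
  fixes i j :: "'n::{finite,linorder}"
  shows "gen i * gen j + gen j * gen i = (if i = j then - 2 else 0)"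
proof -
  have sq: "csign {i} {i} = - 1" for i :: 'n
  proof -
    have *: "{(k, l). k \<in> {i} \<and> l \<in> {i} \<and> l \<le> k} = {(i, i)}" by auto
    show ?thesis unfolding csign_def * by simp
  qed
  have lt: "csign {i} {j} = 1 \<and> csign {j} {i} = - 1" if "i < j" for i j :: 'n
  proof -
    have *: "{(k, l). k \<in> {i} \<and> l \<in> {j} \<and> l \<le> k} = {}"
      "{(k, l). k \<in> {j} \<and> l \<in> {i} \<and> l \<le> k} = {(j, i)}" using that by auto
    show ?thesis unfolding csign_def * by simp
  qed
  have sd: "sym_diff {j} {i} = sym_diff {i} {j}" by auto
  consider "i = j" | "i < j" | "j < i" by fastforce
  then show ?thesis
  proof cases
    case 1
    have "gen j * gen j = (- 1 :: (real, 'n) cliff)"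
      by (intro cliff_eqI) (simp add: cmono_mult_cmono sq coef_cmono one_cliff_def)
    then show ?thesis using 1 by simp
  next
    case 2
    then have "i \<noteq> j" by simp
    with lt[OF 2] show ?thesis
      unfolding cmono_mult_cmono sd by (intro cliff_eqI) (simp add: coef_cmono)
  next
    case 3
    then have "i \<noteq> j" by simp
    with lt[OF 3] show ?thesis
      unfolding cmono_mult_cmono sd by (intro cliff_eqI) (simp add: coef_cmono)
  qed
qed

lemma cmono_insert_Max:
  assumes "\<forall>j\<in>A. j < i"
  shows "cmono (insert i A) 1 = cmono A 1 * gen i"
proof -
  have *: "{(k, l). k \<in> A \<and> l \<in> {i} \<and> l \<le> k} = {}" using assms by fastforce
  have "csign A {i} = 1" unfolding csign_def * by simp
  moreover have "sym_diff A {i} = insert i A" using assms by auto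
  ultimately show ?thesis by (simp add: cmono_mult_cmono)
qed

text \<open>
  The action of \<open>B(V\<^sub>n)\<close> on \<open>V\<^sub>n\<close>; it is faithful and multiplication is composition, so that
  invertibility in \<open>('v endo, 'n) cliff\<close> is invertibility of operators within \<open>B(V\<^sub>n)\<close>.
\<close>

definition capply :: "('v::real_normed_vector endo, 'n::{finite,linorder}) cliff
    \<Rightarrow> ('v, 'n) cliff \<Rightarrow> ('v, 'n) cliff"
  where "capply = cprod (\<lambda>T. blinfun_apply (blinfun_of_endo T))"

lemma capply_mult: "capply (S * T) v = capply S (capply T v)"
  unfolding capply_def times_cliff_def
proof (rule cprod_assoc)
  show "linear (\<lambda>d. blinfun_apply (blinfun_of_endo d) c)" for c :: 'a
    by (rule linearI) (simp_all add: plus_endo.rep_eq scaleR_endo.rep_eq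
        blinfun.add_left blinfun.scaleR_left)
  show "linear (blinfun_apply (blinfun_of_endo a))" for a :: "'a endo"
    by (rule bounded_linear.linear) (rule blinfun.bounded_linear_right)
qed (rule blinfun_of_endo_mult_apply)

lemma capply_one: "capply 1 v = v"
  unfolding capply_def one_cliff_def
  by (rule cliff_eqI, subst cprod_cmono_left)
    (simp_all add: zero_endo.rep_eq one_endo.rep_eq)

lemma capply_inject:
  assumes "\<And>v. capply S v = capply T v" shows "S = T"
proof (rule cliff_eqI)
  fix C
  have *: "coef (capply R (cmono {} v)) C = blinfun_apply (blinfun_of_endo (coef R C)) v"
    for R :: "('a endo, 'b) cliff" and v
  proof -
    have "coef (capply R (cmono {} v)) C
        = (\<Sum>A\<in>UNIV. if A = C then blinfun_apply (blinfun_of_endo (coef R C)) v else 0)"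
      unfolding capply_def cprod.rep_eq coef_cmono by (rule sum.cong) auto
    then show ?thesis by simp
  qed
  have "blinfun_of_endo (coef S C) = blinfun_of_endo (coef T C)"
    by (rule blinfun_eqI) (metis * assms)
  then show "coef S C = coef T C" by (simp add: blinfun_of_endo_inject)
qed

text \<open>The embedding \<open>a \<mapsto> \<I> a\<close> of the Clifford algebra into \<open>B(V\<^sub>n)\<close>.\<close>

definition cembed :: "(real, 'n) cliff \<Rightarrow> ('v::real_normed_vector endo, 'n) cliff"
  where "cembed a = Cliff (\<lambda>A. coef a A *\<^sub>R 1)"

section \<open>Paravectors, axial symmetry and slice Cauchy domains\<close>

text \<open>Points of \<open>\<real>\<^bsup>n+1\<^esup>\<close>; the norm of the product type is the Euclidean norm.\<close>

type_synonym 'n pvec = "real \<times> (real ^ 'n)"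

definition cvec :: "(real, 'n) vec \<Rightarrow> (real, 'n::{finite,linorder}) cliff"
  where "cvec y = (\<Sum>j\<in>UNIV. (y $ j) *\<^sub>R gen j)"

definition paravec :: "'n pvec \<Rightarrow> (real, 'n::{finite,linorder}) cliff"
  where "paravec x = fst x *\<^sub>R 1 + cvec (snd x)"

definition unit_sphere :: "(real ^ 'n) set"  (\<open>\<S>\<close>)
  where "\<S> = {I. norm I = 1}"

text \<open>
  For \<open>I \<in> \<S>\<close>, \<open>u + \<i>v \<mapsto> u + Iv\<close> is an isometry from \<^typ>\<open>complex\<close> onto the plane \<open>\<complex>\<^sub>I\<close>; subsets of \<open>\<complex>\<^sub>I\<close>
  and curves in \<open>\<complex>\<^sub>I\<close> are represented by their preimages.
\<close>

definition slice_pt :: "real ^ 'n \<Rightarrow> complex \<Rightarrow> 'n pvec"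
  where "slice_pt I z = (Re z, Im z *\<^sub>R I)"

definition slice_set :: "real ^ 'n \<Rightarrow> 'n pvec set \<Rightarrow> complex set"
  where "slice_set I U = {z. slice_pt I z \<in> U}"

definition axially_symmetric :: "'n::finite pvec set \<Rightarrow> bool"
  where "axially_symmetric U \<longleftrightarrow>
    (\<forall>x\<in>U. {(fst x, norm (snd x) *\<^sub>R I) | I. I \<in> \<S>} \<subseteq> U)"

definition jordan_boundary :: "(real \<Rightarrow> complex) list \<Rightarrow> complex set \<Rightarrow> bool"
  where "jordan_boundary \<Gamma> D \<longleftrightarrow>
    (\<forall>\<gamma>\<in>set \<Gamma>. valid_path \<gamma> \<and> simple_path \<gamma> \<and> pathfinish \<gamma> = pathstart \<gamma>) \<and>
    (\<forall>i<length \<Gamma>. \<forall>j<length \<Gamma>. i \<noteq> j \<longrightarrow> path_image (\<Gamma> ! i) \<inter> path_image (\<Gamma> ! j) = {}) \<and>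
    frontier D = (\<Union>\<gamma>\<in>set \<Gamma>. path_image \<gamma>)"

text \<open>
  Positive orientation of the boundary of a bounded open set \<open>D\<close>: its curves together wind once
  around every point of \<open>D\<close> and not at all around the points outside the closure of \<open>D\<close>.
\<close>

definition positively_oriented :: "(real \<Rightarrow> complex) list \<Rightarrow> complex set \<Rightarrow> bool"
  where "positively_oriented \<Gamma> D \<longleftrightarrow>
    (\<forall>z\<in>D. (\<Sum>\<gamma>\<leftarrow>\<Gamma>. winding_number \<gamma> z) = 1) \<and>
    (\<forall>z. z \<notin> closure D \<longrightarrow> (\<Sum>\<gamma>\<leftarrow>\<Gamma>. winding_number \<gamma> z) = 0)"

definition slice_cauchy_domain :: "'n::finite pvec set \<Rightarrow> bool"
  where "slice_cauchy_domain U \<longleftrightarrow> open U \<and> axially_symmetric U \<and>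
    (\<forall>I\<in>\<S>. \<exists>\<Gamma>. jordan_boundary \<Gamma> (slice_set I U))"

section \<open>Slice hyperholomorphic functions\<close>

definition plane_of :: "'n::finite pvec set \<Rightarrow> (real \<times> real) set"
  where "plane_of U = {(u, v). \<forall>I\<in>\<S>. (u, v *\<^sub>R I) \<in> U}"

definition partial_u :: "(real \<times> real \<Rightarrow> 'a::real_normed_vector) \<Rightarrow> real \<times> real \<Rightarrow> 'a"
  where "partial_u a p = vector_derivative (\<lambda>t. a (t, snd p)) (at (fst p))"

definition partial_v :: "(real \<times> real \<Rightarrow> 'a::real_normed_vector) \<Rightarrow> real \<times> real \<Rightarrow> 'a"
  where "partial_v a p = vector_derivative (\<lambda>t. a (fst p, t)) (at (snd p))"

definition slice_components :: "(real \<times> real) set \<Rightarrow> (real \<times> real \<Rightarrow> 'a::real_normed_vector)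
    \<Rightarrow> (real \<times> real \<Rightarrow> 'a) \<Rightarrow> bool"
  where "slice_components P a b \<longleftrightarrow>
    (\<forall>p\<in>P. a differentiable (at p) \<and> b differentiable (at p) \<and>
       partial_u a p = partial_v b p \<and> partial_v a p = - partial_u b p) \<and>
    (\<forall>(u, v)\<in>P. a (u, - v) = a (u, v) \<and> b (u, - v) = - b (u, v))"

definition left_slice_hyperholomorphic ::
    "'n pvec set \<Rightarrow> ('n pvec \<Rightarrow> (real, 'n::{finite,linorder}) cliff) \<Rightarrow> bool"
  where "left_slice_hyperholomorphic U f \<longleftrightarrow>
    (\<exists>a b. slice_components (plane_of U) a b \<and>
      (\<forall>I\<in>\<S>. \<forall>(u, v)\<in>plane_of U. f (u, v *\<^sub>R I) = a (u, v) + cvec I * b (u, v)))"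

definition right_slice_hyperholomorphic ::
    "'n pvec set \<Rightarrow> ('n pvec \<Rightarrow> (real, 'n::{finite,linorder}) cliff) \<Rightarrow> bool"
  where "right_slice_hyperholomorphic U f \<longleftrightarrow>
    (\<exists>a b. slice_components (plane_of U) a b \<and>
      (\<forall>I\<in>\<S>. \<forall>(u, v)\<in>plane_of U. f (u, v *\<^sub>R I) = a (u, v) + b (u, v) * cvec I))"

section \<open>Operators with commuting components\<close>

definition alg_invertible :: "'a::monoid_mult \<Rightarrow> bool"
  where "alg_invertible x \<longleftrightarrow> (\<exists>y. x * y = 1 \<and> y * x = 1)"

definition alg_inverse :: "'a::monoid_mult \<Rightarrow> 'a"
  where "alg_inverse x = (THE y. x * y = 1 \<and> y * x = 1)"

lemma alg_inverse:
  assumes "alg_invertible x"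
  shows "x * alg_inverse x = 1" "alg_inverse x * x = 1"
proof -
  have "\<exists>!y. x * y = 1 \<and> y * x = 1"
  proof (rule ex_ex1I)
    show "\<exists>y. x * y = 1 \<and> y * x = 1" using assms by (simp add: alg_invertible_def)
    fix y z assume "x * y = 1 \<and> y * x = 1" "x * z = 1 \<and> z * x = 1"
    then have "y = y * (x * z)" "z = (y * x) * z" by simp_all
    then show "y = z" by (simp only: mult.assoc)
  qed
  from theI'[OF this] show "x * alg_inverse x = 1" "alg_inverse x * x = 1"
    by (simp_all add: alg_inverse_def)
qed

definition paraop :: "'v::real_normed_vector endo \<Rightarrow> ('n \<Rightarrow> 'v endo)
    \<Rightarrow> ('v endo, 'n::{finite,linorder}) cliff"
  where "paraop T0 Tv = cmono {} T0 + (\<Sum>j\<in>UNIV. cmono {j} (Tv j))"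

text \<open>The components of a paravector operator \<open>T\<close> are \<open>T\<^sub>0 = coef T {}\<close> and \<open>T\<^sub>i = coef T {i}\<close>.\<close>

lemma coef_paraop: "coef (paraop T0 Tv) {} = T0" "coef (paraop T0 Tv) {i} = Tv i"
proof -
  have *: "coef (\<Sum>j\<in>S. g j) A = (\<Sum>j\<in>S. coef (g j) A)"
    for g :: "'b \<Rightarrow> ('a endo, 'b) cliff" and S A
    by (induction S rule: infinite_finite_induct) simp_all
  show "coef (paraop T0 Tv) {} = T0" "coef (paraop T0 Tv) {i} = Tv i"
    by (simp_all add: paraop_def * coef_cmono eq_commute[of "{i}"])
qed

definition BC01 :: "('v::real_normed_vector endo, 'n::{finite,linorder}) cliff set"
  where "BC01 = {paraop T0 Tv | T0 Tv. (\<forall>j. T0 * Tv j = Tv j * T0) \<and> (\<forall>i j. Tv i * Tv j = Tv j * Tv i)}"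

definition BC1 :: "('v::real_normed_vector endo, 'n::{finite,linorder}) cliff set"
  where "BC1 = {T \<in> BC01. coef T {} = 0}"

definition conj_op :: "('v::real_normed_vector endo, 'n::{finite,linorder}) cliff \<Rightarrow> ('v endo, 'n) cliff"
  where "conj_op T = paraop (coef T {}) (\<lambda>j. - coef T {j})"

definition S_spectrum :: "('v::real_normed_vector endo, 'n::{finite,linorder}) cliff \<Rightarrow> 'n pvec set"
  where "S_spectrum T = {s. \<not> alg_invertible (T\<^sup>2 - (2 * fst s) *\<^sub>R T + (norm s)\<^sup>2 *\<^sub>R 1)}"

text \<open>
  The complexification of \<open>V\<close> is \<open>V \<times> V\<close>, with \<open>(x, y)\<close> standing for \<open>x + \<i>y\<close>. A two-sided
  bounded real-linear inverse of a complex-linear operator is automatically complex-linear.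
\<close>

lift_definition complexify :: "'v::real_normed_vector endo \<Rightarrow> ('v \<times> 'v) endo"
  is "\<lambda>T. Blinfun (\<lambda>(x, y). (blinfun_apply T x, blinfun_apply T y))" .

lift_definition complex_scalar :: "complex \<Rightarrow> ('v::real_normed_vector \<times> 'v) endo"
  is "\<lambda>c. Blinfun (\<lambda>(x, y). (Re c *\<^sub>R x - Im c *\<^sub>R y, Im c *\<^sub>R x + Re c *\<^sub>R y))" .

lemma complexify_apply:
  "blinfun_apply (blinfun_of_endo (complexify T)) (x, y)
     = (blinfun_apply (blinfun_of_endo T) x, blinfun_apply (blinfun_of_endo T) y)"
proof (transfer fixing: x y)
  fix T :: "'a \<Rightarrow>\<^sub>L 'a"
  have "bounded_linear (\<lambda>(x, y). (blinfun_apply T x, blinfun_apply T y))"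
    unfolding case_prod_beta
    by (intro bounded_linear_Pair bounded_linear_compose[OF blinfun.bounded_linear_right]
        bounded_linear_fst bounded_linear_snd)
  then show "blinfun_apply (Blinfun (\<lambda>(x, y). (blinfun_apply T x, blinfun_apply T y))) (x, y)
      = (blinfun_apply T x, blinfun_apply T y)"
    by (simp add: bounded_linear_Blinfun_apply)
qed

lemma complex_scalar_apply:
  "blinfun_apply (blinfun_of_endo (complex_scalar c)) (x, y)
     = (Re c *\<^sub>R x - Im c *\<^sub>R y, Im c *\<^sub>R x + Re c *\<^sub>R y)"
proof (transfer fixing: x y c)
  have "bounded_linear (\<lambda>(x :: 'a, y :: 'a). (Re c *\<^sub>R x - Im c *\<^sub>R y, Im c *\<^sub>R x + Re c *\<^sub>R y))"
    unfolding case_prod_beta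
    by (intro bounded_linear_Pair bounded_linear_add bounded_linear_sub
        bounded_linear_scaleR_right[THEN bounded_linear_compose] bounded_linear_fst bounded_linear_snd)
  then show "blinfun_apply (Blinfun (\<lambda>(x, y). (Re c *\<^sub>R x - Im c *\<^sub>R y, Im c *\<^sub>R x + Re c *\<^sub>R y))) (x, y)
      = (Re c *\<^sub>R x - Im c *\<^sub>R y, Im c *\<^sub>R x + Re c *\<^sub>R y)"
    by (simp add: bounded_linear_Blinfun_apply)
qed

definition op_spectrum :: "'v::real_normed_vector endo \<Rightarrow> complex set"
  where "op_spectrum T = {c. \<not> alg_invertible (complex_scalar c - complexify T)}"

section \<open>The kernels and the integrals\<close>

text \<open>\<open>s \<I>\<close>, the paravector \<open>s\<close> as an element of \<open>B(V\<^sub>n)\<close>.\<close>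

definition pop :: "'n pvec \<Rightarrow> ('v::real_normed_vector endo, 'n::{finite,linorder}) cliff"
  where "pop s = cembed (paravec s)"

definition Qc :: "'n pvec \<Rightarrow> ('v::real_normed_vector endo, 'n::{finite,linorder}) cliff
    \<Rightarrow> ('v endo, 'n) cliff"
  where "Qc s T = (pop s)\<^sup>2 - pop s * (T + conj_op T) + T * conj_op T"

definition hn :: "nat \<Rightarrow> nat"
  where "hn n = (n - 1) div 2"

definition kconst :: "nat \<Rightarrow> nat \<Rightarrow> real"
  where "kconst n \<alpha> = 4 ^ \<alpha> * fact \<alpha> * pochhammer (- real (hn n)) \<alpha>"

lemma pochhammer_hn:
  assumes "\<alpha> \<le> h"
  shows "pochhammer (- real h) \<alpha> = (- 1) ^ \<alpha> * fact h / fact (h - \<alpha>)"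
proof -
  have "(- 1) ^ \<alpha> * pochhammer (- real h) \<alpha> / fact \<alpha> = fact h / (fact \<alpha> * fact (h - \<alpha>))"
    using assms by (simp add: gbinomial_pochhammer [symmetric] binomial_gbinomial [symmetric] binomial_fact)
  then have "(- 1) ^ \<alpha> * pochhammer (- real h) \<alpha> = fact h / fact (h - \<alpha>)"
    by (simp add: divide_simps)
  then have "(- 1) ^ \<alpha> * ((- 1) ^ \<alpha> * pochhammer (- real h) \<alpha>) = (- 1) ^ \<alpha> * fact h / fact (h - \<alpha>)"
    by simp
  then show ?thesis by (simp add: mult.assoc [symmetric] power_add [symmetric])
qed

definition KL :: "nat \<Rightarrow> 'n pvec \<Rightarrow> ('v::real_normed_vector endo, 'n::{finite,linorder}) cliff
    \<Rightarrow> ('v endo, 'n) cliff"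
  where "KL \<alpha> s T = kconst CARD('n) \<alpha> *\<^sub>R ((pop s - conj_op T) * alg_inverse (Qc s T) ^ (\<alpha> + 1))"

definition KR :: "nat \<Rightarrow> 'n pvec \<Rightarrow> ('v::real_normed_vector endo, 'n::{finite,linorder}) cliff
    \<Rightarrow> ('v endo, 'n) cliff"
  where "KR \<alpha> s T = kconst CARD('n) \<alpha> *\<^sub>R (alg_inverse (Qc s T) ^ (\<alpha> + 1) * (pop s - conj_op T))"

text \<open>
  The pullback of \<open>ds\<^sub>I = ds (-I)\<close> along \<open>s = slice_pt I (\<gamma> t)\<close> is \<open>dsI I \<gamma> t dt\<close>.
\<close>

definition dsI :: "(real, 'n) vec \<Rightarrow> (real \<Rightarrow> complex) \<Rightarrow> real \<Rightarrow> (real, 'n::{finite,linorder}) cliff"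
  where "dsI I \<gamma> t = paravec (slice_pt I (vector_derivative \<gamma> (at t))) * (- cvec I)"

definition left_integrand :: "nat \<Rightarrow> ('v::real_normed_vector endo, 'n::{finite,linorder}) cliff
    \<Rightarrow> ('n pvec \<Rightarrow> (real, 'n) cliff) \<Rightarrow> (real, 'n) vec \<Rightarrow> (real \<Rightarrow> complex) \<Rightarrow> real \<Rightarrow> ('v endo, 'n) cliff"
  where "left_integrand \<alpha> T f I \<gamma> t =
    (let s = slice_pt I (\<gamma> t) in KL \<alpha> s T * cembed (dsI I \<gamma> t) * cembed (f s))"

definition right_integrand :: "nat \<Rightarrow> ('v::real_normed_vector endo, 'n::{finite,linorder}) cliff
    \<Rightarrow> ('n pvec \<Rightarrow> (real, 'n) cliff) \<Rightarrow> (real, 'n) vec \<Rightarrow> (real \<Rightarrow> complex) \<Rightarrow> real \<Rightarrow> ('v endo, 'n) cliff"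
  where "right_integrand \<alpha> T f I \<gamma> t =
    (let s = slice_pt I (\<gamma> t) in cembed (f s) * cembed (dsI I \<gamma> t) * KR \<alpha> s T)"

definition boundary_integral :: "((real \<Rightarrow> complex) \<Rightarrow> real \<Rightarrow> 'b::real_normed_vector)
    \<Rightarrow> (real \<Rightarrow> complex) list \<Rightarrow> 'b"
  where "boundary_integral g \<Gamma> = (1 / (2 * pi)) *\<^sub>R (\<Sum>\<gamma>\<leftarrow>\<Gamma>. integral {0..1} (g \<gamma>))"

text \<open>
  Admissible data for a function with domain \<open>D\<close>: a bounded slice Cauchy domain \<open>U\<close>, an imaginary
  unit \<open>I\<close>, and a positively oriented parametrization \<open>\<Gamma>\<close> of the boundary of \<open>U \<inter> \<complex>\<^sub>I\<close> in \<open>\<complex>\<^sub>I\<close>.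
\<close>

definition admissible :: "('v::real_normed_vector endo, 'n::{finite,linorder}) cliff \<Rightarrow> 'n pvec set
    \<Rightarrow> 'n pvec set \<Rightarrow> (real, 'n) vec \<Rightarrow> (real \<Rightarrow> complex) list \<Rightarrow> bool"
  where "admissible T D U I \<Gamma> \<longleftrightarrow>
    slice_cauchy_domain U \<and> bounded U \<and> S_spectrum T \<subseteq> U \<and> closure U \<subseteq> D \<and> I \<in> \<S> \<and>
    jordan_boundary \<Gamma> (slice_set I U) \<and> positively_oriented \<Gamma> (slice_set I U)"

end

theory Submission
  imports Defs "HOL-Complex_Analysis.Cauchy_Integral_Formula"
begin

text \<open>
  On a slice, write \<open>j\<close> for the unit \<open>I\<close>, \<open>X\<close> for the left and \<open>Y\<close> for the right factor of the
  integrand. Then \<open>X\<close> is right and \<open>Y\<close> left holomorphic with respect to \<open>j\<close>, so that the form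
  \<open>X ds\<^sub>I Y\<close> is closed off the S-spectrum: here \<open>T\<^sup>2\<close> is a scalar operator, and
  \<open>Q = s\<^sup>2 - T\<^sup>2\<close> commutes with \<open>j\<close>. Cauchy's theorem for null-homologous cycles,
  transferred to Banach space valued forms by the Hahn-Banach theorem, gives independence of \<open>U\<close>.

  For independence of \<open>I\<close>, reflection in the real axis shows that the integrals for \<open>I\<close> and \<open>-I\<close>
  coincide. Since \<open>X = A + B j\<close> and \<open>Y = a + j b\<close> with \<open>A, B, a, b\<close> not depending on \<open>I\<close>, half the
  sum of these two integrands no longer depends on \<open>I\<close>.
\<close>

text \<open>The S-spectrum is defined through T^2 - 2 s_0 T + |s|^2, whereas the kernels invert Q,
  and T itself does not commute with the unit in general. The two are tied together by
  \<open>Qnorm\<close>, a polynomial in T^2 with real coefficients: it factors as Q(s) Q(conj s) and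
  also as (T^2 - 2 s_0 T + |s|^2) (T^2 + 2 s_0 T + |s|^2). Hence Q is invertible off the S-spectrum,
  and its inverse is p + q j with p and q commuting with every unit; this is where the form A + B j
  of the kernel comes from.

  The domain minus the spectrum may be disconnected on a slice, and the boundary of U has several
  curves, so Cauchy's theorem is needed for cycles in arbitrary open sets. Around each point outside
  that set all admissible cycles have the same winding sum: 1 at points of the domain, 0 off the
  domain.

  Functionals can compare two integrals only once the vector-valued integrals exist. The velocity of
  a piecewise C1 curve may be unbounded near the finitely many exceptional parameters, so existence
  is obtained from local primitives and the fundamental theorem of calculus for the gauge
  integral.\<close>

section \<open>Bounded functionals separate points\<close>

text \<open>The one-dimensional extension step of Hahn-Banach, with functionals coded by their
  graphs. A dominated subspace of pairs is automatically single-valued: domination at (0, y) and (0,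
  -y) forces y = 0.\<close>

lemma dominated_graph_extension:
  fixes M :: "('a::real_normed_vector \<times> real) set"
  assumes M: "subspace M" and bd: "\<And>x y. (x, y) \<in> M \<Longrightarrow> y \<le> norm x"
  obtains M' c where "subspace M'" "M \<subseteq> M'" "(z, c) \<in> M'" "\<And>x y. (x, y) \<in> M' \<Longrightarrow> y \<le> norm x"
proof -
  let ?L = "{y - norm (x - z) |x y. (x, y) \<in> M}"
  \<comment> \<open>The value at \<open>z\<close> must lie between the supremum of y - norm (x - z)
    and the infimum of norm (x + z) - y. The lower end is taken; \<open>sep\<close> shows that the
    interval is not empty.\<close>
  define c where "c = Sup ?L"
  have sep: "y - norm (x - z) \<le> norm (x' + z) - y'" if "(x, y) \<in> M" "(x', y') \<in> M" for x y x' y'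
  proof -
    have "(x + x', y + y') \<in> M" using subspace_add[OF M that] by simp
    then have "y + y' \<le> norm (x + x')" by (rule bd)
    also have "\<dots> \<le> norm (x - z) + norm (x' + z)"
      using norm_triangle_ineq[of "x - z" "x' + z"] by (simp add: algebra_simps)
    finally show ?thesis by simp
  qed
  have 0: "(0, 0) \<in> M" using subspace_0[OF M] by (simp add: zero_prod_def)
  have ne: "?L \<noteq> {}" using 0 by blast
  have lower: "y - norm (x - z) \<le> c" if "(x, y) \<in> M" for x y
    unfolding c_def
  proof (rule cSup_upper)
    show "bdd_above ?L" using sep[OF _ 0] by (auto intro!: bdd_aboveI[of _ "norm z"])
  qed (use that in blast)
  have upper: "c \<le> norm (x + z) - y" if "(x, y) \<in> M" for x y
    unfolding c_def using ne sep[OF _ that] by (intro cSup_least) auto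
  define M' where "M' = {(x + t *\<^sub>R z, y + t * c) |x y t. (x, y) \<in> M}"
  have mem: "(a, b) \<in> M' \<longleftrightarrow> (\<exists>t. (a - t *\<^sub>R z, b - t * c) \<in> M)" for a b
    unfolding M'_def by (auto; metis add_diff_cancel diff_add_cancel)
  show ?thesis
  proof (rule that)
    show "subspace M'"
    proof (rule subspaceI)
      show "0 \<in> M'" unfolding zero_prod_def mem using 0 by (intro exI[of _ 0]) simp
      fix p q :: "'a \<times> real" and r :: real
      obtain a b a' b' where pq: "p = (a, b)" "q = (a', b')" by fastforce
      show "p + q \<in> M'" if "p \<in> M'" "q \<in> M'"
      proof -
        from that obtain t t' where t: "(a - t *\<^sub>R z, b - t * c) \<in> M" "(a' - t' *\<^sub>R z, b' - t' * c) \<in> M"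
          by (auto simp: pq mem)
        from subspace_add[OF M this] have "(a + a' - (t + t') *\<^sub>R z, b + b' - (t + t') * c) \<in> M"
          by (simp add: algebra_simps)
        then show ?thesis by (auto simp: pq mem)
      qed
      show "r *\<^sub>R p \<in> M'" if "p \<in> M'"
      proof -
        from that obtain t where t: "(a - t *\<^sub>R z, b - t * c) \<in> M"
          by (auto simp: pq mem)
        from subspace_scale[OF M this, of r] have "(r *\<^sub>R a - (r * t) *\<^sub>R z, r * b - (r * t) * c) \<in> M"
          by (simp add: algebra_simps)
        then show ?thesis by (auto simp: pq mem)
      qed
    qed
    show "M \<subseteq> M'" by (auto simp: mem) (metis diff_zero mult_zero_left scaleR_zero_left)
    show "(z, c) \<in> M'" unfolding mem using 0 by (intro exI[of _ 1]) simp
    fix a b assume "(a, b) \<in> M'"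
    then obtain t where t: "(a - t *\<^sub>R z, b - t * c) \<in> M" by (auto simp: mem)
    consider "t = 0" | "t > 0" | "t < 0" by linarith
    \<comment> \<open>Dividing by the absolute value of \<open>t\<close> reduces to coefficient 1 or
      -1 at \<open>z\<close>, which are the cases governed by \<open>upper\<close> and
      \<open>lower\<close>.\<close>
    then show "b \<le> norm a"
    proof cases
      case 1 with bd[OF t] show ?thesis by simp
    next
      case 2
      have "((1/t) *\<^sub>R (a - t *\<^sub>R z), (1/t) * (b - t * c)) \<in> M" using subspace_scale[OF M t, of "1/t"] by simp
      from upper[OF this] 2 have "c \<le> norm ((1/t) *\<^sub>R a) - (b / t - c)"
        by (simp add: algebra_simps diff_divide_distrib)
      then have "b / t \<le> norm a / t" using 2 by simp
      then show ?thesis using 2 by (simp add: divide_le_cancel)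
    next
      case 3
      have "((-1/t) *\<^sub>R (a - t *\<^sub>R z), (-1/t) * (b - t * c)) \<in> M" using subspace_scale[OF M t, of "-1/t"] by simp
      from lower[OF this] 3 have "- b / t + c - norm ((-1/t) *\<^sub>R a) \<le> c"
        by (simp add: algebra_simps diff_divide_distrib)
      then have "b / (-t) \<le> norm a / (-t)" using 3 by (simp add: divide_simps)
      then show ?thesis using 3 by (simp add: divide_le_cancel divide_simps split: if_splits)
    qed
  qed
qed

text \<open>Hahn-Banach at a single point: Zorn's lemma is applied to the graphs of linear
  functionals of norm at most 1 on subspaces.\<close>

lemma exists_bounded_linear_nonzero:
  fixes x0 :: "'a::real_normed_vector"
  assumes "x0 \<noteq> 0"
  obtains \<phi> :: "'a \<Rightarrow> real" where "bounded_linear \<phi>" "\<phi> x0 \<noteq> 0"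
proof -
  \<comment> \<open>Having (x0, norm x0) in every graph fixes the value of the maximal functional at
    \<open>x0\<close>, which is then nonzero.\<close>
  define \<A> where "\<A> = {G :: ('a \<times> real) set. subspace G \<and> (\<forall>x y. (x, y) \<in> G \<longrightarrow> y \<le> norm x)
    \<and> (x0, norm x0) \<in> G}"
  have "span {(x0, norm x0)} \<in> \<A>"
    unfolding \<A>_def by (auto simp: span_base) (auto simp: span_singleton mult_right_mono)
  then have ne: "\<A> \<noteq> {}" by blast
  have "\<exists>M\<in>\<A>. \<forall>X\<in>\<A>. M \<subseteq> X \<longrightarrow> X = M"
  proof (rule subset_Zorn_nonempty[OF ne])
    fix \<C> assume C: "\<C> \<noteq> {}" "subset.chain \<A> \<C>"
    then have sub: "\<C> \<subseteq> \<A>" by (simp add: subset_chain_def)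
    have "subspace (\<Union>\<C>)"
    proof (rule subspaceI)
      show "0 \<in> \<Union>\<C>" using C(1) sub unfolding \<A>_def by (fastforce intro: subspace_0)
      show "r *\<^sub>R p \<in> \<Union>\<C>" if "p \<in> \<Union>\<C>" for r p
        using that sub by (auto simp: \<A>_def intro: subspace_scale)
      show "p + q \<in> \<Union>\<C>" if pq: "p \<in> \<Union>\<C>" "q \<in> \<Union>\<C>" for p q
      proof -
        from pq obtain X Y where XY: "X \<in> \<C>" "Y \<in> \<C>" "p \<in> X" "q \<in> Y" by blast
        then have "X \<subseteq> Y \<or> Y \<subseteq> X" using C(2) by (auto simp: subset_chain_def)
        then obtain Z where Z: "Z \<in> \<C>" "p \<in> Z" "q \<in> Z" using XY by blast
        then have "subspace Z" using sub by (auto simp: \<A>_def)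
        then show ?thesis using Z subspace_add by blast
      qed
    qed
    then show "\<Union>\<C> \<in> \<A>" using C sub by (auto simp: \<A>_def)
  qed
  then obtain M where M: "M \<in> \<A>" and max: "\<And>X. X \<in> \<A> \<Longrightarrow> M \<subseteq> X \<Longrightarrow> X = M" by blast
  have sub: "subspace M" and bd: "\<And>x y. (x, y) \<in> M \<Longrightarrow> y \<le> norm x" and x0: "(x0, norm x0) \<in> M"
    using M by (auto simp: \<A>_def)
  have ex: "\<exists>y. (x, y) \<in> M" for x
  proof -
    obtain M' c where M': "subspace M'" "M \<subseteq> M'" "(x, c) \<in> M'" "\<And>x y. (x, y) \<in> M' \<Longrightarrow> y \<le> norm x"
      using dominated_graph_extension[OF sub bd] by blast
    then have "M' \<in> \<A>" using x0 by (auto simp: \<A>_def)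
    from max[OF this M'(2)] M'(3) show ?thesis by auto
  qed
  have uniq: "y = y'" if "(x, y) \<in> M" "(x, y') \<in> M" for x y y'
    using bd[of 0 "y - y'"] bd[of 0 "y' - y"] subspace_diff[OF sub that] subspace_diff[OF sub that(2,1)]
    by simp
  define \<phi> where "\<phi> x = (SOME y. (x, y) \<in> M)" for x
  have phi: "(x, \<phi> x) \<in> M" for x unfolding \<phi>_def using ex by (rule someI_ex)
  show ?thesis
  proof (rule that)
    show "bounded_linear \<phi>"
    proof (rule bounded_linear_intro[where K = 1])
      show "\<phi> (x + y) = \<phi> x + \<phi> y" for x y
        using subspace_add[OF sub phi phi, of x y] by (intro uniq[OF phi]) simp
      show "\<phi> (r *\<^sub>R x) = r *\<^sub>R \<phi> x" for r x
        using subspace_scale[OF sub phi, of r x] by (intro uniq[OF phi]) simp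
      show "norm (\<phi> x) \<le> norm x * 1" for x
        using bd[OF phi, of x] subspace_neg[OF sub phi, of x] bd[of "-x" "- \<phi> x"]
        by (simp add: abs_le_iff)
    qed
    have "\<phi> x0 = norm x0" by (rule uniq[OF phi x0])
    then show "\<phi> x0 \<noteq> 0" using assms by simp
  qed
qed

lemma eq_if_bounded_linear_eq:
  fixes x y :: "'a::real_normed_vector"
  assumes "\<And>\<phi> :: 'a \<Rightarrow> real. bounded_linear \<phi> \<Longrightarrow> \<phi> x = \<phi> y"
  shows "x = y"
proof (rule ccontr)
  assume "x \<noteq> y"
  then have "x - y \<noteq> 0" by simp
  then obtain \<phi> :: "'a \<Rightarrow> real" where phi: "bounded_linear \<phi>" "\<phi> (x - y) \<noteq> 0"
    by (rule exists_bounded_linear_nonzero)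
  then show False using assms[of \<phi>] by (simp add: bounded_linear.linear linear_diff)
qed

section \<open>Cauchy's theorem for cycles\<close>

definition winding_sum :: "(real \<Rightarrow> complex) list \<Rightarrow> complex \<Rightarrow> complex"
  where "winding_sum \<Gamma> z = (\<Sum>\<gamma>\<leftarrow>\<Gamma>. winding_number \<gamma> z)"

definition cycle_in :: "complex set \<Rightarrow> (real \<Rightarrow> complex) list \<Rightarrow> bool"
  where "cycle_in S \<Gamma> \<longleftrightarrow>
    (\<forall>\<gamma>\<in>set \<Gamma>. valid_path \<gamma> \<and> pathfinish \<gamma> = pathstart \<gamma> \<and> path_image \<gamma> \<subseteq> S)"

lemma winding_sum_locally_constant:
  assumes "cycle_in S \<Gamma>" "z \<notin> S"
  shows "\<forall>\<^sub>F w in nhds z. winding_sum \<Gamma> w = winding_sum \<Gamma> z"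
  using assms
proof (induction \<Gamma>)
  case Nil
  then show ?case by (simp add: winding_sum_def)
next
  case (Cons \<gamma> \<Gamma>)
  let ?V = "{w. w \<notin> path_image \<gamma> \<and> winding_number \<gamma> w = winding_number \<gamma> z}"
  have "open ?V" using Cons.prems
    by (intro open_winding_number_levelsets) (auto simp: cycle_in_def valid_path_imp_path)
  moreover have "z \<in> ?V" using Cons.prems by (auto simp: cycle_in_def)
  ultimately have "\<forall>\<^sub>F w in nhds z. w \<in> ?V" by (rule eventually_nhds_in_open)
  moreover have "\<forall>\<^sub>F w in nhds z. winding_sum \<Gamma> w = winding_sum \<Gamma> z"
    using Cons by (auto simp: cycle_in_def)
  ultimately show ?case by eventually_elim (simp add: winding_sum_def)
qed

lemma winding_sum_zero_at_infinity:
  assumes "cycle_in S \<Gamma>"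
  shows "\<exists>B. \<forall>z. B \<le> norm z \<longrightarrow> winding_sum \<Gamma> z = 0"
  using assms
proof (induction \<Gamma>)
  case (Cons \<gamma> \<Gamma>)
  then obtain B where B: "\<forall>z. B \<le> norm z \<longrightarrow> winding_sum \<Gamma> z = 0" by (auto simp: cycle_in_def)
  obtain B' where "\<forall>z. B' \<le> norm z \<longrightarrow> winding_number \<gamma> z = 0"
    using winding_number_zero_at_infinity[of \<gamma>] Cons.prems
    by (auto simp: cycle_in_def valid_path_imp_path)
  with B show ?case by (intro exI[of _ "max B B'"]) (auto simp: winding_sum_def)
qed (auto simp: winding_sum_def)

text \<open>The two winding sums glue to a locally constant function on the plane that vanishes near
  infinity.\<close>

lemma winding_sum_zero_split:
  assumes C: "cycle_in C \<Gamma>" "cycle_in C' \<Gamma>'" and disj: "C \<inter> C' = {}"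
    and zero: "\<And>z. z \<notin> C \<Longrightarrow> z \<notin> C' \<Longrightarrow> winding_sum \<Gamma> z + winding_sum \<Gamma>' z = 0"
    and op: "open C" "open C'"
  shows "z \<notin> C \<Longrightarrow> winding_sum \<Gamma> z = 0" "z \<notin> C' \<Longrightarrow> winding_sum \<Gamma>' z = 0"
proof -
  define \<psi> where "\<psi> z = (if z \<in> C then - winding_sum \<Gamma>' z else winding_sum \<Gamma> z)" for z
  have psi1: "\<psi> z = winding_sum \<Gamma> z" if "z \<notin> C" for z using that by (simp add: \<psi>_def)
  have psi2: "\<psi> z = - winding_sum \<Gamma>' z" if "z \<notin> C'" for z
    using that zero[of z] by (auto simp: \<psi>_def add_eq_0_iff)
  have loc: "\<forall>\<^sub>F w in nhds z. \<psi> w = \<psi> z" for z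
  proof -
    consider "z \<in> C" | "z \<in> C'" "z \<notin> C" | "z \<notin> C" "z \<notin> C'" by blast
    then show ?thesis
    proof cases
      case 1
      then have "z \<notin> C'" using disj by blast
      from winding_sum_locally_constant[OF C(2) this] eventually_nhds_in_open[OF op(1) 1]
      show ?thesis by eventually_elim (use 1 in \<open>simp add: \<psi>_def\<close>)
    next
      case 2
      from winding_sum_locally_constant[OF C(1) 2(2)] eventually_nhds_in_open[OF op(2) 2(1)]
      show ?thesis by eventually_elim (use 2 disj in \<open>auto simp: \<psi>_def\<close>)
    next
      case 3
      from winding_sum_locally_constant[OF C(1) 3(1)] winding_sum_locally_constant[OF C(2) 3(2)]
      show ?thesis
      proof eventually_elim
        case (elim w)
        show ?case using psi1[of w] psi2[of w] psi1[OF 3(1)] psi2[OF 3(2)] disj elim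
          by (metis disjoint_iff)
      qed
    qed
  qed
  have loc': "\<exists>U. openin (top_of_set UNIV) U \<and> z \<in> U \<and> (\<forall>w\<in>U. \<psi> w = \<psi> z)" for z
    using loc[of z] unfolding eventually_nhds by auto
  have "\<psi> constant_on UNIV"
    by (rule locally_constant_imp_constant) (use loc' in blast)+
  then obtain c where c: "\<And>z. \<psi> z = c" by (auto simp: constant_on_def)
  obtain B B' where B: "\<forall>z. B \<le> norm z \<longrightarrow> winding_sum \<Gamma> z = 0" "\<forall>z. B' \<le> norm z \<longrightarrow> winding_sum \<Gamma>' z = 0"
    using winding_sum_zero_at_infinity[OF C(1)] winding_sum_zero_at_infinity[OF C(2)] by blast
  \<comment> \<open>The absolute values make this real number its own modulus, so that it lies
    beyond both bounds.\<close>
  have "\<psi> (of_real (max \<bar>B\<bar> \<bar>B'\<bar>)) = 0" using B by (auto simp: \<psi>_def)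
  with c have "\<psi> z = 0" for z by metis
  with psi1 psi2 show "z \<notin> C \<Longrightarrow> winding_sum \<Gamma> z = 0" "z \<notin> C' \<Longrightarrow> winding_sum \<Gamma>' z = 0"
    by fastforce+
qed

text \<open>The curves are strung together along connecting paths that are run through in both
  directions, so their contributions cancel. Quantifying over all holomorphic \<open>g\<close> makes
  the statement cover the winding numbers as well.\<close>

lemma cycle_joined_to_loop:
  assumes S: "open S" "connected S" and \<Gamma>: "cycle_in S \<Gamma>" "\<Gamma> \<noteq> []"
  obtains \<eta> where "valid_path \<eta>" "pathfinish \<eta> = pathstart \<eta>" "path_image \<eta> \<subseteq> S"
    "\<And>g. g holomorphic_on S \<Longrightarrow> contour_integral \<eta> g = (\<Sum>\<gamma>\<leftarrow>\<Gamma>. contour_integral \<gamma> g)"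
proof -
  have "\<exists>\<eta>. valid_path \<eta> \<and> pathfinish \<eta> = pathstart \<eta> \<and> path_image \<eta> \<subseteq> S \<and>
    (\<forall>g. g holomorphic_on S \<longrightarrow> contour_integral \<eta> g = (\<Sum>\<gamma>\<leftarrow>\<Gamma>. contour_integral \<gamma> g))"
    using \<Gamma>(2,1)
  proof (induction \<Gamma> rule: list_nonempty_induct)
    case (single \<gamma>)
    then show ?case by (intro exI[of _ \<gamma>]) (auto simp: cycle_in_def)
  next
    case (cons \<gamma> \<Gamma>)
    then obtain \<eta> where \<eta>: "valid_path \<eta>" "pathfinish \<eta> = pathstart \<eta>" "path_image \<eta> \<subseteq> S"
      "\<And>g. g holomorphic_on S \<Longrightarrow> contour_integral \<eta> g = (\<Sum>\<gamma>\<leftarrow>\<Gamma>. contour_integral \<gamma> g)"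
      by (auto simp: cycle_in_def)
    have \<gamma>: "valid_path \<gamma>" "pathfinish \<gamma> = pathstart \<gamma>" "path_image \<gamma> \<subseteq> S"
      using cons.prems by (auto simp: cycle_in_def)
    have "pathstart \<gamma> \<in> S" "pathstart \<eta> \<in> S" using \<gamma> \<eta> by auto
    then obtain p where p: "polynomial_function p" "path_image p \<subseteq> S" "pathstart p = pathstart \<gamma>"
        "pathfinish p = pathstart \<eta>"
      using connected_open_polynomial_connected[OF S] by blast
    have vp: "valid_path p" using p(1) by (rule valid_path_polynomial_function)
    define q where "q = \<gamma> +++ p +++ \<eta> +++ reversepath p"
    have "contour_integral q g = (\<Sum>\<gamma>\<leftarrow>\<gamma> # \<Gamma>. contour_integral \<gamma> g)" if g: "g holomorphic_on S" for g
    proof -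
      have int: "g contour_integrable_on \<gamma>" "g contour_integrable_on \<eta>" "g contour_integrable_on p"
        using contour_integrable_holomorphic_simple[OF g S(1)] \<gamma> \<eta> p vp by auto
      then have "contour_integral q g = contour_integral \<gamma> g + (contour_integral p g + (contour_integral \<eta> g
          + contour_integral (reversepath p) g))"
        unfolding q_def using \<gamma> \<eta> p vp
        by (simp add: contour_integrable_reversepath)
      then show ?thesis using \<eta>(4)[OF g] vp int by (simp add: contour_integral_reversepath)
    qed
    moreover have "valid_path q" "pathfinish q = pathstart q" "path_image q \<subseteq> S"
      unfolding q_def using \<gamma> \<eta> p vp by (auto simp: path_image_join)
    ultimately show ?case by blast
  qed
  then show ?thesis using that by blast
qed

text \<open>For w outside S the function 1 / (z - w) is holomorphic on S, so the single loop
  inherits the winding sum of the cycle and the one-curve form of Cauchy's theorem applies to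
  it.\<close>

lemma Cauchy_theorem_cycle_connected:
  assumes S: "open S" "connected S" and \<Gamma>: "cycle_in S \<Gamma>" and g: "g holomorphic_on S"
    and zero: "\<And>w. w \<notin> S \<Longrightarrow> winding_sum \<Gamma> w = 0"
  shows "(\<Sum>\<gamma>\<leftarrow>\<Gamma>. contour_integral \<gamma> g) = 0"
proof (cases "\<Gamma> = []")
  case False
  obtain \<eta> where \<eta>: "valid_path \<eta>" "pathfinish \<eta> = pathstart \<eta>" "path_image \<eta> \<subseteq> S"
    and int: "\<And>g. g holomorphic_on S \<Longrightarrow> contour_integral \<eta> g = (\<Sum>\<gamma>\<leftarrow>\<Gamma>. contour_integral \<gamma> g)"
    using cycle_joined_to_loop[OF S \<Gamma> False] by blast
  have "winding_number \<eta> w = 0" if w: "w \<notin> S" for w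
  proof -
    have hol: "(\<lambda>z. 1 / (z - w)) holomorphic_on S" using w by (auto intro!: holomorphic_intros)
    have "winding_number \<eta> w = 1 / (2 * pi * \<i>) * contour_integral \<eta> (\<lambda>z. 1 / (z - w))"
      using \<eta> w by (subst winding_number_valid_path) auto
    also have "\<dots> = (\<Sum>\<gamma>\<leftarrow>\<Gamma>. 1 / (2 * pi * \<i>) * contour_integral \<gamma> (\<lambda>z. 1 / (z - w)))"
      by (simp only: int[OF hol] sum_list_const_mult)
    also have "\<dots> = winding_sum \<Gamma> w"
      unfolding winding_sum_def
    proof (intro arg_cong[of _ _ sum_list] map_cong refl)
      fix \<gamma> assume "\<gamma> \<in> set \<Gamma>"
      then have "valid_path \<gamma>" "w \<notin> path_image \<gamma>" using \<Gamma> w by (auto simp: cycle_in_def)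
      then show "1 / (2 * pi * \<i>) * contour_integral \<gamma> (\<lambda>z. 1 / (z - w)) = winding_number \<gamma> w"
        by (simp add: winding_number_valid_path)
    qed
    finally show ?thesis using zero[OF w] by simp
  qed
  then have "(g has_contour_integral 0) \<eta>"
    using Cauchy_theorem_global[OF S(1) g \<eta>] by blast
  then show ?thesis using int[OF g] contour_integral_unique by metis
qed simp

text \<open>Each curve lies in one component of S. The curves in the component of a chosen curve are
  split off, and \<open>winding_sum_zero_split\<close> keeps both parts null-homologous in their own
  open sets; the remaining list is shorter because the chosen curve has left it.\<close>

theorem Cauchy_theorem_cycle:
  assumes S: "open S" and \<Gamma>: "cycle_in S \<Gamma>" and g: "g holomorphic_on S"
    and zero: "\<And>w. w \<notin> S \<Longrightarrow> winding_sum \<Gamma> w = 0"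
  shows "(\<Sum>\<gamma>\<leftarrow>\<Gamma>. contour_integral \<gamma> g) = 0"
  using \<Gamma> zero
proof (induction "length \<Gamma>" arbitrary: \<Gamma> rule: less_induct)
  case less
  show ?case
  proof (cases "\<Gamma> = []")
    case False
    then obtain \<gamma>0 where \<gamma>0: "\<gamma>0 \<in> set \<Gamma>" by (cases \<Gamma>) auto
    define C where "C = connected_component_set S (pathstart \<gamma>0)"
    have CS: "C \<subseteq> S" "open C" "connected C"
      unfolding C_def by (auto simp: connected_component_subset open_connected_component[OF S])
    have op': "open (S - C)"
    proof -
      have "S - C = \<Union>(components S - {C})"
      proof -
        have "pathstart \<gamma>0 \<in> S" using \<gamma>0 less.prems by (auto simp: cycle_in_def)
        then have "C \<in> components S" by (auto simp: C_def components_def)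
        then show ?thesis using Union_components[of S] components_nonoverlap[of C S] by blast
      qed
      then show ?thesis using open_components[OF S] by auto
    qed
    have dich: "path_image \<gamma> \<subseteq> C \<or> path_image \<gamma> \<subseteq> S - C" if "\<gamma> \<in> set \<Gamma>" for \<gamma>
    proof (cases "path_image \<gamma> \<inter> C = {}")
      case True then show ?thesis using that less.prems by (auto simp: cycle_in_def)
    next
      case False
      then obtain x where x: "x \<in> path_image \<gamma>" "x \<in> C" by blast
      have "connected (path_image \<gamma>)" "path_image \<gamma> \<subseteq> S"
        using that less.prems by (auto simp: cycle_in_def connected_path_image valid_path_imp_path)
      then have "path_image \<gamma> \<subseteq> connected_component_set S x"
        using x by (intro connected_component_maximal) auto
      also have "\<dots> = C" using x(2) unfolding C_def by (metis connected_component_eq)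
      finally show ?thesis by simp
    qed
    define \<Gamma>1 where "\<Gamma>1 = filter (\<lambda>\<gamma>. path_image \<gamma> \<subseteq> C) \<Gamma>"
    define \<Gamma>2 where "\<Gamma>2 = filter (\<lambda>\<gamma>. \<not> path_image \<gamma> \<subseteq> C) \<Gamma>"
    have split: "(\<Sum>\<gamma>\<leftarrow>\<Gamma>. h \<gamma>) = (\<Sum>\<gamma>\<leftarrow>\<Gamma>1. h \<gamma>) + (\<Sum>\<gamma>\<leftarrow>\<Gamma>2. h \<gamma>)" for h :: "_ \<Rightarrow> complex"
      unfolding \<Gamma>1_def \<Gamma>2_def by (induction \<Gamma>) (auto simp: add_ac)
    have "path_image \<gamma> \<subseteq> S - C" if "\<gamma> \<in> set \<Gamma>2" for \<gamma>
      using dich[of \<gamma>] that by (auto simp: \<Gamma>2_def)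
    then have cyc: "cycle_in C \<Gamma>1" "cycle_in (S - C) \<Gamma>2"
      using less.prems(1) unfolding cycle_in_def by (auto simp: \<Gamma>1_def \<Gamma>2_def)
    have z: "winding_sum \<Gamma>1 z + winding_sum \<Gamma>2 z = 0" if "z \<notin> C" "z \<notin> S - C" for z
      using less.prems(2)[of z] that by (auto simp: winding_sum_def split)
    note w = winding_sum_zero_split[OF cyc _ z CS(2) op']
    have "(\<Sum>\<gamma>\<leftarrow>\<Gamma>1. contour_integral \<gamma> g) = 0"
      using cyc(1) w(1) CS g
      by (intro Cauchy_theorem_cycle_connected[of C]) (auto intro: holomorphic_on_subset)
    moreover have "(\<Sum>\<gamma>\<leftarrow>\<Gamma>2. contour_integral \<gamma> g) = 0"
    proof (rule less.hyps)
      have "path_image \<gamma>0 \<subseteq> C"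
      proof -
        have "pathstart \<gamma>0 \<in> path_image \<gamma>0" by (rule pathstart_in_path_image)
        moreover have "pathstart \<gamma>0 \<in> C"
          using \<gamma>0 less.prems by (auto simp: cycle_in_def C_def)
        ultimately show ?thesis using dich[OF \<gamma>0] by blast
      qed
      then show "length \<Gamma>2 < length \<Gamma>" unfolding \<Gamma>2_def using \<gamma>0 by (intro length_filter_less) auto
      show "cycle_in S \<Gamma>2" using cyc(2) by (auto simp: cycle_in_def)
      show "winding_sum \<Gamma>2 v = 0" if "v \<notin> S" for v using w(2)[of v] that by blast
    qed
    ultimately show ?thesis by (simp add: split)
  qed simp
qed

section \<open>Closed Banach space valued forms\<close>

text \<open>The pullback of the one-form P dx + Q dy along the curve.\<close>

definition form_integrand ::
    "(complex \<Rightarrow> 'a::real_normed_vector) \<Rightarrow> (complex \<Rightarrow> 'a) \<Rightarrow> (real \<Rightarrow> complex) \<Rightarrow> real \<Rightarrow> 'a"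
  where "form_integrand P Q \<gamma> t = Re (vector_derivative \<gamma> (at t)) *\<^sub>R P (\<gamma> t)
    + Im (vector_derivative \<gamma> (at t)) *\<^sub>R Q (\<gamma> t)"

text \<open>The Cauchy-Riemann equations making both \<open>P dx + Q dy\<close> and \<open>Q dx - P dy\<close> closed; for real
  functionals \<open>\<phi>\<close> they say that \<open>\<phi> P - \<i> \<phi> Q\<close> is holomorphic.\<close>

definition cr_pair :: "complex set \<Rightarrow> (complex \<Rightarrow> 'a::real_normed_vector) \<Rightarrow> (complex \<Rightarrow> 'a) \<Rightarrow> bool"
  where "cr_pair S P Q \<longleftrightarrow> (\<forall>z\<in>S. \<exists>X Y.
    (P has_derivative (\<lambda>h. Re h *\<^sub>R X + Im h *\<^sub>R Y)) (at z) \<and>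
    (Q has_derivative (\<lambda>h. Re h *\<^sub>R Y - Im h *\<^sub>R X)) (at z))"

lemma cr_pair_subset: "cr_pair S P Q \<Longrightarrow> S' \<subseteq> S \<Longrightarrow> cr_pair S' P Q"
  unfolding cr_pair_def by blast

lemma cr_pair_continuous:
  assumes "cr_pair S P Q"
  shows "continuous_on S P" "continuous_on S Q"
  using assms unfolding cr_pair_def
  by (auto intro!: continuous_at_imp_continuous_on dest!: bspec has_derivative_continuous)

lemma cr_pair_holomorphic:
  fixes \<phi> :: "'a::real_normed_vector \<Rightarrow> real"
  assumes "cr_pair S P Q" and \<phi>: "bounded_linear \<phi>"
  shows "(\<lambda>z. Complex (\<phi> (P z)) (- \<phi> (Q z))) holomorphic_on S"
  unfolding holomorphic_on_def
proof
  fix z assume "z \<in> S"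
  then obtain X Y where D: "(P has_derivative (\<lambda>h. Re h *\<^sub>R X + Im h *\<^sub>R Y)) (at z)"
      "(Q has_derivative (\<lambda>h. Re h *\<^sub>R Y - Im h *\<^sub>R X)) (at z)"
    using assms(1) unfolding cr_pair_def by blast
  note lin = linear_add[OF bounded_linear.linear[OF \<phi>]] linear_diff[OF bounded_linear.linear[OF \<phi>]]
     linear_scale[OF bounded_linear.linear[OF \<phi>]]
  have "((\<lambda>z. of_real (\<phi> (P z)) - \<i> * of_real (\<phi> (Q z))) has_derivative
      (\<lambda>h. of_real (\<phi> (Re h *\<^sub>R X + Im h *\<^sub>R Y)) - \<i> * of_real (\<phi> (Re h *\<^sub>R Y - Im h *\<^sub>R X)))) (at z)"
    by (intro has_derivative_diff has_derivative_mult_right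
        bounded_linear.has_derivative[OF bounded_linear_of_real] bounded_linear.has_derivative[OF \<phi>] D)
  also have "(\<lambda>h. of_real (\<phi> (Re h *\<^sub>R X + Im h *\<^sub>R Y)) - \<i> * of_real (\<phi> (Re h *\<^sub>R Y - Im h *\<^sub>R X)))
      = (*) (Complex (\<phi> X) (- \<phi> Y))"
    by (rule ext) (simp add: lin complex_eq_iff algebra_simps)
  finally have "((\<lambda>z. of_real (\<phi> (P z)) - \<i> * of_real (\<phi> (Q z))) has_field_derivative
      (Complex (\<phi> X) (- \<phi> Y))) (at z)"
    unfolding has_field_derivative_def .
  moreover have "(\<lambda>z. of_real (\<phi> (P z)) - \<i> * of_real (\<phi> (Q z))) = (\<lambda>z. Complex (\<phi> (P z)) (- \<phi> (Q z)))"
    by (rule ext) (simp add: complex_eq_iff)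
  ultimately show "(\<lambda>z. Complex (\<phi> (P z)) (- \<phi> (Q z))) field_differentiable at z within S"
    unfolding field_differentiable_def by (auto intro: has_field_derivative_at_within)
qed

text \<open>For real p and q, p dx + q dy is the real part of (p - i q) (dx + i dy). This accounts
  for the sign in front of Q.\<close>

lemma functional_form_integral:
  fixes \<phi> :: "'a::real_normed_vector \<Rightarrow> real"
  assumes \<phi>: "bounded_linear \<phi>" and int: "form_integrand P Q \<gamma> integrable_on {0..1}"
    and g: "(\<lambda>z. Complex (\<phi> (P z)) (- \<phi> (Q z))) contour_integrable_on \<gamma>"
  shows "\<phi> (integral {0..1} (form_integrand P Q \<gamma>))
    = Re (contour_integral \<gamma> (\<lambda>z. Complex (\<phi> (P z)) (- \<phi> (Q z))))"
proof -
  let ?g = "\<lambda>z. Complex (\<phi> (P z)) (- \<phi> (Q z))"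
  note lin = linear_add[OF bounded_linear.linear[OF \<phi>]] linear_scale[OF bounded_linear.linear[OF \<phi>]]
  have "(?g has_contour_integral contour_integral \<gamma> ?g) \<gamma>"
    using g by (rule has_contour_integral_integral)
  then have "((\<lambda>t. ?g (\<gamma> t) * vector_derivative \<gamma> (at t)) has_integral contour_integral \<gamma> ?g) {0..1}"
    by (simp add: has_contour_integral)
  from has_integral_Re[OF this]
  have "((\<lambda>t. \<phi> (form_integrand P Q \<gamma> t)) has_integral Re (contour_integral \<gamma> ?g)) {0..1}"
    by (simp add: form_integrand_def lin algebra_simps)
  moreover have "((\<lambda>t. \<phi> (form_integrand P Q \<gamma> t)) has_integral \<phi> (integral {0..1} (form_integrand P Q \<gamma>))) {0..1}"
    using has_integral_linear[OF integrable_integral[OF int] \<phi>] by (simp add: o_def)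
  ultimately show ?thesis by (rule has_integral_unique[symmetric])
qed

lemma form_integrand_linepath:
  "form_integrand P Q (linepath a b) t
    = Re (b - a) *\<^sub>R P (linepath a b t) + Im (b - a) *\<^sub>R Q (linepath a b t)"
  by (simp add: form_integrand_def)

lemma form_integrable_linepath:
  fixes P Q :: "complex \<Rightarrow> 'a::banach"
  assumes "cr_pair S P Q" "closed_segment a b \<subseteq> S"
  shows "form_integrand P Q (linepath a b) integrable_on {0..1}"
proof -
  have "continuous_on {0..1} (\<lambda>t. P (linepath a b t))" "continuous_on {0..1} (\<lambda>t. Q (linepath a b t))"
    using assms by (auto intro!: continuous_on_compose2[OF cr_pair_continuous(1)[OF assms(1)]]
      continuous_on_compose2[OF cr_pair_continuous(2)[OF assms(1)]] continuous_intros
      simp: linepath_image_01[symmetric])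
  then show ?thesis
    unfolding form_integrand_linepath[abs_def] by (intro integrable_continuous_real continuous_intros)
qed

text \<open>Path independence on a disc. Each real functional turns the form into the real part of a
  holomorphic g dz, which has a primitive there; the functionals then separate the two sides. On
  segments integrability follows from continuity, so nothing circular enters.\<close>

lemma form_integral_triangle:
  fixes P Q :: "complex \<Rightarrow> 'a::banach"
  assumes cr: "cr_pair (ball c r) P Q" and w: "w \<in> ball c r" "w' \<in> ball c r"
  shows "integral {0..1} (form_integrand P Q (linepath c w')) - integral {0..1} (form_integrand P Q (linepath c w))
    = integral {0..1} (form_integrand P Q (linepath w w'))"
proof (rule eq_if_bounded_linear_eq)
  fix \<phi> :: "'a \<Rightarrow> real" assume \<phi>: "bounded_linear \<phi>"
  define g where "g = (\<lambda>z. Complex (\<phi> (P z)) (- \<phi> (Q z)))"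
  have hol: "g holomorphic_on ball c r"
    unfolding g_def by (rule cr_pair_holomorphic[OF cr \<phi>])
  obtain G where G: "\<And>x. x \<in> ball c r \<Longrightarrow> (G has_field_derivative g x) (at x within ball c r)"
    using holomorphic_convex_primitive'[OF convex_ball open_ball hol] by blast
  have c: "c \<in> ball c r" using w(1) zero_le_dist[of c w] unfolding mem_ball dist_self by linarith
  have seg: "closed_segment a b \<subseteq> ball c r" if "a \<in> ball c r" "b \<in> ball c r" for a b
    using that by (rule closed_segment_subset) simp
  have ci: "(g has_contour_integral G b - G a) (linepath a b)" if "a \<in> ball c r" "b \<in> ball c r" for a b
    using contour_integral_primitive[OF G, where g = "linepath a b"] seg[OF that] by auto
  have *: "\<phi> (integral {0..1} (form_integrand P Q (linepath a b))) = Re (G b - G a)"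
    if "a \<in> ball c r" "b \<in> ball c r" for a b
    using functional_form_integral[OF \<phi> form_integrable_linepath[OF cr seg[OF that]]] ci[OF that]
    unfolding g_def by (metis contour_integrable_on_def contour_integral_unique)
  show "\<phi> (integral {0..1} (form_integrand P Q (linepath c w')) - integral {0..1} (form_integrand P Q (linepath c w)))
    = \<phi> (integral {0..1} (form_integrand P Q (linepath w w')))"
    using c w by (simp add: linear_diff[OF bounded_linear.linear[OF \<phi>]] *)
qed

text \<open>The primitive is the integral along the segment from the centre. Triangle additivity
  reduces its increment to a short segment, on which P and Q are nearly constant. It serves to
  integrate along arbitrary valid paths.\<close>

lemma cr_pair_primitive:
  fixes P Q :: "complex \<Rightarrow> 'a::banach"
  assumes cr: "cr_pair (ball c r) P Q"
  obtains \<Psi> where "\<And>w. w \<in> ball c r \<Longrightarrow> (\<Psi> has_derivative (\<lambda>h. Re h *\<^sub>R P w + Im h *\<^sub>R Q w)) (at w)"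
proof -
  define \<Psi> where "\<Psi> w = integral {0..1} (form_integrand P Q (linepath c w))" for w
  have "(\<Psi> has_derivative (\<lambda>h. Re h *\<^sub>R P w + Im h *\<^sub>R Q w)) (at w)" if w: "w \<in> ball c r" for w
    unfolding has_derivative_at_alt
  proof (intro conjI allI impI)
    show "bounded_linear (\<lambda>h. Re h *\<^sub>R P w + Im h *\<^sub>R Q w)"
      by (intro bounded_linear_add bounded_linear_compose[OF bounded_linear_scaleR_left]
          bounded_linear_Re bounded_linear_Im)
    fix e :: real assume e: "e > 0"
    have "\<forall>\<^sub>F z in nhds w. z \<in> ball c r \<and> dist (P z) (P w) < e/2 \<and> dist (Q z) (Q w) < e/2"
    proof (intro eventually_conj)
      show "\<forall>\<^sub>F z in nhds w. z \<in> ball c r" by (rule eventually_nhds_in_open) (use w in auto)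
      have "isCont P w" "isCont Q w"
        using cr_pair_continuous[OF cr] w by (auto simp: continuous_on_eq_continuous_at)
      then have "(P \<longlongrightarrow> P w) (nhds w)" "(Q \<longlongrightarrow> Q w) (nhds w)"
        by (simp_all add: isCont_def tendsto_at_iff_tendsto_nhds)
      then show "\<forall>\<^sub>F z in nhds w. dist (P z) (P w) < e/2" "\<forall>\<^sub>F z in nhds w. dist (Q z) (Q w) < e/2"
        using half_gt_zero[OF e] by (simp_all only: tendstoD)
    qed
    then obtain d where d: "d > 0" and near: "\<And>z. dist z w < d \<Longrightarrow> z \<in> ball c r \<and> dist (P z) (P w) < e/2 \<and> dist (Q z) (Q w) < e/2"
      unfolding eventually_nhds_metric by blast
    show "\<exists>d>0. \<forall>y. norm (y - w) < d \<longrightarrow>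
      norm (\<Psi> y - \<Psi> w - (Re (y - w) *\<^sub>R P w + Im (y - w) *\<^sub>R Q w)) \<le> e * norm (y - w)"
    proof (intro exI[of _ d] conjI d allI impI)
      fix y assume y: "norm (y - w) < d"
      have yb: "y \<in> ball c r" using near[of y] y by (simp add: dist_norm)
      have seg: "closed_segment w y \<subseteq> ball c r" using w yb by (rule closed_segment_subset) simp
      let ?D = "Re (y - w) *\<^sub>R P w + Im (y - w) *\<^sub>R Q w"
      have "\<Psi> y - \<Psi> w = integral {0..1} (form_integrand P Q (linepath w y))"
        unfolding \<Psi>_def by (rule form_integral_triangle[OF cr w yb])
      then have "((\<lambda>t. form_integrand P Q (linepath w y) t - ?D) has_integral (\<Psi> y - \<Psi> w - ?D)) {0..1}"
        using has_integral_diff[OF integrable_integral[OF form_integrable_linepath[OF cr seg]]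
            has_integral_const_real[of ?D 0 1]] by simp
      moreover have "norm (form_integrand P Q (linepath w y) t - ?D) \<le> e * norm (y - w)" if t: "t \<in> {0..1}" for t
      proof -
        let ?z = "linepath w y t"
        have "?z \<in> closed_segment w y" using t by (metis linepath_in_path atLeastAtMost_iff)
        then have "dist ?z w \<le> norm (y - w)" using segment_bound(1)[of ?z w y] by (simp add: dist_norm)
        then have *: "norm (P ?z - P w) \<le> e/2" "norm (Q ?z - Q w) \<le> e/2"
          using near[of ?z] y by (auto simp: dist_norm)
        have "form_integrand P Q (linepath w y) t - ?D = Re (y - w) *\<^sub>R (P ?z - P w) + Im (y - w) *\<^sub>R (Q ?z - Q w)"
          by (simp add: form_integrand_linepath algebra_simps)
        also have "norm \<dots> \<le> \<bar>Re (y - w)\<bar> * norm (P ?z - P w) + \<bar>Im (y - w)\<bar> * norm (Q ?z - Q w)"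
          by (rule order_trans[OF norm_triangle_ineq]) simp
        also have "\<dots> \<le> norm (y - w) * (e/2) + norm (y - w) * (e/2)"
          using * by (intro add_mono mult_mono abs_Re_le_cmod abs_Im_le_cmod) auto
        finally show ?thesis by (simp add: mult.commute)
      qed
      ultimately show "norm (\<Psi> y - \<Psi> w - ?D) \<le> e * norm (y - w)"
        using has_integral_bound_real[of "e * norm (y - w)" "{}" _ "\<Psi> y - \<Psi> w - ?D" 0 1] e by simp
    qed
  qed
  then show ?thesis using that by blast
qed

text \<open>The velocity of a valid path is continuous only off a finite set and may be unbounded
  near it, so continuity does not settle integrability. Locally, however, the integrand is the
  derivative of the continuous function \<Psi> composed with the path, and integrability on small
  subintervals suffices.\<close>

lemma form_integrable:
  fixes P Q :: "complex \<Rightarrow> 'a::banach"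
  assumes S: "open S" and cr: "cr_pair S P Q" and \<gamma>: "valid_path \<gamma>" "path_image \<gamma> \<subseteq> S"
  shows "form_integrand P Q \<gamma> integrable_on {0..1}"
proof -
  have cont: "continuous_on {0..1} \<gamma>" using \<gamma>(1) by (simp add: valid_path_def piecewise_C1_differentiable_on_def)
  obtain N where N: "finite N" "\<gamma> C1_differentiable_on ({0..1} - N)"
    using \<gamma>(1) by (auto simp: valid_path_def piecewise_C1_differentiable_on_def)
  have "form_integrand P Q \<gamma> integrable_on cbox 0 1"
  proof (rule integrable_on_little_subintervals, rule ballI)
    fix x :: real assume "x \<in> cbox 0 1"
    then have x: "x \<in> {0..1}" by simp
    then have "\<gamma> x \<in> S" using \<gamma>(2) by (auto simp: path_image_def)
    then obtain r where r: "r > 0" "ball (\<gamma> x) r \<subseteq> S" using S open_contains_ball by blast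
    from cr_pair_primitive[OF cr_pair_subset[OF cr r(2)]] obtain \<Psi> where
      \<Psi>: "\<And>w. w \<in> ball (\<gamma> x) r \<Longrightarrow> (\<Psi> has_derivative (\<lambda>h. Re h *\<^sub>R P w + Im h *\<^sub>R Q w)) (at w)" by blast
    obtain d where d: "d > 0" "\<And>t. t \<in> {0..1} \<Longrightarrow> dist t x < d \<Longrightarrow> dist (\<gamma> t) (\<gamma> x) < r"
      using cont x r(1) unfolding continuous_on_iff by blast
    show "\<exists>d>0. \<forall>u v. x \<in> cbox u v \<and> cbox u v \<subseteq> ball x d \<and> cbox u v \<subseteq> cbox 0 1 \<longrightarrow>
        form_integrand P Q \<gamma> integrable_on cbox u v"
    proof (intro exI[of _ d] conjI d allI impI)
      fix u v :: real assume uv: "x \<in> cbox u v \<and> cbox u v \<subseteq> ball x d \<and> cbox u v \<subseteq> cbox 0 1"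
      then have le: "u \<le> v" and sub: "{u..v} \<subseteq> {0..1}" by auto
      have inb: "\<gamma> t \<in> ball (\<gamma> x) r" if "t \<in> {u..v}" for t
        using d(2)[of t] uv that sub by (auto simp: dist_commute subset_iff)
      have "(form_integrand P Q \<gamma> has_integral ((\<Psi> \<circ> \<gamma>) v - (\<Psi> \<circ> \<gamma>) u)) {u..v}"
      \<comment> \<open>At the finitely many points of \<open>N\<close> only continuity of the
        composite is asked for.\<close>
      proof (rule fundamental_theorem_of_calculus_interior_strong[OF N(1) le])
        fix t assume t: "t \<in> {u<..<v} - N"
        then have "t \<in> {0..1} - N" "t \<in> {u..v}" using sub by auto
        then have "(\<gamma> has_vector_derivative vector_derivative \<gamma> (at t)) (at t)"
          using N(2) by (auto simp: C1_differentiable_on_eq vector_derivative_works)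
        from vector_derivative_diff_chain_within[OF this has_derivative_at_withinI[OF \<Psi>[OF inb[OF \<open>t \<in> {u..v}\<close>]]]]
        show "((\<Psi> \<circ> \<gamma>) has_vector_derivative form_integrand P Q \<gamma> t) (at t)"
          by (simp add: form_integrand_def)
      next
        have "continuous_on (ball (\<gamma> x) r) \<Psi>"
          using \<Psi> has_derivative_continuous by (blast intro: continuous_at_imp_continuous_on)
        then show "continuous_on {u..v} (\<Psi> \<circ> \<gamma>)"
          unfolding o_def using inb by (intro continuous_on_compose2[OF _ continuous_on_subset[OF cont sub]]) auto
      qed
      then show "form_integrand P Q \<gamma> integrable_on cbox u v" by (auto simp: integrable_on_def)
    qed
  qed
  then show ?thesis by simp
qed

theorem Cauchy_theorem_form_cycle:
  fixes P Q :: "complex \<Rightarrow> 'a::banach"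
  assumes S: "open S" and cr: "cr_pair S P Q" and \<Gamma>: "cycle_in S \<Gamma>"
    and zero: "\<And>w. w \<notin> S \<Longrightarrow> winding_sum \<Gamma> w = 0"
  shows "(\<Sum>\<gamma>\<leftarrow>\<Gamma>. integral {0..1} (form_integrand P Q \<gamma>)) = 0"
proof (rule eq_if_bounded_linear_eq)
  fix \<phi> :: "'a \<Rightarrow> real" assume \<phi>: "bounded_linear \<phi>"
  define g where "g = (\<lambda>z. Complex (\<phi> (P z)) (- \<phi> (Q z)))"
  have hol: "g holomorphic_on S" unfolding g_def by (rule cr_pair_holomorphic[OF cr \<phi>])
  have *: "\<phi> (integral {0..1} (form_integrand P Q \<gamma>)) = Re (contour_integral \<gamma> g)" if "\<gamma> \<in> set \<Gamma>" for \<gamma>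
    unfolding g_def
  proof (rule functional_form_integral[OF \<phi> form_integrable[OF S cr]])
    show "valid_path \<gamma>" "path_image \<gamma> \<subseteq> S" using \<Gamma> that by (auto simp: cycle_in_def)
    then show "(\<lambda>z. Complex (\<phi> (P z)) (- \<phi> (Q z))) contour_integrable_on \<gamma>"
      using contour_integrable_holomorphic_simple[OF hol S] unfolding g_def by blast
  qed
  have "\<phi> (\<Sum>\<gamma>\<leftarrow>\<Gamma>. integral {0..1} (form_integrand P Q \<gamma>))
      = (\<Sum>\<gamma>\<leftarrow>\<Gamma>. \<phi> (integral {0..1} (form_integrand P Q \<gamma>)))"
    using bounded_linear.linear[OF \<phi>] by (induction \<Gamma>) (auto simp: linear_0 linear_add)
  also have "\<dots> = (\<Sum>\<gamma>\<leftarrow>\<Gamma>. Re (contour_integral \<gamma> g))"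
    by (intro arg_cong[of _ _ sum_list] map_cong refl *)
  also have "\<dots> = Re (\<Sum>\<gamma>\<leftarrow>\<Gamma>. contour_integral \<gamma> g)" by (induction \<Gamma>) auto
  also have "\<dots> = \<phi> 0"
    using Cauchy_theorem_cycle[OF S \<Gamma> hol zero] bounded_linear.linear[OF \<phi>] by (simp add: linear_0)
  finally show "\<phi> (\<Sum>\<gamma>\<leftarrow>\<Gamma>. integral {0..1} (form_integrand P Q \<gamma>)) = \<phi> 0" .
qed

section \<open>Inverses and one-sided holomorphy in Banach algebras\<close>

lemma alg_inverse_unique:
  assumes "x * y = 1" "y * x = 1"
  shows "alg_inverse x = y"
proof -
  have "alg_invertible x" using assms by (auto simp: alg_invertible_def)
  then have "alg_inverse x = alg_inverse x * (x * y)" "alg_inverse x * x = 1"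
    using assms alg_inverse by simp_all
  then show ?thesis by (metis mult.assoc mult_1_left)
qed

lemma alg_inverse_commute:
  assumes "alg_invertible x" "x * c = c * x"
  shows "alg_inverse x * c = c * alg_inverse x"
proof -
  note inv = alg_inverse[OF assms(1)]
  have "alg_inverse x * c = alg_inverse x * (c * x) * alg_inverse x" using inv by (simp add: mult.assoc)
  also have "\<dots> = c * alg_inverse x" using inv by (simp flip: assms(2) add: mult.assoc[symmetric])
  finally show ?thesis .
qed

lemma alg_invertible_mult:
  assumes "alg_invertible x" "alg_invertible y"
  shows "alg_invertible (x * y)"
proof -
  have "x * y * (alg_inverse y * alg_inverse x) = x * (y * alg_inverse y) * alg_inverse x"
    "alg_inverse y * alg_inverse x * (x * y) = alg_inverse y * (alg_inverse x * x) * y"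
    by (simp_all only: mult.assoc)
  then show ?thesis unfolding alg_invertible_def using alg_inverse assms by (metis mult_1_right)
qed

text \<open>The right inverse is immediate. Commuting factors make x commute with x x', hence with
  its inverse, and this turns the right inverse into a two-sided one.\<close>

lemma alg_inverse_factor:
  assumes inv: "alg_invertible (x * x')" and comm: "x * x' = x' * x"
  shows "alg_invertible x" "alg_inverse x = x' * alg_inverse (x * x')"
proof -
  let ?y = "x' * alg_inverse (x * x')"
  have 1: "x * ?y = 1" using alg_inverse[OF inv] by (simp add: mult.assoc)
  have "x * x' * x = x * (x * x')" by (simp only: mult.assoc comm[symmetric])
  from alg_inverse_commute[OF inv this] have "?y * x = x' * x * alg_inverse (x * x')"
    by (simp add: mult.assoc)
  then have 2: "?y * x = 1" using alg_inverse[OF inv] comm by simp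
  show "alg_invertible x" using 1 2 by (auto simp: alg_invertible_def)
  show "alg_inverse x = ?y" using 1 2 by (rule alg_inverse_unique)
qed

text \<open>The Neumann series. The bound carries \<open>norm 1\<close> because the unit may have a
  norm other than 1; it is 0 in the zero algebra.\<close>

lemma alg_invertible_one_minus:
  fixes h :: "'a::{banach, real_normed_algebra, monoid_mult}"
  assumes "norm h < 1"
  shows "alg_invertible (1 - h)"
proof -
  have "norm (h ^ n) \<le> norm (1::'a) * norm h ^ n" for n
  proof (induction n)
    case (Suc n)
    have "norm (h ^ Suc n) \<le> norm h * norm (h ^ n)" by (simp add: norm_mult_ineq)
    also have "\<dots> \<le> norm h * (norm (1::'a) * norm h ^ n)" by (intro mult_left_mono Suc) simp
    finally show ?case by (simp add: mult_ac)
  qed simp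
  moreover have "summable (\<lambda>n. norm (1::'a) * norm h ^ n)"
    using assms by (intro summable_mult summable_geometric) simp
  ultimately have sm: "summable (\<lambda>n. h ^ n)"
    using summable_comparison_test' by blast
  have tel: "(\<lambda>n. h ^ n - h ^ Suc n) sums 1"
    using telescope_sums'[OF summable_LIMSEQ_zero[OF sm]] by simp
  have "(\<lambda>n. (1 - h) * h ^ n) = (\<lambda>n. h ^ n - h ^ Suc n)"
    by (simp only: left_diff_distrib power_Suc mult_1_left)
  then have 1: "(1 - h) * (\<Sum>n. h ^ n) = 1"
    using sums_unique2[OF sums_mult[OF summable_sums[OF sm], of "1 - h"]] tel by simp
  have "(\<lambda>n. h ^ n * (1 - h)) = (\<lambda>n. h ^ n - h ^ Suc n)"
    by (simp only: right_diff_distrib power_Suc2 mult_1_right)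
  then have 2: "(\<Sum>n. h ^ n) * (1 - h) = 1"
    using sums_unique2[OF sums_mult2[OF summable_sums[OF sm], of "1 - h"]] tel by simp
  from 1 2 show ?thesis unfolding alg_invertible_def by blast
qed

text \<open>Writing z = x (1 - y (x - z)) with y inverse to x reduces the claim to the Neumann
  series.\<close>

lemma open_alg_invertible: "open {x :: 'a::{banach, real_normed_algebra, monoid_mult}. alg_invertible x}"
proof (clarsimp simp: open_dist)
  fix x :: 'a assume x: "alg_invertible x"
  let ?y = "alg_inverse x"
  show "\<exists>e>0. \<forall>z. dist z x < e \<longrightarrow> alg_invertible z"
  \<comment> \<open>The added 1 keeps the radius positive when \<open>?y\<close> is 0, as happens in
    the zero algebra.\<close>
  proof (intro exI[of _ "1 / (norm ?y + 1)"] conjI allI impI)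
    show "0 < 1 / (norm ?y + 1)" by (simp add: add_nonneg_pos)
    fix z assume "dist z x < 1 / (norm ?y + 1)"
    then have d: "norm (x - z) * (norm ?y + 1) < 1"
      by (simp add: dist_norm norm_minus_commute pos_less_divide_eq add_nonneg_pos)
    have "norm (?y * (x - z)) \<le> norm ?y * norm (x - z)" by (rule norm_mult_ineq)
    also have "\<dots> \<le> norm (x - z) * (norm ?y + 1)" by (simp add: algebra_simps)
    also note d
    finally have "alg_invertible (1 - ?y * (x - z))" by (rule alg_invertible_one_minus)
    from alg_invertible_mult[OF x this] have "alg_invertible (x - x * ?y * (x - z))"
      by (simp add: algebra_simps)
    then show "alg_invertible z" using alg_inverse[OF x] by simp
  qed
qed

lemma has_derivative_alg_inverse_at:
  fixes x :: "'a::{banach, real_normed_algebra, monoid_mult}"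
  assumes x: "alg_invertible x"
  shows "(alg_inverse has_derivative (\<lambda>h. - (alg_inverse x * h * alg_inverse x))) (at x)"
  unfolding has_derivative_at_alt
proof (intro conjI allI impI)
  define y where "y = alg_inverse x"
  have y: "x * y = 1" "y * x = 1" using alg_inverse[OF x] by (simp_all add: y_def)
  show "bounded_linear (\<lambda>h. - (alg_inverse x * h * alg_inverse x))"
    by (intro bounded_linear_minus bounded_linear_mult_const bounded_linear_const_mult bounded_linear_ident)
  fix e :: real assume e: "e > 0"
  obtain r where r: "r > 0" "\<And>z. dist z x < r \<Longrightarrow> alg_invertible z"
    using open_alg_invertible x unfolding open_dist by blast
  \<comment> \<open>The three bounds give, in turn, invertibility of z, the estimate norm w \<le> 2
    norm y for its inverse, and a quadratic remainder 2 norm y ^ 3 \<delta> ^ 2 of size at most e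
    \<delta>. The added 1 avoids division by 0.\<close>
  define d where "d = min r (min (1 / (2 * norm y + 1)) (e / (2 * norm y ^ 3 + 1)))"
  show "\<exists>d>0. \<forall>z. norm (z - x) < d \<longrightarrow>
      norm (alg_inverse z - alg_inverse x - - (alg_inverse x * (z - x) * alg_inverse x)) \<le> e * norm (z - x)"
  proof (intro exI[of _ d] conjI allI impI)
    show "d > 0" unfolding d_def using r e by (simp add: add_nonneg_pos)
    fix z assume z: "norm (z - x) < d"
    define w where "w = alg_inverse z"
    have "alg_invertible z" using r z by (simp add: d_def dist_norm)
    then have w: "z * w = 1" "w * z = 1" unfolding w_def by (rule alg_inverse)+
    define \<delta> where "\<delta> = norm (z - x)"
    have dl: "\<delta> \<ge> 0" by (simp add: \<delta>_def)
    have "\<delta> < 1 / (2 * norm y + 1)" "\<delta> < e / (2 * norm y ^ 3 + 1)" using z by (simp_all add: d_def \<delta>_def)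
    then have "\<delta> * (2 * norm y + 1) < 1" "\<delta> * (2 * norm y ^ 3 + 1) < e"
      by (simp_all add: pos_less_divide_eq add_nonneg_pos)
    then have d1: "\<delta> * norm y \<le> 1/2" and d2: "2 * norm y ^ 3 * \<delta> \<le> e"
      using dl by (simp_all add: algebra_simps)
    have "w * (x - z) * y = w * (x * y) - (w * z) * y" by (simp add: algebra_simps)
    then have diff: "w - y = w * (x - z) * y" by (simp add: y w)
    have n1: "norm (w - y) \<le> norm w * \<delta> * norm y"
      unfolding diff \<delta>_def norm_minus_commute[of z x]
      by (rule order_trans[OF norm_mult_ineq]) (intro mult_right_mono norm_mult_ineq norm_ge_zero)
    also have "\<dots> \<le> norm w * (1/2)" using mult_left_mono[OF d1, of "norm w"] by (simp add: mult.assoc)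
    finally have "norm w \<le> 2 * norm y" using norm_triangle_sub[of w y] by simp
    then have n2: "norm (w - y) \<le> 2 * norm y * \<delta> * norm y"
      using n1 mult_right_mono[of "norm w" "2 * norm y" "\<delta> * norm y"] dl by (simp add: mult.assoc)
    have "w - y + y * (z - x) * y = w * (x - z) * y - y * (x - z) * y"
      unfolding diff by (simp add: algebra_simps)
    also have "\<dots> = (w - y) * (x - z) * y" by (simp add: algebra_simps)
    finally have "norm (w - y + y * (z - x) * y) \<le> norm (w - y) * \<delta> * norm y"
      unfolding \<delta>_def norm_minus_commute[of z x]
      by (metis (no_types) norm_mult_ineq mult_right_mono norm_ge_zero order_trans)
    also have "\<dots> \<le> (2 * norm y * \<delta> * norm y) * \<delta> * norm y"
      using dl n2 by (intro mult_right_mono) auto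
    also have "\<dots> = (2 * norm y ^ 3 * \<delta>) * \<delta>" by (simp add: power3_eq_cube)
    also have "\<dots> \<le> e * \<delta>" using d2 dl by (rule mult_right_mono)
    finally show "norm (alg_inverse z - alg_inverse x - - (alg_inverse x * (z - x) * alg_inverse x)) \<le> e * norm (z - x)"
      by (simp add: w_def y_def \<delta>_def)
  qed
qed

lemma has_derivative_alg_inverse:
  fixes f :: "'b::real_normed_vector \<Rightarrow> 'a::{banach, real_normed_algebra, monoid_mult}"
  assumes "(f has_derivative f') (at z)" "alg_invertible (f z)"
  shows "((\<lambda>w. alg_inverse (f w)) has_derivative (\<lambda>h. - (alg_inverse (f z) * f' h * alg_inverse (f z)))) (at z)"
  using has_derivative_compose[OF assms(1) has_derivative_alg_inverse_at[OF assms(2)]] .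

section \<open>One-sided holomorphic functions\<close>

definition cplx :: "'a::{real_normed_algebra, monoid_mult} \<Rightarrow> complex \<Rightarrow> 'a"
  where "cplx j h = Re h *\<^sub>R 1 + Im h *\<^sub>R j"

text \<open>Real differentiability together with the Cauchy-Riemann equation X_y = j X_x; for
  \<open>rhol\<close> below it reads X_y = X_x j. The increment is kept as a factor so that product
  rules become a matter of moving it past other factors.\<close>

definition lhol :: "'a::{real_normed_algebra, monoid_mult} \<Rightarrow> (complex \<Rightarrow> 'a) \<Rightarrow> complex \<Rightarrow> bool"
  where "lhol j X z \<longleftrightarrow> (\<exists>A. (X has_derivative (\<lambda>h. cplx j h * A)) (at z))"

definition rhol :: "'a::{real_normed_algebra, monoid_mult} \<Rightarrow> (complex \<Rightarrow> 'a) \<Rightarrow> complex \<Rightarrow> bool"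
  where "rhol j X z \<longleftrightarrow> (\<exists>A. (X has_derivative (\<lambda>h. A * cplx j h)) (at z))"

lemma cplx_commute: "c * j = j * c \<Longrightarrow> c * cplx j h = cplx j h * c"
  by (simp add: cplx_def algebra_simps)

lemma lhol_const: "lhol j (\<lambda>_. c) z"
  unfolding lhol_def by (intro exI[of _ 0]) simp

lemma rhol_const: "rhol j (\<lambda>_. c) z"
  unfolding rhol_def by (intro exI[of _ 0]) simp

lemma cplx_has_derivative: "(cplx j has_derivative cplx j) (at z)"
proof -
  have "bounded_linear (cplx j)"
    unfolding cplx_def[abs_def]
    by (intro bounded_linear_add bounded_linear_compose[OF bounded_linear_scaleR_left]
        bounded_linear_Re bounded_linear_Im)
  then show ?thesis by (rule bounded_linear_imp_has_derivative)
qed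

lemma hol_cplx: "lhol j (cplx j) z" "rhol j (cplx j) z"
  unfolding lhol_def rhol_def using cplx_has_derivative by (auto intro!: exI[of _ 1])

lemma lhol_add:
  assumes "lhol j X z" "lhol j Y z"
  shows "lhol j (\<lambda>z. X z + Y z) z"
proof -
  obtain A B where D: "(X has_derivative (\<lambda>h. cplx j h * A)) (at z)" "(Y has_derivative (\<lambda>h. cplx j h * B)) (at z)"
    using assms unfolding lhol_def by (elim exE) (rule that)
  have "((\<lambda>z. X z + Y z) has_derivative (\<lambda>h. cplx j h * (A + B))) (at z)"
    using has_derivative_add[OF D] by (simp only: distrib_left)
  then show ?thesis unfolding lhol_def by (rule exI)
qed

lemma lhol_scaleR:
  assumes "lhol j X z"
  shows "lhol j (\<lambda>z. r *\<^sub>R X z) z"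
proof -
  obtain A where D: "(X has_derivative (\<lambda>h. cplx j h * A)) (at z)"
    using assms unfolding lhol_def by (elim exE)
  have "((\<lambda>z. r *\<^sub>R X z) has_derivative (\<lambda>h. cplx j h * (r *\<^sub>R A))) (at z)"
    using has_derivative_scaleR_right[OF D, of r] by (simp only: mult_scaleR_right)
  then show ?thesis unfolding lhol_def by (rule exI)
qed

lemma rhol_add:
  assumes "rhol j X z" "rhol j Y z"
  shows "rhol j (\<lambda>z. X z + Y z) z"
proof -
  obtain A B where D: "(X has_derivative (\<lambda>h. A * cplx j h)) (at z)" "(Y has_derivative (\<lambda>h. B * cplx j h)) (at z)"
    using assms unfolding rhol_def by (elim exE) (rule that)
  have "((\<lambda>z. X z + Y z) has_derivative (\<lambda>h. (A + B) * cplx j h)) (at z)"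
    using has_derivative_add[OF D] by (simp only: distrib_right)
  then show ?thesis unfolding rhol_def by (rule exI)
qed

lemma rhol_scaleR:
  assumes "rhol j X z"
  shows "rhol j (\<lambda>z. r *\<^sub>R X z) z"
proof -
  obtain A where D: "(X has_derivative (\<lambda>h. A * cplx j h)) (at z)"
    using assms unfolding rhol_def by (elim exE)
  have "((\<lambda>z. r *\<^sub>R X z) has_derivative (\<lambda>h. (r *\<^sub>R A) * cplx j h)) (at z)"
    using has_derivative_scaleR_right[OF D, of r] by (simp only: mult_scaleR_left)
  then show ?thesis unfolding rhol_def by (rule exI)
qed

text \<open>In the product rule the increment coming from Y has to pass X z to reach the left end,
  so it is the left factor that must commute with j. For \<open>rhol_mult\<close> it is the right
  one.\<close>

lemma lhol_mult:
  assumes "lhol j X z" "lhol j Y z" and comm: "X z * j = j * X z"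
  shows "lhol j (\<lambda>z. X z * Y z) z"
proof -
  obtain A B where D: "(X has_derivative (\<lambda>h. cplx j h * A)) (at z)" "(Y has_derivative (\<lambda>h. cplx j h * B)) (at z)"
    using assms(1,2) unfolding lhol_def by (elim exE) (rule that)
  have eq: "X z * (cplx j h * B) + cplx j h * A * Y z = cplx j h * (X z * B + A * Y z)" for h
    unfolding mult.assoc[symmetric] cplx_commute[OF comm, of h] distrib_left ..
  have "((\<lambda>z. X z * Y z) has_derivative (\<lambda>h. cplx j h * (X z * B + A * Y z))) (at z)"
    using has_derivative_mult[OF D] unfolding eq .
  then show ?thesis unfolding lhol_def by (rule exI)
qed

lemma rhol_mult:
  assumes "rhol j X z" "rhol j Y z" and comm: "Y z * j = j * Y z"
  shows "rhol j (\<lambda>z. X z * Y z) z"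
proof -
  obtain A B where D: "(X has_derivative (\<lambda>h. A * cplx j h)) (at z)" "(Y has_derivative (\<lambda>h. B * cplx j h)) (at z)"
    using assms(1,2) unfolding rhol_def by (elim exE) (rule that)
  have eq: "X z * (B * cplx j h) + A * cplx j h * Y z = (X z * B + A * Y z) * cplx j h" for h
    unfolding mult.assoc cplx_commute[OF comm, of h, symmetric] distrib_right ..
  have "((\<lambda>z. X z * Y z) has_derivative (\<lambda>h. (X z * B + A * Y z) * cplx j h)) (at z)"
    using has_derivative_mult[OF D] unfolding eq .
  then show ?thesis unfolding rhol_def by (rule exI)
qed

lemma lhol_power:
  assumes "lhol j X z" "X z * j = j * X z"
  shows "lhol j (\<lambda>z. X z ^ n) z"
  by (induction n) (auto intro!: lhol_const lhol_mult assms)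

lemma rhol_power:
  assumes "rhol j X z" "X z * j = j * X z"
  shows "rhol j (\<lambda>z. X z ^ n) z"
  by (induction n) (auto intro!: rhol_const rhol_mult assms power_commuting_commutes)

text \<open>The derivative of the inverse is a sandwich - y dX y. The inverse y commutes with j
  along with X z, so the increment can leave the sandwich on either side.\<close>

lemma hol_alg_inverse:
  fixes X :: "complex \<Rightarrow> 'a::{banach, real_normed_algebra, monoid_mult}"
  assumes inv: "alg_invertible (X z)" and comm: "X z * j = j * X z"
  shows "lhol j X z \<Longrightarrow> lhol j (\<lambda>z. alg_inverse (X z)) z"
    and "rhol j X z \<Longrightarrow> rhol j (\<lambda>z. alg_inverse (X z)) z"
proof -
  let ?y = "alg_inverse (X z)"
  have c: "?y * cplx j h = cplx j h * ?y" for h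
    by (rule cplx_commute[OF alg_inverse_commute[OF inv comm]])
  show "lhol j (\<lambda>z. alg_inverse (X z)) z" if X: "lhol j X z"
  proof -
    obtain A where D: "(X has_derivative (\<lambda>h. cplx j h * A)) (at z)"
      using X unfolding lhol_def by (elim exE)
    have eq: "- (?y * (cplx j h * A) * ?y) = cplx j h * (- (?y * A * ?y))" for h
      by (simp only: mult.assoc[symmetric] c mult_minus_right)
    have "((\<lambda>z. alg_inverse (X z)) has_derivative (\<lambda>h. cplx j h * (- (?y * A * ?y)))) (at z)"
      using has_derivative_alg_inverse[OF D inv] unfolding eq .
    then show ?thesis unfolding lhol_def by (rule exI)
  qed
  show "rhol j (\<lambda>z. alg_inverse (X z)) z" if X: "rhol j X z"
  proof -
    obtain A where D: "(X has_derivative (\<lambda>h. A * cplx j h)) (at z)"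
      using X unfolding rhol_def by (elim exE)
    have eq: "- (?y * (A * cplx j h) * ?y) = (- (?y * A * ?y)) * cplx j h" for h
      by (simp only: mult.assoc c[symmetric] mult_minus_left)
    have "((\<lambda>z. alg_inverse (X z)) has_derivative (\<lambda>h. (- (?y * A * ?y)) * cplx j h)) (at z)"
      using has_derivative_alg_inverse[OF D inv] unfolding eq .
    then show ?thesis unfolding rhol_def by (rule exI)
  qed
qed

section \<open>Reflection of cycles\<close>

text \<open>The coefficients come from expanding X (dx + j dy) (- j) Y, where j (- j) = 1. The
  increments of both factors appear between X and Y, next to j, with which they commute.\<close>

lemma cr_pair_product:
  fixes X Y :: "complex \<Rightarrow> 'a::{real_normed_algebra, monoid_mult}"
  assumes j: "j * j = - 1" and X: "\<And>z. z \<in> S \<Longrightarrow> rhol j X z" and Y: "\<And>z. z \<in> S \<Longrightarrow> lhol j Y z"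
  shows "cr_pair S (\<lambda>z. X z * (- j) * Y z) (\<lambda>z. X z * Y z)"
  unfolding cr_pair_def
proof
  fix z assume z: "z \<in> S"
  obtain A where A: "(X has_derivative (\<lambda>h. A * cplx j h)) (at z)"
    using X[OF z] unfolding rhol_def by (elim exE)
  obtain B where B: "(Y has_derivative (\<lambda>h. cplx j h * B)) (at z)"
    using Y[OF z] unfolding lhol_def by (elim exE)
  have jj: "j * (j * x) = - x" for x using j by (simp flip: mult.assoc)
  define U where "U = - (A * j * Y z) - X z * j * B"
  define V where "V = A * Y z + X z * B"
  have 1: "X z * (- j) * (cplx j h * B) + A * cplx j h * (- j) * Y z = Re h *\<^sub>R U + Im h *\<^sub>R V" for h
    unfolding U_def V_def cplx_def by (simp add: algebra_simps jj)
  have 2: "X z * (cplx j h * B) + A * cplx j h * Y z = Re h *\<^sub>R V - Im h *\<^sub>R U" for h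
    unfolding U_def V_def cplx_def by (simp add: algebra_simps jj)
  have "((\<lambda>z. X z * (- j) * Y z) has_derivative (\<lambda>h. Re h *\<^sub>R U + Im h *\<^sub>R V)) (at z)"
    using has_derivative_mult[OF has_derivative_mult_left[OF A, of "- j"] B] unfolding 1 .
  moreover have "((\<lambda>z. X z * Y z) has_derivative (\<lambda>h. Re h *\<^sub>R V - Im h *\<^sub>R U)) (at z)"
    using has_derivative_mult[OF A B] unfolding 2 .
  ultimately show "\<exists>U V. ((\<lambda>z. X z * (- j) * Y z) has_derivative (\<lambda>h. Re h *\<^sub>R U + Im h *\<^sub>R V)) (at z) \<and>
      ((\<lambda>z. X z * Y z) has_derivative (\<lambda>h. Re h *\<^sub>R V - Im h *\<^sub>R U)) (at z)"
    by blast
qed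

lemma form_integrand_product:
  fixes X Y :: "complex \<Rightarrow> 'a::{real_normed_algebra, monoid_mult}"
  assumes j: "j * j = - 1"
  shows "form_integrand (\<lambda>z. X z * (- j) * Y z) (\<lambda>z. X z * Y z) \<gamma> t
    = X (\<gamma> t) * (cplx j (vector_derivative \<gamma> (at t)) * (- j)) * Y (\<gamma> t)"
  unfolding form_integrand_def cplx_def by (simp add: j algebra_simps)

section \<open>Conjugating curves, forms and cycles\<close>

lemma valid_path_differentiable:
  assumes "valid_path \<gamma>"
  obtains N where "finite N" "\<And>t. t \<in> {0..1} - N \<Longrightarrow> \<gamma> differentiable at t"
  using assms unfolding valid_path_def piecewise_C1_differentiable_on_def C1_differentiable_on_eq
  by blast

text \<open>Conjugation keeps the real part of the velocity and negates the imaginary part. With the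
  opposite parities of P and Q in \<open>sym\<close> both terms of the integrand change
  sign.\<close>

lemma form_integral_cnj:
  fixes P Q P' Q' :: "complex \<Rightarrow> 'a::banach"
  assumes \<gamma>: "valid_path \<gamma>"
    and sym: "\<And>z. z \<in> path_image \<gamma> \<Longrightarrow> P (cnj z) = - P' z \<and> Q (cnj z) = Q' z"
  shows "integral {0..1} (form_integrand P Q (cnj \<circ> \<gamma>)) = - integral {0..1} (form_integrand P' Q' \<gamma>)"
proof -
  obtain N where N: "finite N" "\<And>t. t \<in> {0..1} - N \<Longrightarrow> \<gamma> differentiable at t"
    using valid_path_differentiable[OF \<gamma>] by blast
  have "integral {0..1} (form_integrand P Q (cnj \<circ> \<gamma>)) = integral {0..1} (\<lambda>t. - form_integrand P' Q' \<gamma> t)"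
  \<comment> \<open>The conjugated velocity is known only where the path is differentiable; the
    finite exceptional set does not affect the integral.\<close>
  proof (rule integral_spike[OF negligible_finite[OF N(1)]])
    fix t assume t: "t \<in> {0..1} - N"
    then have "\<gamma> t \<in> path_image \<gamma>" by (auto simp: path_image_def)
    then show "- form_integrand P' Q' \<gamma> t = form_integrand P Q (cnj \<circ> \<gamma>) t"
      using sym vector_derivative_cnj[OF N(2)[OF t]] by (simp add: form_integrand_def o_def)
  qed
  then show ?thesis by simp
qed

lemma winding_sum_cnj:
  assumes "cycle_in S \<Gamma>" "z \<notin> S"
  shows "winding_sum (map ((\<circ>) cnj) \<Gamma>) (cnj z) = - cnj (winding_sum \<Gamma> z)"
  using assms
proof (induction \<Gamma>)
  case (Cons \<gamma> \<Gamma>)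
  then have "winding_number (cnj \<circ> \<gamma>) (cnj z) = - cnj (winding_number \<gamma> z)"
    by (intro winding_number_cnj) (auto simp: cycle_in_def valid_path_imp_path)
  with Cons show ?case by (simp add: winding_sum_def cycle_in_def o_def)
qed (simp add: winding_sum_def)

lemma cycle_in_cnj:
  assumes "cycle_in S \<Gamma>" "\<And>z. z \<in> S \<Longrightarrow> cnj z \<in> S"
  shows "cycle_in S (map ((\<circ>) cnj) \<Gamma>)"
  using assms by (auto simp: cycle_in_def valid_path_cnj path_image_compose pathstart_compose pathfinish_compose)

text \<open>Reflection turns a winding sum into minus its conjugate, so \<Gamma> together with the
  mirror image of \<Gamma>' is null-homologous in S. Cauchy's theorem equates the integral over
  \<Gamma> with minus that over the mirror image, which is the integral of P', Q' over
  \<Gamma>'.\<close>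

lemma form_cycle_reflect:
  fixes P Q P' Q' :: "complex \<Rightarrow> 'a::banach"
  assumes S: "open S" "\<And>z. z \<in> S \<Longrightarrow> cnj z \<in> S" and cr: "cr_pair S P Q"
    and sym: "\<And>z. z \<in> S \<Longrightarrow> P (cnj z) = - P' z \<and> Q (cnj z) = Q' z"
    and \<Gamma>: "cycle_in S \<Gamma>" "cycle_in S \<Gamma>'"
    and w: "\<And>z. z \<notin> S \<Longrightarrow> winding_sum \<Gamma> z = cnj (winding_sum \<Gamma>' (cnj z))"
  shows "(\<Sum>\<gamma>\<leftarrow>\<Gamma>. integral {0..1} (form_integrand P Q \<gamma>)) = (\<Sum>\<gamma>\<leftarrow>\<Gamma>'. integral {0..1} (form_integrand P' Q' \<gamma>))"
proof -
  let ?\<Delta> = "map ((\<circ>) cnj) \<Gamma>'"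
  have "(\<Sum>\<gamma>\<leftarrow>\<Gamma> @ ?\<Delta>. integral {0..1} (form_integrand P Q \<gamma>)) = 0"
  proof (rule Cauchy_theorem_form_cycle[OF S(1) cr])
    show "cycle_in S (\<Gamma> @ ?\<Delta>)" using \<Gamma>(1) cycle_in_cnj[OF \<Gamma>(2) S(2)] by (auto simp: cycle_in_def)
    fix z assume z: "z \<notin> S"
    then have "cnj z \<notin> S" using S(2)[of "cnj z"] by auto
    from winding_sum_cnj[OF \<Gamma>(2) this] w[OF z] show "winding_sum (\<Gamma> @ ?\<Delta>) z = 0"
      by (simp add: winding_sum_def)
  qed
  moreover have "(\<Sum>\<gamma>\<leftarrow>?\<Delta>. integral {0..1} (form_integrand P Q \<gamma>))
      = (\<Sum>\<gamma>\<leftarrow>\<Gamma>'. - integral {0..1} (form_integrand P' Q' \<gamma>))"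
    unfolding map_map
  proof (intro arg_cong[of _ _ sum_list] map_cong refl)
    fix \<gamma> assume "\<gamma> \<in> set \<Gamma>'"
    then have "valid_path \<gamma>" "path_image \<gamma> \<subseteq> S" using \<Gamma>(2) by (auto simp: cycle_in_def)
    then show "((\<lambda>\<gamma>. integral {0..1} (form_integrand P Q \<gamma>)) \<circ> (\<circ>) cnj) \<gamma> = - integral {0..1} (form_integrand P' Q' \<gamma>)"
      using form_integral_cnj[of \<gamma> P P' Q Q'] sym by (auto simp: subset_iff)
  qed
  moreover have "(\<Sum>\<gamma>\<leftarrow>\<Gamma>'. - integral {0..1} (form_integrand P' Q' \<gamma>))
      = - (\<Sum>\<gamma>\<leftarrow>\<Gamma>'. integral {0..1} (form_integrand P' Q' \<gamma>))"
    by (simp add: uminus_sum_list_map o_def)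
  ultimately show ?thesis by simp
qed

lemma form_cycle_add:
  fixes P Q P' Q' :: "complex \<Rightarrow> 'a::banach"
  assumes S: "open S" and cr: "cr_pair S P Q" "cr_pair S P' Q'" and \<Gamma>: "cycle_in S \<Gamma>"
  shows "(\<Sum>\<gamma>\<leftarrow>\<Gamma>. integral {0..1} (form_integrand P Q \<gamma>)) + (\<Sum>\<gamma>\<leftarrow>\<Gamma>. integral {0..1} (form_integrand P' Q' \<gamma>))
    = (\<Sum>\<gamma>\<leftarrow>\<Gamma>. integral {0..1} (form_integrand (\<lambda>z. P z + P' z) (\<lambda>z. Q z + Q' z) \<gamma>))"
  unfolding sum_list_addf[symmetric]
proof (intro arg_cong[of _ _ sum_list] map_cong refl)
  fix \<gamma> assume "\<gamma> \<in> set \<Gamma>"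
  then have "valid_path \<gamma>" "path_image \<gamma> \<subseteq> S" using \<Gamma> by (auto simp: cycle_in_def)
  then have "form_integrand P Q \<gamma> integrable_on {0..1}" "form_integrand P' Q' \<gamma> integrable_on {0..1}"
    using form_integrable S cr by blast+
  then have "integral {0..1} (form_integrand P Q \<gamma>) + integral {0..1} (form_integrand P' Q' \<gamma>)
      = integral {0..1} (\<lambda>t. form_integrand P Q \<gamma> t + form_integrand P' Q' \<gamma> t)"
    by (rule integral_add[symmetric])
  also have "(\<lambda>t. form_integrand P Q \<gamma> t + form_integrand P' Q' \<gamma> t)
      = form_integrand (\<lambda>z. P z + P' z) (\<lambda>z. Q z + Q' z) \<gamma>"
    by (rule ext) (simp add: form_integrand_def algebra_simps)
  finally show "integral {0..1} (form_integrand P Q \<gamma>) + integral {0..1} (form_integrand P' Q' \<gamma>)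
      = integral {0..1} (form_integrand (\<lambda>z. P z + P' z) (\<lambda>z. Q z + Q' z) \<gamma>)" .
qed

text \<open>Reflecting a cycle in the real axis replaces the unit \<open>I\<close> by \<open>-I\<close> and reverses the orientation,
  so the integrals over the slices \<open>I\<close> and \<open>-I\<close> agree; their sum only involves the integrands
  \<open>P I + P (-I)\<close> and \<open>Q I + Q (-I)\<close>, which no longer depend on \<open>I\<close>.\<close>

lemma form_cycle_independent:
  fixes P Q :: "'i::real_normed_vector \<Rightarrow> complex \<Rightarrow> 'a::banach"
  assumes S: "open S" "\<And>z. z \<in> S \<Longrightarrow> cnj z \<in> S" and K: "\<And>I. I \<in> K \<Longrightarrow> - I \<in> K"
    and cr: "\<And>I. I \<in> K \<Longrightarrow> cr_pair S (P I) (Q I)"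
    and sym: "\<And>I z. I \<in> K \<Longrightarrow> z \<in> S \<Longrightarrow> P I (cnj z) = - P (- I) z \<and> Q I (cnj z) = Q (- I) z"
    and indep: "\<And>I J z. I \<in> K \<Longrightarrow> J \<in> K \<Longrightarrow> z \<in> S \<Longrightarrow>
      P I z + P (- I) z = P J z + P (- J) z \<and> Q I z + Q (- I) z = Q J z + Q (- J) z"
    and \<Gamma>: "cycle_in S \<Gamma>" "cycle_in S \<Gamma>'"
    and w: "\<And>z. z \<notin> S \<Longrightarrow> winding_sum \<Gamma> z = w z" "\<And>z. z \<notin> S \<Longrightarrow> winding_sum \<Gamma>' z = w z"
      "\<And>z. z \<notin> S \<Longrightarrow> cnj (w (cnj z)) = w z"
    and IJ: "I \<in> K" "J \<in> K"
  shows "(\<Sum>\<gamma>\<leftarrow>\<Gamma>. integral {0..1} (form_integrand (P I) (Q I) \<gamma>))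
    = (\<Sum>\<gamma>\<leftarrow>\<Gamma>'. integral {0..1} (form_integrand (P J) (Q J) \<gamma>))"
proof -
  define F where "F I \<Gamma> = (\<Sum>\<gamma>\<leftarrow>\<Gamma>. integral {0..1} (form_integrand (P I) (Q I) \<gamma>))" for I \<Gamma>
  have nS: "cnj z \<notin> S" if "z \<notin> S" for z using S(2)[of "cnj z"] that by auto
  have swap: "F I \<Delta> = F (- I) \<Delta>'"
    if "I \<in> K" "\<Delta> \<in> {\<Gamma>, \<Gamma>'}" "\<Delta>' \<in> {\<Gamma>, \<Gamma>'}" for I \<Delta> \<Delta>'
    unfolding F_def
  proof (rule form_cycle_reflect[OF S cr[OF that(1)]])
    show "P I (cnj z) = - P (- I) z \<and> Q I (cnj z) = Q (- I) z" if "z \<in> S" for z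
      using sym \<open>I \<in> K\<close> that by blast
    show "cycle_in S \<Delta>" "cycle_in S \<Delta>'" using that \<Gamma> by auto
    show "winding_sum \<Delta> z = cnj (winding_sum \<Delta>' (cnj z))" if "z \<notin> S" for z
      using \<open>\<Delta> \<in> _\<close> \<open>\<Delta>' \<in> _\<close> w that nS[OF that] by auto
  qed
  have plus: "F I \<Gamma> + F (- I) \<Gamma> = F J \<Gamma> + F (- J) \<Gamma>"
    unfolding F_def form_cycle_add[OF S(1) cr[OF IJ(1)] cr[OF K[OF IJ(1)]] \<Gamma>(1)]
      form_cycle_add[OF S(1) cr[OF IJ(2)] cr[OF K[OF IJ(2)]] \<Gamma>(1)]
  proof (intro arg_cong[of _ _ sum_list] map_cong refl integral_cong)
    fix \<gamma> and t :: real assume "\<gamma> \<in> set \<Gamma>" "t \<in> {0..1}"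
    then have "\<gamma> t \<in> S" using \<Gamma>(1) unfolding cycle_in_def path_image_def by blast
    then show "form_integrand (\<lambda>z. P I z + P (- I) z) (\<lambda>z. Q I z + Q (- I) z) \<gamma> t
        = form_integrand (\<lambda>z. P J z + P (- J) z) (\<lambda>z. Q J z + Q (- J) z) \<gamma> t"
      using indep[OF IJ] by (simp add: form_integrand_def)
  qed
  \<comment> \<open>\<open>swap\<close> may change the cycle while it flips the unit; the third
    equation uses this to trade \<Gamma>' for \<Gamma>. Every integral is thereby half of a sum of
    the kind compared in \<open>plus\<close>.\<close>
  have "F I \<Gamma> = F (- I) \<Gamma>" "F J \<Gamma> = F (- J) \<Gamma>" "F J \<Gamma>' = F (- J) \<Gamma>"
    using swap IJ by blast+
  with plus have "F I \<Gamma> + F I \<Gamma> = F J \<Gamma>' + F J \<Gamma>'" by simp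
  then have "2 *\<^sub>R F I \<Gamma> = 2 *\<^sub>R F J \<Gamma>'" by (simp add: scaleR_2)
  then show ?thesis by (simp add: F_def)
qed

lemma product_cycle_independent:
  fixes X Y :: "'i::real_normed_vector \<Rightarrow> complex \<Rightarrow> 'a::{banach, real_normed_algebra, monoid_mult}"
    and j :: "'i \<Rightarrow> 'a"
  assumes S: "open S" "\<And>z. z \<in> S \<Longrightarrow> cnj z \<in> S" and K: "\<And>I. I \<in> K \<Longrightarrow> - I \<in> K"
    and j: "\<And>I. I \<in> K \<Longrightarrow> j I * j I = - 1" "\<And>I. j (- I) = - j I"
    and hol: "\<And>I z. I \<in> K \<Longrightarrow> z \<in> S \<Longrightarrow> rhol (j I) (X I) z" "\<And>I z. I \<in> K \<Longrightarrow> z \<in> S \<Longrightarrow> lhol (j I) (Y I) z"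
    and sym: "\<And>I z. X I (cnj z) = X (- I) z" "\<And>I z. Y I (cnj z) = Y (- I) z"
    and X: "\<And>z. z \<in> S \<Longrightarrow> \<exists>A B. \<forall>I\<in>K. X I z = A + B * j I"
    and Y: "\<And>z. z \<in> S \<Longrightarrow> \<exists>a b. \<forall>I\<in>K. Y I z = a + j I * b"
    and \<Gamma>: "cycle_in S \<Gamma>" "cycle_in S \<Gamma>'"
    and w: "\<And>z. z \<notin> S \<Longrightarrow> winding_sum \<Gamma> z = w z" "\<And>z. z \<notin> S \<Longrightarrow> winding_sum \<Gamma>' z = w z"
      "\<And>z. z \<notin> S \<Longrightarrow> cnj (w (cnj z)) = w z"
    and IJ: "I \<in> K" "J \<in> K"
  defines "\<omega> \<equiv> \<lambda>I \<gamma> t. X I (\<gamma> t) * (cplx (j I) (vector_derivative \<gamma> (at t)) * (- j I)) * Y I (\<gamma> t)"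
  shows "\<forall>\<gamma>\<in>set \<Gamma>. \<omega> I \<gamma> integrable_on {0..1}"
    and "(\<Sum>\<gamma>\<leftarrow>\<Gamma>. integral {0..1} (\<omega> I \<gamma>)) = (\<Sum>\<gamma>\<leftarrow>\<Gamma>'. integral {0..1} (\<omega> J \<gamma>))"
proof -
  define P where "P I z = X I z * (- j I) * Y I z" for I z
  define Q where "Q I z = X I z * Y I z" for I z
  have \<omega>: "\<omega> I \<gamma> = form_integrand (P I) (Q I) \<gamma>" if "I \<in> K" for I \<gamma>
    unfolding \<omega>_def P_def[abs_def] Q_def[abs_def]
    by (rule ext, rule form_integrand_product[OF j(1)[OF that], symmetric])
  have cr: "cr_pair S (P I) (Q I)" if "I \<in> K" for I
    unfolding P_def[abs_def] Q_def[abs_def] using that by (intro cr_pair_product j hol)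
  show "\<forall>\<gamma>\<in>set \<Gamma>. \<omega> I \<gamma> integrable_on {0..1}"
    unfolding \<omega>[OF IJ(1)] using \<Gamma>(1) form_integrable[OF S(1) cr[OF IJ(1)]] by (auto simp: cycle_in_def)
  show "(\<Sum>\<gamma>\<leftarrow>\<Gamma>. integral {0..1} (\<omega> I \<gamma>)) = (\<Sum>\<gamma>\<leftarrow>\<Gamma>'. integral {0..1} (\<omega> J \<gamma>))"
    unfolding \<omega>[OF IJ(1)] \<omega>[OF IJ(2)]
  proof (rule form_cycle_independent[where K = K and w = w, OF S K cr])
    show "P I (cnj z) = - P (- I) z \<and> Q I (cnj z) = Q (- I) z" for I z
      by (simp add: P_def Q_def sym j)
    fix I J z assume IJ: "I \<in> K" "J \<in> K" and z: "z \<in> S"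
    obtain A B where AB: "\<And>I. I \<in> K \<Longrightarrow> X I z = A + B * j I" using X[OF z] by blast
    obtain a b where ab: "\<And>I. I \<in> K \<Longrightarrow> Y I z = a + j I * b" using Y[OF z] by blast
    \<comment> \<open>Replacing I by - I replaces j by - j, so only the terms even in j survive;
      there j j = -1 removes the unit.\<close>
    have "P I z + P (- I) z = 2 *\<^sub>R (A * b + B * a) \<and> Q I z + Q (- I) z = 2 *\<^sub>R (A * a - B * b)"
      if I: "I \<in> K" for I
    proof -
      have jj: "j I * (j I * x) = - x" for x using j(1)[OF I] by (simp flip: mult.assoc)
      show ?thesis
        unfolding P_def Q_def AB[OF I] ab[OF I] AB[OF K[OF I]] ab[OF K[OF I]] j(2)
        by (simp add: algebra_simps jj scaleR_2)
    qed
    then show "P I z + P (- I) z = P J z + P (- J) z \<and> Q I z + Q (- I) z = Q J z + Q (- J) z"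
      using IJ by simp
  qed (use \<Gamma> w IJ in auto)
qed

section \<open>Clifford algebras\<close>

lemma coef_sum: "coef (\<Sum>i\<in>S. f i) A = (\<Sum>i\<in>S. coef (f i) A)"
  for f :: "'i \<Rightarrow> ('a::real_normed_vector, 'n::finite) cliff"
  by (induction S rule: infinite_finite_induct) simp_all

lemma coef_mult: "coef (x * y) C = (\<Sum>A\<in>UNIV. csign A (sym_diff A C) *\<^sub>R (coef x A * coef y (sym_diff A C)))"
  by (simp add: times_cliff_def cprod.rep_eq)

lemma coef_cembed: "coef (cembed a) A = coef a A *\<^sub>R 1"
  by (simp add: cembed_def Cliff_inverse)

lemma cembed_simps:
  "cembed (a + b) = cembed a + cembed b" "cembed (a - b) = cembed a - cembed b"
  "cembed (- a) = - cembed a" "cembed (r *\<^sub>R a) = r *\<^sub>R cembed a" "cembed 0 = 0" "cembed 1 = 1"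
  by (rule cliff_eqI; simp add: coef_cembed scaleR_add_left scaleR_diff_left one_cliff_def coef_cmono)+

lemma cembed_mult: "cembed (a * b) = cembed a * cembed b"
  by (rule cliff_eqI) (simp add: coef_cembed coef_mult scaleR_sum_left mult_ac)

lemma bounded_linear_cembed:
  "bounded_linear (cembed :: (real, 'n::{finite,linorder}) cliff \<Rightarrow> ('v::real_normed_vector endo, 'n) cliff)"
  by (rule bounded_linear_intro[where K = "norm (1 :: 'v endo)"])
    (simp_all add: cembed_simps norm_cliff_def coef_cembed sum_distrib_right)

text \<open>The two elements act on different tensor factors of V \<otimes> \<real>_n.\<close>

lemma cmono_empty_cembed_commute: "cmono {} S * cembed a = cembed a * cmono {} S"
proof (rule cliff_eqI)
  fix C
  have "coef (cmono {} S * cembed a) C = coef a C *\<^sub>R S"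
    unfolding times_cliff_def by (subst cprod_cmono_left) (simp_all add: coef_cembed)
  moreover have "coef (cembed a * cmono {} S) C = (\<Sum>A\<in>UNIV. if A = C then coef a C *\<^sub>R S else 0)"
    unfolding coef_mult by (rule sum.cong) (auto simp: coef_cmono coef_cembed)
  ultimately show "coef (cmono {} S * cembed a) C = coef (cembed a * cmono {} S) C" by simp
qed

text \<open>For squares of sums of anticommuting terms: the off-diagonal terms cancel in pairs. It
  is applied both to \<open>cvec\<close> and to paravector operators.\<close>

lemma sum_symmetrize:
  fixes f :: "'i::finite \<Rightarrow> 'i \<Rightarrow> 'a::real_vector"
  assumes "\<And>i j. f i j + f j i = (if i = j then 2 *\<^sub>R c i else 0)"
  shows "(\<Sum>i\<in>UNIV. \<Sum>j\<in>UNIV. f i j) = (\<Sum>i\<in>UNIV. c i)"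
proof -
  let ?s = "\<Sum>i\<in>UNIV. \<Sum>j\<in>UNIV. f i j"
  have "2 *\<^sub>R ?s = ?s + (\<Sum>i\<in>UNIV. \<Sum>j\<in>UNIV. f j i)"
    by (subst (3) sum.swap) (simp add: scaleR_2)
  also have "\<dots> = (\<Sum>i\<in>UNIV. \<Sum>j\<in>UNIV. if i = j then 2 *\<^sub>R c i else 0)"
    by (simp only: assms flip: sum.distrib)
  also have "\<dots> = 2 *\<^sub>R (\<Sum>i\<in>UNIV. c i)" by (simp add: scaleR_sum_right)
  finally show ?thesis by simp
qed

lemma gen_anticomm: "gen i * gen j + gen j * gen i = (if i = j then 2 *\<^sub>R (- 1) else 0)"
  unfolding gen_relation by (simp add: scaleR_2)

lemma cvec_sq: "cvec I * cvec I = - ((norm I)\<^sup>2 *\<^sub>R 1)"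
proof -
  let ?f = "\<lambda>i j. ((I $ i) *\<^sub>R gen i) * ((I $ j) *\<^sub>R gen j)"
  have "?f i j + ?f j i = (I $ i * I $ j) *\<^sub>R (gen i * gen j + gen j * gen i)" for i j
    by (simp add: algebra_simps)
  then have *: "?f i j + ?f j i = (if i = j then 2 *\<^sub>R (- ((I $ i)\<^sup>2 *\<^sub>R 1)) else 0)" for i j
    unfolding gen_anticomm by (simp add: power2_eq_square)
  have "cvec I * cvec I = (\<Sum>i\<in>UNIV. \<Sum>j\<in>UNIV. ?f i j)"
    unfolding cvec_def by (rule sum_product)
  also have "\<dots> = (\<Sum>i\<in>UNIV. - ((I $ i)\<^sup>2 *\<^sub>R 1))"
    by (rule sum_symmetrize) (rule *)
  also have "\<dots> = - ((norm I)\<^sup>2 *\<^sub>R 1)"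
    by (simp add: sum_negf norm_vec_def L2_set_def sum_nonneg flip: scaleR_sum_left)
  finally show ?thesis .
qed

lemma cvec_simps: "cvec (- I) = - cvec I" "cvec (r *\<^sub>R I) = r *\<^sub>R cvec I"
  by (simp_all add: cvec_def sum_negf scaleR_sum_right)

lemma cmono_singleton: "cmono {i} a = cmono {} a * cembed (gen i)"
  by (rule cliff_eqI) (auto simp: times_cliff_def cprod_cmono_left coef_cembed coef_cmono)

lemma cmono_uminus: "cmono A (- a) = - cmono A a" for a :: "'a::real_normed_vector"
  by (rule cliff_eqI) (simp add: coef_cmono)

text \<open>Since the components commute, the generators' anticommutation cancels the mixed terms
  and leaves T T = - (sum of the squares of the components). The other two conclusions hold because
  T has only coefficients of grade 1.\<close>

lemma BC1_square:
  assumes "T \<in> BC1"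
  obtains S where "T * T = cmono {} S" and "conj_op T = - T" and "\<And>A. even (card A) \<Longrightarrow> coef T A = 0"
proof -
  obtain T0 Tv where T: "T = paraop T0 Tv" and comm: "\<And>i j. Tv i * Tv j = Tv j * Tv i"
    and "coef T {} = 0" using assms unfolding BC1_def BC01_def by blast
  then have T0: "T0 = 0" by (simp add: coef_paraop)
  have 00: "cmono {} 0 = 0" by (rule cliff_eqI) (simp add: coef_cmono)
  have TS: "T = (\<Sum>j\<in>UNIV. cmono {j} (Tv j))" by (simp add: T paraop_def T0 00)
  let ?f = "\<lambda>i j. cmono {i} (Tv i) * cmono {j} (Tv j)"
  have f: "?f i j = cmono {} (Tv i * Tv j) * cembed (gen i * gen j)" for i j
  proof -
    have "?f i j = cmono {} (Tv i) * (cembed (gen i) * cmono {} (Tv j)) * cembed (gen j)"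
      unfolding cmono_singleton by (simp only: mult.assoc)
    also have "\<dots> = cmono {} (Tv i) * cmono {} (Tv j) * cembed (gen i * gen j)"
      unfolding cmono_empty_cembed_commute[symmetric] cembed_mult by (simp only: mult.assoc)
    also have "cmono {} (Tv i) * cmono {} (Tv j) = cmono {} (Tv i * Tv j)"
      by (simp add: cmono_mult_cmono)
    finally show ?thesis .
  qed
  have "?f i j + ?f j i = cmono {} (Tv i * Tv j) * cembed (gen i * gen j + gen j * gen i)" for i j
    unfolding f comm[of j i] cembed_simps by (simp only: distrib_left)
  note f2 = this[unfolded gen_anticomm]
  have *: "?f i j + ?f j i = (if i = j then 2 *\<^sub>R cmono {} (- (Tv i * Tv i)) else 0)" for i j
    unfolding f2
  proof (cases "i = j")
    case True
    then show "cmono {} (Tv i * Tv j) * cembed (if i = j then 2 *\<^sub>R - 1 else 0)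
        = (if i = j then 2 *\<^sub>R cmono {} (- (Tv i * Tv i)) else 0)"
      by (simp only: refl if_True cembed_simps cmono_uminus mult_scaleR_right mult_minus_right mult_1_right)
  qed (simp add: cembed_simps)
  have "T * T = (\<Sum>i\<in>UNIV. \<Sum>j\<in>UNIV. ?f i j)" unfolding TS by (rule sum_product)
  also have "\<dots> = (\<Sum>i\<in>UNIV. cmono {} (- (Tv i * Tv i)))" by (rule sum_symmetrize) (rule *)
  also have "\<dots> = cmono {} (\<Sum>i\<in>UNIV. - (Tv i * Tv i))"
    by (rule cliff_eqI) (simp add: coef_sum coef_cmono)
  finally have 1: "T * T = cmono {} (\<Sum>i\<in>UNIV. - (Tv i * Tv i))" .
  have c: "coef T {} = 0" "coef T {i} = Tv i" for i by (simp_all add: T coef_paraop T0)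
  have "conj_op T = (\<Sum>j\<in>UNIV. - cmono {j} (Tv j))"
    by (simp add: conj_op_def paraop_def c 00 cmono_uminus)
  also have "\<dots> = - T" by (simp only: TS sum_negf)
  finally have 2: "conj_op T = - T" .
  have 3: "coef T A = 0" if "even (card A)" for A
    using that by (auto simp: TS coef_sum coef_cmono intro!: sum.neutral)
  show ?thesis using that[OF 1 2 3] .
qed

section \<open>The grade involution\<close>

definition grade_inv :: "('a::real_normed_vector, 'n::finite) cliff \<Rightarrow> ('a, 'n) cliff"
  where "grade_inv x = Cliff (\<lambda>A. (- 1) ^ card A *\<^sub>R coef x A)"

lemma coef_grade_inv: "coef (grade_inv x) A = (- 1) ^ card A *\<^sub>R coef x A"
  by (simp add: grade_inv_def Cliff_inverse)

lemma sign_card_sym_diff: "(- 1 :: real) ^ card (sym_diff A B) = (- 1) ^ card A * (- 1) ^ card B"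
  for A B :: "'n::finite set"
proof -
  have *: "(- 1 :: real) ^ card A = (\<Prod>i\<in>UNIV. if i \<in> A then - 1 else 1)" for A :: "'n set"
    by (simp add: prod.If_cases)
  show ?thesis unfolding * prod.distrib[symmetric] by (rule prod.cong) auto
qed

text \<open>The parity of the grade is additive under \<open>sym_diff\<close>, so the signs of the
  factors multiply to the sign of the product. Being an automorphism, the involution preserves
  invertibility.\<close>

lemma grade_inv_mult: "grade_inv (x * y) = grade_inv x * grade_inv y"
  for x :: "('a::real_normed_algebra, 'n::{finite,linorder}) cliff"
proof (rule cliff_eqI)
  fix C :: "'n set"
  have sgn: "(- 1 :: real) ^ card C = (- 1) ^ card A * (- 1) ^ card (sym_diff A C)" for A :: "'n set"
    unfolding sign_card_sym_diff[symmetric] by (rule arg_cong[of _ _ "\<lambda>X. (- 1) ^ card X"]) auto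
  have "(- 1 :: real) ^ card C *\<^sub>R (csign A (sym_diff A C) *\<^sub>R (coef x A * coef y (sym_diff A C)))
      = csign A (sym_diff A C) *\<^sub>R (coef (grade_inv x) A * coef (grade_inv y) (sym_diff A C))" for A
    unfolding sgn[of A] by (simp add: coef_grade_inv mult_ac)
  then show "coef (grade_inv (x * y)) C = coef (grade_inv x * grade_inv y) C"
    by (simp only: coef_mult coef_grade_inv[of "x * y"] scaleR_sum_right)
qed

lemma grade_inv_simps:
  "grade_inv (x + y) = grade_inv x + grade_inv y" "grade_inv (x - y) = grade_inv x - grade_inv y"
  "grade_inv (r *\<^sub>R x) = r *\<^sub>R grade_inv x"
  by (rule cliff_eqI; simp add: coef_grade_inv algebra_simps)+

lemma grade_inv_one: "grade_inv 1 = 1"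
  by (rule cliff_eqI) (simp add: coef_grade_inv one_cliff_def coef_cmono)

lemma alg_invertible_grade_inv:
  assumes "alg_invertible x" shows "alg_invertible (grade_inv x)"
  using assms unfolding alg_invertible_def by (metis grade_inv_mult grade_inv_one)

lemma grade_inv_BC1:
  assumes "T \<in> BC1" shows "grade_inv T = - T"
proof (rule cliff_eqI)
  fix A
  obtain S where "\<And>A. even (card A) \<Longrightarrow> coef T A = 0" using BC1_square[OF assms] by blast
  then show "coef (grade_inv T) A = coef (- T) A"
    by (cases "even (card A)") (simp_all add: coef_grade_inv)
qed

section \<open>Slice points and imaginary units inside the operator algebra\<close>

lemma paravec_slice_pt: "paravec (slice_pt I z) = Re z *\<^sub>R 1 + Im z *\<^sub>R cvec I"
  by (simp add: paravec_def slice_pt_def cvec_simps)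

lemma cembed_paravec: "cembed (paravec (slice_pt I z)) = cplx (cembed (cvec I)) z"
  by (simp add: paravec_slice_pt cplx_def cembed_simps)

lemma slice_pt_cnj: "slice_pt I (cnj z) = slice_pt (- I) z"
  by (simp add: slice_pt_def)

lemma unit_sphere_uminus: "I \<in> \<S> \<Longrightarrow> - I \<in> \<S>"
  by (simp add: unit_sphere_def)

lemma unit_j: "I \<in> \<S> \<Longrightarrow> cembed (cvec I) * cembed (cvec I) = - 1"
  by (simp add: unit_sphere_def cvec_sq cembed_simps flip: cembed_mult)

lemma norm_slice_pt: "I \<in> \<S> \<Longrightarrow> norm (slice_pt I z) = cmod z"
  by (simp add: unit_sphere_def slice_pt_def norm_Pair cmod_def power_mult_distrib)

section \<open>The kernels\<close>

abbreviation junit :: "(real, 'n) vec \<Rightarrow> ('v::real_normed_vector endo, 'n::{finite,linorder}) cliff"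
  where "junit I \<equiv> cembed (cvec I)"

lemma fst_slice_pt: "fst (slice_pt I z) = Re z"
  by (simp add: slice_pt_def)

text \<open>The elements that pass through all units at once. \<open>T * T\<close> belongs to it, T
  in general does not; coefficients taken from it can be collected on either side of a unit.\<close>

definition real_commutant :: "('v::real_normed_vector endo, 'n::{finite,linorder}) cliff set"
  where "real_commutant = {x. \<forall>a. x * cembed a = cembed a * x}"

lemma real_commutantD: "x \<in> real_commutant \<Longrightarrow> x * cembed a = cembed a * x"
  by (simp add: real_commutant_def)

lemma real_commutant_closed:
  "x \<in> real_commutant \<Longrightarrow> y \<in> real_commutant \<Longrightarrow> x + y \<in> real_commutant"
  "x \<in> real_commutant \<Longrightarrow> y \<in> real_commutant \<Longrightarrow> x - y \<in> real_commutant"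
  "x \<in> real_commutant \<Longrightarrow> r *\<^sub>R x \<in> real_commutant"
  unfolding real_commutant_def mem_Collect_eq
  by (simp_all only: distrib_left distrib_right left_diff_distrib right_diff_distrib
      mult_scaleR_left mult_scaleR_right simp_thms)

lemma real_commutant_mult:
  assumes "x \<in> real_commutant" "y \<in> real_commutant"
  shows "x * y \<in> real_commutant"
proof -
  have "x * y * cembed a = cembed a * (x * y)" for a
    unfolding mult.assoc real_commutantD[OF assms(2)]
    unfolding mult.assoc[symmetric] real_commutantD[OF assms(1)] ..
  then show ?thesis by (simp add: real_commutant_def)
qed

lemma one_in_real_commutant: "1 \<in> real_commutant"
  by (simp add: real_commutant_def)

lemma zero_in_real_commutant: "0 \<in> real_commutant"
  by (simp add: real_commutant_def)

lemma alg_inverse_in_real_commutant: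
  "x \<in> real_commutant \<Longrightarrow> alg_invertible x \<Longrightarrow> alg_inverse x \<in> real_commutant"
  unfolding real_commutant_def by (auto intro: alg_inverse_commute)

text \<open>The product of the values of \<open>Qc\<close> at \<open>slice_pt I z\<close> and at its conjugate, for every unit \<open>I\<close>.\<close>

definition Qnorm :: "('v::real_normed_vector endo, 'n::{finite,linorder}) cliff \<Rightarrow> complex \<Rightarrow> ('v endo, 'n) cliff"
  where "Qnorm T z = ((cmod z)\<^sup>2)\<^sup>2 *\<^sub>R 1 - (2 * ((Re z)\<^sup>2 - (Im z)\<^sup>2)) *\<^sub>R (T * T) + T * T * (T * T)"

lemma continuous_Qnorm: "continuous_on UNIV (Qnorm T)"
  unfolding Qnorm_def by (intro continuous_intros)

lemma Qnorm_cnj: "Qnorm T (cnj z) = Qnorm T z"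
  by (simp add: Qnorm_def)

context
  fixes T :: "('v::banach endo, 'n::{finite,linorder}) cliff"
  assumes T: "T \<in> BC1"
begin

lemma square_in_real_commutant: "T * T \<in> real_commutant"
proof -
  obtain S where "T * T = cmono {} S" by (rule BC1_square[OF T])
  then show ?thesis unfolding real_commutant_def by (simp only: mem_Collect_eq cmono_empty_cembed_commute simp_thms)
qed

lemma conj_op_BC1: "conj_op T = - T"
  by (rule BC1_square[OF T])

lemma Qnorm_in_real_commutant: "Qnorm T z \<in> real_commutant"
  unfolding Qnorm_def
  by (intro square_in_real_commutant one_in_real_commutant real_commutant_closed real_commutant_mult)

lemma Qc_slice: "Qc (slice_pt I z) T = cplx (junit I) z * cplx (junit I) z - T * T"
  by (simp add: Qc_def pop_def cembed_paravec conj_op_BC1 power2_eq_square)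

lemma Qc_slice_unit:
  assumes "I \<in> \<S>"
  shows "Qc (slice_pt I z) T = (((Re z)\<^sup>2 - (Im z)\<^sup>2) *\<^sub>R 1 - T * T) + (2 * Re z * Im z) *\<^sub>R junit I"
proof -
  have "(2 * Re z * Im z) *\<^sub>R junit I = (Re z * Im z) *\<^sub>R junit I + (Re z * Im z) *\<^sub>R (junit I :: ('v endo, 'n) cliff)"
    by (simp flip: scaleR_add_left)
  then show ?thesis
    unfolding Qc_slice cplx_def by (simp add: algebra_simps unit_j[OF assms] power2_eq_square)
qed

text \<open>The two factors are c + d j and c - d j with c commuting with j, so the product is c^2 +
  d^2 in either order.\<close>

lemma Qc_mult_cnj:
  assumes I: "I \<in> \<S>"
  shows "Qc (slice_pt I z) T * Qc (slice_pt I (cnj z)) T = Qnorm T z"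
    and "Qc (slice_pt I (cnj z)) T * Qc (slice_pt I z) T = Qnorm T z"
proof -
  let ?N = "T * T" and ?j = "junit I :: ('v endo, 'n) cliff"
  \<comment> \<open>\<open>r\<close> and \<open>d\<close> are the real and imaginary parts of z^2,
    whence r^2 + d^2 is the fourth power of the modulus of z.\<close>
  define r where "r = (Re z)\<^sup>2 - (Im z)\<^sup>2"
  define d where "d = 2 * Re z * Im z"
  define c where "c = r *\<^sub>R 1 - ?N"
  have cj: "c * ?j = ?j * c"
    unfolding c_def by (intro real_commutantD square_in_real_commutant one_in_real_commutant real_commutant_closed)
  have Q: "Qc (slice_pt I z) T = c + d *\<^sub>R ?j" "Qc (slice_pt I (cnj z)) T = c - d *\<^sub>R ?j"
    using Qc_slice_unit[OF I, of z] Qc_slice_unit[OF I, of "cnj z"] by (simp_all add: c_def d_def r_def)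
  have cc: "c * c + (d * d) *\<^sub>R 1 = (r * r + d * d) *\<^sub>R 1 - (2 * r) *\<^sub>R ?N + ?N * ?N"
  proof -
    have "(2 * r) *\<^sub>R ?N = r *\<^sub>R ?N + r *\<^sub>R ?N" by (simp flip: scaleR_add_left)
    then show ?thesis unfolding c_def by (simp add: algebra_simps)
  qed
  have "r * r + d * d = ((cmod z)\<^sup>2)\<^sup>2"
    unfolding r_def d_def cmod_power2 by (simp add: power2_eq_square algebra_simps)
  with cc have *: "c * c + (d * d) *\<^sub>R 1 = Qnorm T z"
    unfolding Qnorm_def by (simp add: r_def)
  show "Qc (slice_pt I z) T * Qc (slice_pt I (cnj z)) T = Qnorm T z"
    "Qc (slice_pt I (cnj z)) T * Qc (slice_pt I z) T = Qnorm T z"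
    unfolding Q *[symmetric] by (simp_all add: algebra_simps cj unit_j[OF I])
qed

lemma Qc_inverse:
  assumes "I \<in> \<S>" "alg_invertible (Qnorm T z)"
  shows "alg_invertible (Qc (slice_pt I z) T)"
    and "alg_inverse (Qc (slice_pt I z) T) = Qc (slice_pt I (cnj z)) T * alg_inverse (Qnorm T z)"
  using alg_inverse_factor[of "Qc (slice_pt I z) T" "Qc (slice_pt I (cnj z)) T"]
    Qc_mult_cnj[OF assms(1), of z] assms(2) by simp_all

lemma Qc_commute: "Qc (slice_pt I z) T * junit I = junit I * Qc (slice_pt I z) T"
proof -
  have c: "cplx (junit I) z * junit I = junit I * (cplx (junit I) z :: ('v endo, 'n) cliff)"
    by (rule cplx_commute[symmetric]) (rule refl)
  have N: "T * T * junit I = junit I * (T * T)"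
    by (rule real_commutantD[OF square_in_real_commutant])
  have "cplx (junit I) z * cplx (junit I) z * junit I
      = junit I * (cplx (junit I) z * cplx (junit I) z :: ('v endo, 'n) cliff)"
    by (simp only: mult.assoc c) (simp only: mult.assoc[symmetric] c)
  with N show ?thesis unfolding Qc_slice by (simp only: left_diff_distrib right_diff_distrib)
qed

text \<open>Off the S-spectrum the conjugate factors \<open>T\<^sup>2 \<mp> 2 s\<^sub>0 T + |s|\<^sup>2\<close> of \<open>Qnorm\<close> are exchanged by the
  grade involution, so that they are invertible together.\<close>

lemma alg_invertible_Qnorm:
  assumes I: "I \<in> \<S>" and s: "slice_pt I z \<notin> S_spectrum T"
  shows "alg_invertible (Qnorm T z)"
proof -
  let ?N = "T * T"
  define m where "m = (cmod z)\<^sup>2"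
  define u where "u = 2 * Re z"
  have inv: "alg_invertible (?N - u *\<^sub>R T + m *\<^sub>R 1)"
    using s fst_slice_pt[of I z]
    by (simp add: S_spectrum_def norm_slice_pt[OF I] m_def u_def power2_eq_square[of T])
  have "grade_inv (?N - u *\<^sub>R T + m *\<^sub>R 1) = ?N + u *\<^sub>R T + m *\<^sub>R 1"
    by (simp add: grade_inv_simps grade_inv_mult grade_inv_BC1[OF T] grade_inv_one)
  with alg_invertible_grade_inv[OF inv] have inv': "alg_invertible (?N + u *\<^sub>R T + m *\<^sub>R 1)" by simp
  \<comment> \<open>T commutes with its square, so this is the difference of squares (T^2 + m)^2 -
    (u T)^2.\<close>
  have "(?N - u *\<^sub>R T + m *\<^sub>R 1) * (?N + u *\<^sub>R T + m *\<^sub>R 1)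
      = (m * m) *\<^sub>R 1 + (m + m - u * u) *\<^sub>R ?N + ?N * ?N"
    unfolding scaleR_add_left scaleR_diff_left by (simp add: algebra_simps)
  also have "m * m = ((cmod z)\<^sup>2)\<^sup>2" by (simp add: m_def power2_eq_square)
  also have "m + m - u * u = - (2 * ((Re z)\<^sup>2 - (Im z)\<^sup>2))"
    unfolding m_def u_def cmod_power2 by (simp add: power2_eq_square algebra_simps)
  finally have "(?N - u *\<^sub>R T + m *\<^sub>R 1) * (?N + u *\<^sub>R T + m *\<^sub>R 1) = Qnorm T z"
    by (simp only: Qnorm_def scaleR_minus_left add_uminus_conv_diff)
  with alg_invertible_mult[OF inv inv'] show ?thesis by simp
qed

text \<open>The inverse is the conjugate value of \<open>Qc\<close> times the inverse of
  \<open>Qnorm\<close>, hence p' + q' j with p' and q' commuting with all units; powers are then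
  formed as for complex numbers. It matters that p and q are chosen before I.\<close>

lemma Qc_inverse_power_decomp:
  assumes z: "alg_invertible (Qnorm T z)"
  shows "\<exists>p\<in>real_commutant. \<exists>q\<in>real_commutant. \<forall>I\<in>\<S>.
    alg_inverse (Qc (slice_pt I z) T) ^ m = p + q * junit I"
proof (induction m)
  case 0
  show ?case
    by (intro bexI[of _ 1] bexI[of _ 0]) (simp_all add: one_in_real_commutant zero_in_real_commutant)
next
  case (Suc m)
  then obtain p q where pq: "p \<in> real_commutant" "q \<in> real_commutant"
    and IH: "\<And>I. I \<in> \<S> \<Longrightarrow> alg_inverse (Qc (slice_pt I z) T) ^ m = p + q * junit I" by blast
  define B where "B = alg_inverse (Qnorm T z)"
  have B: "B \<in> real_commutant"
    unfolding B_def by (rule alg_inverse_in_real_commutant[OF Qnorm_in_real_commutant z])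
  define p' where "p' = (((Re z)\<^sup>2 - (Im z)\<^sup>2) *\<^sub>R 1 - T * T) * B"
  define q' where "q' = (- (2 * Re z * Im z)) *\<^sub>R B"
  have pq': "p' \<in> real_commutant" "q' \<in> real_commutant"
    unfolding p'_def q'_def by (intro square_in_real_commutant one_in_real_commutant B real_commutant_closed real_commutant_mult)+
  have "alg_inverse (Qc (slice_pt I z) T) ^ Suc m = (p' * p - q' * q) + (p' * q + q' * p) * junit I"
    if I: "I \<in> \<S>" for I
  proof -
    have inv: "alg_inverse (Qc (slice_pt I z) T) = p' + q' * junit I"
    proof -
      have "alg_inverse (Qc (slice_pt I z) T) = Qc (slice_pt I (cnj z)) T * B"
        unfolding B_def by (rule Qc_inverse(2)[OF I z])
      then show ?thesis
        unfolding Qc_slice_unit[OF I, of "cnj z"] p'_def q'_def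
        by (simp add: algebra_simps real_commutantD[OF B])
    qed
    have "q' * junit I * (q * junit I) = q' * (junit I * q) * junit I" by (simp only: mult.assoc)
    also have "\<dots> = q' * q * (junit I * junit I)"
      by (simp only: mult.assoc real_commutantD[OF pq(2), symmetric])
    finally have 1: "q' * junit I * (q * junit I) = - (q' * q)" by (simp add: unit_j[OF I])
    have 2: "q' * junit I * p = q' * p * junit I"
      by (simp only: mult.assoc real_commutantD[OF pq(1)])
    have "alg_inverse (Qc (slice_pt I z) T) ^ Suc m = (p' + q' * junit I) * (p + q * junit I)"
      by (simp only: power_Suc IH[OF I]) (simp only: inv)
    also have "\<dots> = (p' * p - q' * q) + (p' * q + q' * p) * junit I"
      unfolding distrib_left distrib_right 1 2 by (simp add: mult.assoc)
    finally show ?thesis .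
  qed
  then show ?case using pq pq' by (blast intro: real_commutant_closed real_commutant_mult)
qed

text \<open>As the conjugate of T is - T, the product to expand is (Re z + Im z j + T) (p + q j). T
  need not commute with j, but it stands at the far left, so every unit can be moved to the right.
  For KR the product is mirrored and the units move to the left.\<close>

lemma KL_decomp:
  assumes z: "alg_invertible (Qnorm T z)"
  shows "\<exists>A B. \<forall>I\<in>\<S>. KL \<alpha> (slice_pt I z) T = A + B * junit I"
proof -
  obtain p q where pq: "p \<in> real_commutant" "q \<in> real_commutant"
    and y: "\<And>I. I \<in> \<S> \<Longrightarrow> alg_inverse (Qc (slice_pt I z) T) ^ (\<alpha> + 1) = p + q * junit I"
    using Qc_inverse_power_decomp[OF z] by blast
  let ?k = "kconst CARD('n) \<alpha>"
  have "KL \<alpha> (slice_pt I z) T = ?k *\<^sub>R (Re z *\<^sub>R p + T * p - Im z *\<^sub>R q)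
      + (?k *\<^sub>R (Im z *\<^sub>R p + Re z *\<^sub>R q + T * q)) * junit I" if I: "I \<in> \<S>" for I
  proof -
    have "junit I * q * junit I = - q"
      by (simp add: real_commutantD[OF pq(2), symmetric] mult.assoc unit_j[OF I])
    then show ?thesis
      unfolding KL_def y[OF I] pop_def cembed_paravec conj_op_BC1 cplx_def
      by (simp add: algebra_simps real_commutantD[OF pq(1)])
  qed
  then show ?thesis by blast
qed

lemma KR_decomp:
  assumes z: "alg_invertible (Qnorm T z)"
  shows "\<exists>A B. \<forall>I\<in>\<S>. KR \<alpha> (slice_pt I z) T = A + junit I * B"
proof -
  obtain p q where pq: "p \<in> real_commutant" "q \<in> real_commutant"
    and y: "\<And>I. I \<in> \<S> \<Longrightarrow> alg_inverse (Qc (slice_pt I z) T) ^ (\<alpha> + 1) = p + q * junit I"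
    using Qc_inverse_power_decomp[OF z] by blast
  let ?k = "kconst CARD('n) \<alpha>"
  have "KR \<alpha> (slice_pt I z) T = ?k *\<^sub>R (Re z *\<^sub>R p + p * T - Im z *\<^sub>R q)
      + junit I * (?k *\<^sub>R (Im z *\<^sub>R p + Re z *\<^sub>R q + q * T))" if I: "I \<in> \<S>" for I
  proof -
    have "junit I * (q * junit I) = - q"
      by (simp add: real_commutantD[OF pq(2)] unit_j[OF I] flip: mult.assoc)
    then show ?thesis
      unfolding KR_def y[OF I] pop_def cembed_paravec conj_op_BC1 cplx_def
        real_commutantD[OF pq(2)]
      by (simp add: algebra_simps real_commutantD[OF pq(1)] real_commutantD[OF pq(2)])
  qed
  then show ?thesis by blast
qed

text \<open>The factor s + T need not commute with j. The kernels place it where the product rule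
  does not ask for this: on the left in KL, on the right in KR. The power of the inverse of
  \<open>Qc\<close> does commute with j.\<close>

lemma
  assumes I: "I \<in> \<S>" and z: "alg_invertible (Qnorm T z)"
  shows rhol_KL: "rhol (junit I) (\<lambda>z. KL \<alpha> (slice_pt I z) T) z"
    and lhol_KR: "lhol (junit I) (\<lambda>z. KR \<alpha> (slice_pt I z) T) z"
proof -
  let ?j = "junit I :: ('v endo, 'n) cliff"
  have cj: "cplx ?j z * ?j = ?j * cplx ?j z" by (rule cplx_commute[symmetric]) (rule refl)
  have Q: "lhol ?j (\<lambda>z. Qc (slice_pt I z) T) z" "rhol ?j (\<lambda>z. Qc (slice_pt I z) T) z"
    unfolding Qc_slice diff_conv_add_uminus
    by (intro lhol_add lhol_mult lhol_const rhol_add rhol_mult rhol_const hol_cplx cj)+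
  note inv = Qc_inverse(1)[OF I z]
  note y = alg_inverse_commute[OF inv Qc_commute]
  note yn = power_commuting_commutes[OF y]
  show "rhol ?j (\<lambda>z. KL \<alpha> (slice_pt I z) T) z"
    unfolding KL_def pop_def cembed_paravec conj_op_BC1 diff_minus_eq_add
    by (intro rhol_scaleR rhol_mult rhol_add rhol_const rhol_power hol_cplx yn
        hol_alg_inverse(2)[OF inv Qc_commute Q(2)] y)
  show "lhol ?j (\<lambda>z. KR \<alpha> (slice_pt I z) T) z"
    unfolding KR_def pop_def cembed_paravec conj_op_BC1 diff_minus_eq_add
    by (intro lhol_scaleR lhol_mult lhol_add lhol_const lhol_power hol_cplx yn
        hol_alg_inverse(1)[OF inv Qc_commute Q(1)] y)
qed

end

section \<open>Slice hyperholomorphic functions and slice Cauchy domains\<close>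

lemma slice_pt_mem_unit_independent:
  assumes D: "axially_symmetric D" and IJ: "I \<in> \<S>" "J \<in> \<S>" and z: "slice_pt I z \<in> D"
  shows "slice_pt J z \<in> D"
proof -
  \<comment> \<open>Axial symmetry yields only nonnegative multiples of a unit; a negative imaginary
    part is reached through the unit - J.\<close>
  have *: "(Re z, \<bar>Im z\<bar> *\<^sub>R J') \<in> D" if "J' \<in> \<S>" for J'
    using D z that IJ unfolding axially_symmetric_def slice_pt_def by (fastforce simp: unit_sphere_def)
  show ?thesis
  proof (cases "Im z \<ge> 0")
    case True with *[OF IJ(2)] show ?thesis by (simp add: slice_pt_def)
  next
    case False with *[OF unit_sphere_uminus[OF IJ(2)]] show ?thesis by (simp add: slice_pt_def)
  qed
qed

lemma plane_of_slice:
  assumes "axially_symmetric D" "I \<in> \<S>"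
  shows "(Re z, Im z) \<in> plane_of D \<longleftrightarrow> slice_pt I z \<in> D"
  using slice_pt_mem_unit_independent[OF assms] assms(2) unfolding plane_of_def slice_pt_def by auto

lemma continuous_slice_pt: "continuous_on A (slice_pt I)"
  unfolding slice_pt_def[abs_def] by (intro continuous_intros)

lemma open_slice_set: "open D \<Longrightarrow> open (slice_set I D)"
  using open_vimage[OF _ continuous_slice_pt] unfolding slice_set_def vimage_def by blast

lemma closure_slice_set: "closure (slice_set I U) \<subseteq> slice_set I (closure U)"
proof (rule closure_minimal)
  show "slice_set I U \<subseteq> slice_set I (closure U)"
    unfolding slice_set_def using closure_subset by blast
  show "closed (slice_set I (closure U))"
    using closed_vimage[OF closed_closure continuous_slice_pt] unfolding slice_set_def vimage_def by blast
qed

text \<open>X and Y are the partial derivatives of a and b in the direction u. Total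
  differentiability expresses both differentials through partial derivatives, and the Cauchy-Riemann
  system eliminates those in the direction v.\<close>

lemma slice_components_derivative:
  fixes a b :: "real \<times> real \<Rightarrow> 'a::real_normed_vector"
  assumes "slice_components P a b" "(Re z, Im z) \<in> P"
  obtains X Y where "((\<lambda>z. a (Re z, Im z)) has_derivative (\<lambda>h. Re h *\<^sub>R X - Im h *\<^sub>R Y)) (at z)"
    "((\<lambda>z. b (Re z, Im z)) has_derivative (\<lambda>h. Re h *\<^sub>R Y + Im h *\<^sub>R X)) (at z)"
proof -
  let ?p = "(Re z, Im z)"
  have partials: "((\<lambda>z. c (Re z, Im z)) has_derivative (\<lambda>h. Re h *\<^sub>R partial_u c ?p + Im h *\<^sub>R partial_v c ?p)) (at z)"
    if "c differentiable (at ?p)" for c :: "real \<times> real \<Rightarrow> 'a"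
  proof -
    obtain c' where c': "(c has_derivative c') (at ?p)" using \<open>c differentiable (at ?p)\<close> unfolding differentiable_def by blast
    have lin: "linear c'" using has_derivative_linear[OF c'] .
    have scale: "c' (h, 0) = h *\<^sub>R c' (1, 0)" "c' (0, h) = h *\<^sub>R c' (0, 1)" for h
      unfolding linear_scale[OF lin, symmetric] by simp_all
    have pu: "partial_u c ?p = c' (1, 0)"
    proof -
      have "((\<lambda>t. (t, Im z)) has_derivative (\<lambda>h. (h, 0))) (at (Re z))"
        by (auto intro!: derivative_eq_intros)
      from has_derivative_compose[OF this c'] have "((\<lambda>t. c (t, Im z)) has_vector_derivative c' (1, 0)) (at (Re z))"
        unfolding has_vector_derivative_def scale(1)[symmetric] .
      then show ?thesis unfolding partial_u_def by (simp add: vector_derivative_at)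
    qed
    have pv: "partial_v c ?p = c' (0, 1)"
    proof -
      have "((\<lambda>t. (Re z, t)) has_derivative (\<lambda>h. (0, h))) (at (Im z))"
        by (auto intro!: derivative_eq_intros)
      from has_derivative_compose[OF this c'] have "((\<lambda>t. c (Re z, t)) has_vector_derivative c' (0, 1)) (at (Im z))"
        unfolding has_vector_derivative_def scale(2)[symmetric] .
      then show ?thesis unfolding partial_v_def by (simp add: vector_derivative_at)
    qed
    have "((\<lambda>z. (Re z, Im z)) has_derivative (\<lambda>h. (Re h, Im h))) (at z)"
      by (intro has_derivative_Pair has_derivative_Re has_derivative_Im has_derivative_ident)
    from has_derivative_compose[OF this c'] have "((\<lambda>z. c (Re z, Im z)) has_derivative (\<lambda>h. c' (Re h, Im h))) (at z)" .
    moreover have "c' (Re h, Im h) = Re h *\<^sub>R c' (1, 0) + Im h *\<^sub>R c' (0, 1)" for h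
      unfolding scale[symmetric] linear_add[OF lin, symmetric] by simp
    ultimately show ?thesis by (simp add: pu pv)
  qed
  have ab: "a differentiable (at ?p)" "b differentiable (at ?p)" "partial_u a ?p = partial_v b ?p"
    "partial_v a ?p = - partial_u b ?p"
    using assms unfolding slice_components_def by auto
  show ?thesis
    using that[of "partial_u a ?p" "partial_u b ?p"] partials[OF ab(1)] partials[OF ab(2)] ab(3,4) by simp
qed

text \<open>With X and Y as in \<open>slice_components_derivative\<close>, the differential of a + j
  b is (dx + j dy) (X + j Y): the unit to the left of b becomes a left increment.\<close>

lemma
  fixes f :: "'n pvec \<Rightarrow> (real, 'n::{finite,linorder}) cliff"
  assumes D: "open D" "axially_symmetric D" and f: "left_slice_hyperholomorphic D f"
    and I: "I \<in> \<S>" and z: "slice_pt I z \<in> D"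
  shows left_slice_lhol: "lhol (junit I) (\<lambda>z. cembed (f (slice_pt I z)) :: ('v::real_normed_vector endo, 'n) cliff) z"
    and left_slice_decomp: "\<exists>a b. \<forall>I\<in>\<S>. (cembed (f (slice_pt I z)) :: ('v endo, 'n) cliff) = a + junit I * b"
proof -
  obtain a b where ab: "slice_components (plane_of D) a b"
    and fab: "\<And>I u v. I \<in> \<S> \<Longrightarrow> (u, v) \<in> plane_of D \<Longrightarrow> f (u, v *\<^sub>R I) = a (u, v) + cvec I * b (u, v)"
    using f unfolding left_slice_hyperholomorphic_def by blast
  have f_slice: "(cembed (f (slice_pt J w)) :: ('v endo, 'n) cliff)
      = cembed (a (Re w, Im w)) + junit J * cembed (b (Re w, Im w))"
    if "J \<in> \<S>" "slice_pt J w \<in> D" for J w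
    using fab[of J "Re w" "Im w"] plane_of_slice[OF D(2) that(1), of w] that
    by (simp add: slice_pt_def cembed_simps cembed_mult)
  show "\<exists>a b. \<forall>I\<in>\<S>. (cembed (f (slice_pt I z)) :: ('v endo, 'n) cliff) = a + junit I * b"
    using f_slice slice_pt_mem_unit_independent[OF D(2) I _ z] by blast
  have "(Re z, Im z) \<in> plane_of D" using plane_of_slice[OF D(2) I] z by simp
  from slice_components_derivative[OF ab this] obtain X Y where
    XY: "((\<lambda>z. a (Re z, Im z)) has_derivative (\<lambda>h. Re h *\<^sub>R X - Im h *\<^sub>R Y)) (at z)"
      "((\<lambda>z. b (Re z, Im z)) has_derivative (\<lambda>h. Re h *\<^sub>R Y + Im h *\<^sub>R X)) (at z)" by blast
  let ?j = "junit I :: ('v endo, 'n) cliff"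
  note cd = bounded_linear.has_derivative[OF bounded_linear_cembed]
  have jj: "?j * (?j * x) = - x" for x using unit_j[OF I] by (metis mult.assoc mult_1_left mult_minus_left)
  have eq: "cembed (Re h *\<^sub>R X - Im h *\<^sub>R Y) + ?j * cembed (Re h *\<^sub>R Y + Im h *\<^sub>R X)
      = cplx ?j h * (cembed X + ?j * cembed Y)" for h
    unfolding cplx_def by (simp add: cembed_simps algebra_simps jj)
  have "((\<lambda>z. cembed (a (Re z, Im z)) + ?j * cembed (b (Re z, Im z))) has_derivative
      (\<lambda>h. cplx ?j h * (cembed X + ?j * cembed Y))) (at z)"
    using has_derivative_add[OF cd[OF XY(1)] has_derivative_mult_right[OF cd[OF XY(2)], of ?j]]
    unfolding eq .
  \<comment> \<open>The splitting of f is known only on the slice of D, which is an open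
    neighbourhood of z.\<close>
  then have "((\<lambda>z. cembed (f (slice_pt I z))) has_derivative
      (\<lambda>h. cplx ?j h * (cembed X + ?j * cembed Y))) (at z)"
    by (rule has_derivative_transform_within_open[OF _ open_slice_set[OF D(1), of I]])
      (simp_all add: slice_set_def z f_slice[OF I])
  then show "lhol ?j (\<lambda>z. cembed (f (slice_pt I z))) z" unfolding lhol_def by (rule exI)
qed

lemma
  fixes f :: "'n pvec \<Rightarrow> (real, 'n::{finite,linorder}) cliff"
  assumes D: "open D" "axially_symmetric D" and f: "right_slice_hyperholomorphic D f"
    and I: "I \<in> \<S>" and z: "slice_pt I z \<in> D"
  shows right_slice_rhol: "rhol (junit I) (\<lambda>z. cembed (f (slice_pt I z)) :: ('v::real_normed_vector endo, 'n) cliff) z"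
    and right_slice_decomp: "\<exists>a b. \<forall>I\<in>\<S>. (cembed (f (slice_pt I z)) :: ('v endo, 'n) cliff) = a + b * junit I"
proof -
  obtain a b where ab: "slice_components (plane_of D) a b"
    and fab: "\<And>I u v. I \<in> \<S> \<Longrightarrow> (u, v) \<in> plane_of D \<Longrightarrow> f (u, v *\<^sub>R I) = a (u, v) + b (u, v) * cvec I"
    using f unfolding right_slice_hyperholomorphic_def by blast
  have f_slice: "(cembed (f (slice_pt J w)) :: ('v endo, 'n) cliff)
      = cembed (a (Re w, Im w)) + cembed (b (Re w, Im w)) * junit J"
    if "J \<in> \<S>" "slice_pt J w \<in> D" for J w
    using fab[of J "Re w" "Im w"] plane_of_slice[OF D(2) that(1), of w] that
    by (simp add: slice_pt_def cembed_simps cembed_mult)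
  show "\<exists>a b. \<forall>I\<in>\<S>. (cembed (f (slice_pt I z)) :: ('v endo, 'n) cliff) = a + b * junit I"
    using f_slice slice_pt_mem_unit_independent[OF D(2) I _ z] by blast
  have "(Re z, Im z) \<in> plane_of D" using plane_of_slice[OF D(2) I] z by simp
  from slice_components_derivative[OF ab this] obtain X Y where
    XY: "((\<lambda>z. a (Re z, Im z)) has_derivative (\<lambda>h. Re h *\<^sub>R X - Im h *\<^sub>R Y)) (at z)"
      "((\<lambda>z. b (Re z, Im z)) has_derivative (\<lambda>h. Re h *\<^sub>R Y + Im h *\<^sub>R X)) (at z)" by blast
  let ?j = "junit I :: ('v endo, 'n) cliff"
  note cd = bounded_linear.has_derivative[OF bounded_linear_cembed]
  have eq: "cembed (Re h *\<^sub>R X - Im h *\<^sub>R Y) + cembed (Re h *\<^sub>R Y + Im h *\<^sub>R X) * ?j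
      = (cembed X + cembed Y * ?j) * cplx ?j h" for h
    unfolding cplx_def by (simp add: cembed_simps algebra_simps unit_j[OF I])
  have "((\<lambda>z. cembed (a (Re z, Im z)) + cembed (b (Re z, Im z)) * ?j) has_derivative
      (\<lambda>h. (cembed X + cembed Y * ?j) * cplx ?j h)) (at z)"
    using has_derivative_add[OF cd[OF XY(1)] has_derivative_mult_left[OF cd[OF XY(2)], of ?j]]
    unfolding eq .
  then have "((\<lambda>z. cembed (f (slice_pt I z))) has_derivative
      (\<lambda>h. (cembed X + cembed Y * ?j) * cplx ?j h)) (at z)"
    by (rule has_derivative_transform_within_open[OF _ open_slice_set[OF D(1), of I]])
      (simp_all add: slice_set_def z f_slice[OF I])
  then show "rhol ?j (\<lambda>z. cembed (f (slice_pt I z))) z" unfolding rhol_def by (rule exI)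
qed

text \<open>Stated through \<open>Qnorm\<close> instead of \<open>S_spectrum\<close>: in this form
  openness, independence of I and symmetry under conjugation can be read off.\<close>

definition slice_resolvent :: "('v::real_normed_vector endo, 'n::{finite,linorder}) cliff \<Rightarrow> 'n pvec set
    \<Rightarrow> (real, 'n) vec \<Rightarrow> complex set"
  where "slice_resolvent T D I = {z. slice_pt I z \<in> D \<and> alg_invertible (Qnorm T z)}"

lemma open_slice_resolvent:
  fixes T :: "('v::banach endo, 'n::{finite,linorder}) cliff"
  assumes "open D"
  shows "open (slice_resolvent T D I)"
proof -
  have "slice_resolvent T D I = slice_set I D \<inter> Qnorm T -` {x. alg_invertible x}"
    by (auto simp: slice_resolvent_def slice_set_def)
  then show ?thesis
    using open_slice_set[OF assms] open_vimage[OF open_alg_invertible continuous_Qnorm] by auto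
qed

lemma slice_resolvent_unit_independent:
  assumes "axially_symmetric D" "I \<in> \<S>" "J \<in> \<S>"
  shows "slice_resolvent T D I = slice_resolvent T D J"
  using assms slice_pt_mem_unit_independent unfolding slice_resolvent_def by blast

lemma slice_resolvent_cnj:
  assumes "axially_symmetric D" "I \<in> \<S>" "z \<in> slice_resolvent T D I"
  shows "cnj z \<in> slice_resolvent T D I"
  using assms slice_pt_mem_unit_independent[OF assms(1,2) unit_sphere_uminus[OF assms(2)], of z]
  by (simp add: slice_resolvent_def slice_pt_cnj Qnorm_cnj)

text \<open>A point outside the set either lies in D with \<open>Qnorm\<close> not invertible, and
  then inside U, or lies off D, and then off the closure of U. So the winding sum there depends on D
  alone, and any two admissible cycles can be compared.\<close>

lemma admissible_cycle:
  fixes T :: "('v::banach endo, 'n::{finite,linorder}) cliff"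
  assumes T: "T \<in> BC1" and adm: "admissible T D U I \<Gamma>"
  shows "cycle_in (slice_resolvent T D I) \<Gamma>"
    and "z \<notin> slice_resolvent T D I \<Longrightarrow> winding_sum \<Gamma> z = (if slice_pt I z \<in> D then 1 else 0)"
proof -
  define W where "W = slice_set I U"
  have U: "open U" "S_spectrum T \<subseteq> U" "closure U \<subseteq> D" and I: "I \<in> \<S>"
    and \<Gamma>: "jordan_boundary \<Gamma> W" "positively_oriented \<Gamma> W"
    using adm unfolding admissible_def slice_cauchy_domain_def W_def by auto
  have W: "open W" "closure W \<subseteq> slice_set I D"
    using open_slice_set[OF U(1), of I] closure_slice_set[of I U] U(3) unfolding W_def slice_set_def by auto
  have inv: "alg_invertible (Qnorm T z)" if "z \<notin> W" for z
    using that U(2) by (intro alg_invertible_Qnorm[OF T I]) (auto simp: W_def slice_set_def)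
  have "frontier W \<subseteq> slice_resolvent T D I"
    using W inv unfolding frontier_def slice_resolvent_def slice_set_def by (auto simp: interior_open)
  then show "cycle_in (slice_resolvent T D I) \<Gamma>"
    using \<Gamma>(1) unfolding cycle_in_def jordan_boundary_def by blast
  show "winding_sum \<Gamma> z = (if slice_pt I z \<in> D then 1 else 0)" if z: "z \<notin> slice_resolvent T D I"
  proof (cases "slice_pt I z \<in> D")
    case True
    then have "z \<in> W" using z inv unfolding slice_resolvent_def by blast
    then show ?thesis using \<Gamma>(2) True unfolding positively_oriented_def winding_sum_def by simp
  next
    case False
    then have "z \<notin> closure W" using W(2) by (auto simp: slice_set_def)
    then show ?thesis using \<Gamma>(2) False unfolding positively_oriented_def winding_sum_def by simp
  qed
qed

lemma cembed_dsI: "cembed (dsI I \<gamma> t) = cplx (junit I) (vector_derivative \<gamma> (at t)) * (- junit I)"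
  by (simp only: dsI_def cembed_mult cembed_paravec cembed_simps)

text \<open>Abstract factors treat both calculi at once: X is the kernel and Y the function in the
  left case, the other way round in the right case.\<close>

lemma boundary_integral_independent:
  fixes T :: "('v::banach endo, 'n::{finite,linorder}) cliff"
    and X Y :: "'n pvec \<Rightarrow> ('v endo, 'n) cliff"
  assumes T: "T \<in> BC1" and D: "open D" "axially_symmetric D"
    and hol: "\<And>I z. I \<in> \<S> \<Longrightarrow> z \<in> slice_resolvent T D I \<Longrightarrow> rhol (junit I) (\<lambda>z. X (slice_pt I z)) z"
      "\<And>I z. I \<in> \<S> \<Longrightarrow> z \<in> slice_resolvent T D I \<Longrightarrow> lhol (junit I) (\<lambda>z. Y (slice_pt I z)) z"
    and X: "\<And>J z. J \<in> \<S> \<Longrightarrow> z \<in> slice_resolvent T D J \<Longrightarrow> \<exists>A B. \<forall>I\<in>\<S>. X (slice_pt I z) = A + B * junit I"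
    and Y: "\<And>J z. J \<in> \<S> \<Longrightarrow> z \<in> slice_resolvent T D J \<Longrightarrow> \<exists>a b. \<forall>I\<in>\<S>. Y (slice_pt I z) = a + junit I * b"
    and g: "\<And>I \<gamma> t. g I \<gamma> t = X (slice_pt I (\<gamma> t)) * cembed (dsI I \<gamma> t) * Y (slice_pt I (\<gamma> t))"
  shows "\<exists>W. \<forall>U I \<Gamma>. admissible T D U I \<Gamma> \<longrightarrow>
    (\<forall>\<gamma>\<in>set \<Gamma>. g I \<gamma> integrable_on {0..1}) \<and> boundary_integral (g I) \<Gamma> = W"
proof -
  have main: "(\<forall>\<gamma>\<in>set \<Gamma>. g I \<gamma> integrable_on {0..1}) \<and> boundary_integral (g I) \<Gamma> = boundary_integral (g J) \<Gamma>'"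
    if adm: "admissible T D U I \<Gamma>" "admissible T D U' J \<Gamma>'" for U I \<Gamma> U' J \<Gamma>'
  proof -
    let ?S = "slice_resolvent T D I"
    have IJ: "I \<in> \<S>" "J \<in> \<S>" using adm by (auto simp: admissible_def)
    have S: "slice_resolvent T D K = ?S" if "K \<in> \<S>" for K
      using slice_resolvent_unit_independent[OF D(2) that IJ(1)] .
    have mem: "slice_pt J z \<in> D \<longleftrightarrow> slice_pt I z \<in> D" "slice_pt I (cnj z) \<in> D \<longleftrightarrow> slice_pt I z \<in> D" for z
      using slice_pt_mem_unit_independent[OF D(2)] IJ unit_sphere_uminus slice_pt_cnj by metis+
    have g': "g I = (\<lambda>\<gamma> t. X (slice_pt I (\<gamma> t)) * (cplx (junit I) (vector_derivative \<gamma> (at t)) * (- junit I))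
        * Y (slice_pt I (\<gamma> t)))" for I
      by (intro ext) (simp only: g cembed_dsI)
    define w :: "complex \<Rightarrow> complex" where "w z = (if slice_pt I z \<in> D then 1 else 0)" for z
    have j: "junit (- K) = - junit K" for K by (simp add: cvec_simps cembed_simps)
    have sym: "X (slice_pt K (cnj z)) = X (slice_pt (- K) z)" "Y (slice_pt K (cnj z)) = Y (slice_pt (- K) z)"
      for K z by (simp_all add: slice_pt_cnj)
    have holI: "rhol (junit K) (\<lambda>z. X (slice_pt K z)) z" "lhol (junit K) (\<lambda>z. Y (slice_pt K z)) z"
      if "K \<in> \<S>" "z \<in> ?S" for K z using hol[OF that(1)] that S by simp_all
    \<comment> \<open>Off \<open>?S\<close> both winding sums are the indicator of D, which is real
      and invariant under conjugation because D is axially symmetric.\<close>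
    have w: "winding_sum \<Gamma> z = w z" "winding_sum \<Gamma>' z = w z" "cnj (w (cnj z)) = w z" if "z \<notin> ?S" for z
      using admissible_cycle(2)[OF T adm(1) that] admissible_cycle(2)[OF T adm(2), of z] that S[OF IJ(2)]
      by (simp_all add: w_def mem)
    have \<Gamma>': "cycle_in ?S \<Gamma>'" using admissible_cycle(1)[OF T adm(2)] S[OF IJ(2)] by simp
    note * = product_cycle_independent[where X = "\<lambda>I z. X (slice_pt I z)" and Y = "\<lambda>I z. Y (slice_pt I z)"
        and j = junit,
        OF open_slice_resolvent[OF D(1)] slice_resolvent_cnj[OF D(2) IJ(1)] unit_sphere_uminus unit_j j
        holI sym X[OF IJ(1)] Y[OF IJ(1)] admissible_cycle(1)[OF T adm(1)] \<Gamma>' w IJ]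
    have "(\<forall>\<gamma>\<in>set \<Gamma>. g I \<gamma> integrable_on {0..1}) \<and>
      (\<Sum>\<gamma>\<leftarrow>\<Gamma>. integral {0..1} (g I \<gamma>)) = (\<Sum>\<gamma>\<leftarrow>\<Gamma>'. integral {0..1} (g J \<gamma>))"
      unfolding g' by (rule conjI; rule *)
    then show ?thesis by (simp add: boundary_integral_def)
  qed
  show ?thesis
  proof (cases "\<exists>U I \<Gamma>. admissible T D U I \<Gamma>")
    case True
    then obtain U' J \<Gamma>' where adm: "admissible T D U' J \<Gamma>'" by (elim exE)
    show ?thesis
      by (rule exI[of _ "boundary_integral (g J) \<Gamma>'"]) (intro allI impI, rule main[OF _ adm])
  next
    case False
    then have "\<not> admissible T D U I \<Gamma>" for U I \<Gamma> by simp
    then show ?thesis by simp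
  qed
qed

theorem theorem7p6:
  fixes T :: "('v::banach endo, 'n::{finite,linorder}) cliff"
    and \<alpha> :: nat
  assumes "odd CARD('n)"
    and "1 \<le> \<alpha>" and "\<alpha> \<le> hn CARD('n) - 1"
    and "T \<in> BC1"
    and "\<And>i. op_spectrum (coef T {i}) \<subseteq> \<real>"
  shows "(\<forall>D f. open D \<and> axially_symmetric D \<and> left_slice_hyperholomorphic D f \<longrightarrow>
            (\<exists>W. \<forall>U I \<Gamma>. admissible T D U I \<Gamma> \<longrightarrow>
               (\<forall>\<gamma>\<in>set \<Gamma>. left_integrand \<alpha> T f I \<gamma> integrable_on {0..1}) \<and>
               boundary_integral (left_integrand \<alpha> T f I) \<Gamma> = W)) \<and>
         (\<forall>D f. open D \<and> axially_symmetric D \<and> right_slice_hyperholomorphic D f \<longrightarrow>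
            (\<exists>W. \<forall>U I \<Gamma>. admissible T D U I \<Gamma> \<longrightarrow>
               (\<forall>\<gamma>\<in>set \<Gamma>. right_integrand \<alpha> T f I \<gamma> integrable_on {0..1}) \<and>
               boundary_integral (right_integrand \<alpha> T f I) \<Gamma> = W))"
proof (intro conjI allI impI)
  fix D and f :: "'n pvec \<Rightarrow> (real, 'n) cliff"
  assume f: "open D \<and> axially_symmetric D \<and> left_slice_hyperholomorphic D f"
  then have D: "open D" "axially_symmetric D" by auto
  show "\<exists>W. \<forall>U I \<Gamma>. admissible T D U I \<Gamma> \<longrightarrow>
     (\<forall>\<gamma>\<in>set \<Gamma>. left_integrand \<alpha> T f I \<gamma> integrable_on {0..1}) \<and>
     boundary_integral (left_integrand \<alpha> T f I) \<Gamma> = W"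
    by (rule boundary_integral_independent[OF assms(4) D, where X = "\<lambda>s. KL \<alpha> s T" and Y = "\<lambda>s. cembed (f s)"])
      (use f in \<open>auto simp: slice_resolvent_def left_integrand_def Let_def
        intro!: rhol_KL[OF assms(4)] KL_decomp[OF assms(4)] left_slice_lhol left_slice_decomp\<close>)
next
  fix D and f :: "'n pvec \<Rightarrow> (real, 'n) cliff"
  assume f: "open D \<and> axially_symmetric D \<and> right_slice_hyperholomorphic D f"
  then have D: "open D" "axially_symmetric D" by auto
  show "\<exists>W. \<forall>U I \<Gamma>. admissible T D U I \<Gamma> \<longrightarrow>
     (\<forall>\<gamma>\<in>set \<Gamma>. right_integrand \<alpha> T f I \<gamma> integrable_on {0..1}) \<and>
     boundary_integral (right_integrand \<alpha> T f I) \<Gamma> = W"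
    by (rule boundary_integral_independent[OF assms(4) D, where X = "\<lambda>s. cembed (f s)" and Y = "\<lambda>s. KR \<alpha> s T"])
      (use f in \<open>auto simp: slice_resolvent_def right_integrand_def Let_def
        intro!: lhol_KR[OF assms(4)] KR_decomp[OF assms(4)] right_slice_rhol right_slice_decomp\<close>)
qed

end
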